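(* Let $F\in\mathcal{S}^\sharp$ have degree $d\ge1$, let $\alpha\in\mathrm{Spec}(F)$ and $\ell\in\{0,1,2,\dots\}$. Then the residue $\rho_\ell(\alpha)$ of $F(s,\alpha)$ at $s=s_\ell^*$ equals \[ \rho_\ell(\alpha)=\frac{d_\ell}{d}\frac{\omega_F}{\sqrt{2\pi}}e^{-i\frac{\pi}{2}(\xi_F+ds_\ell^* )}\Big(\frac{q^{1/d}}{2\pi d}\Big)^{\frac d2-ds_\ell^*}\frac{\overline{a(n_\alpha)}}{n_\alpha^{1-s_\ell^*}}. \] In particular, the set of poles of $F(s,\alpha)$ is independent of $\alpha\in\mathrm{Spec}(F)$ and equals $\{s_\ell^*:d_\ell\ne0\}$.
   Context: Write $s=\sigma+it$, $e(x)=e^{2\pi ix}$, $\overline{f}(s)=\overline{f(\overline{s})}$. The extended Selberg class $\mathcal{S}^\sharp$ consists of non identically vanishing Dirichlet series $F(s)=\sum_{n\ge1}a(n)n^{-s}$, absolutely convergent for $\sigma>1$, such that $(s-1)^mF(s)$ is entire of finite order for some integer $m\ge0$, satisfying $F(s)\gamma(s)=\omega\overline{\gamma}(1-s)\overline{F}(1-s)$ with $\gamma(s)=Q^s\prod_{j=1}^r\Gamma(\lambda_js+\mu_j)$, $|\omega|=1$, $Q>0$, $r\ge0$, $\lambda_j>0$, $\Re\mu_j\ge0$. Invariants: degree $d=2\sum\lambda_j$; conductor $q=(2\pi)^dQ^2\prod\lambda_j^{2\lambda_j}$; $\xi_F=2\sum(\mu_j-\frac12)=\eta_F+id\theta_F$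 ($\eta_F,\theta_F\in\mathbb{R}$); root number $\omega_F=\omega\prod\lambda_j^{-2i\Im\mu_j}$. The standard twist is $F(s,\alpha)=\sum_{n\ge1}a(n)n^{-s}e(-\alpha n^{1/d})$ for $\alpha>0$ (absolutely convergent for $\sigma>1$); it is known to extend meromorphically to $\mathbb{C}$ with at most simple poles, located at the points $s_\ell^*=s_\ell-i\theta_F$, $s_\ell=\frac{d+1}{2d}-\frac{\ell}{d}$ ($\ell=0,1,\dots$). Put $n_\alpha=qd^{-d}\alpha^d$ with $a(n_\alpha)=0$ if $n_\alpha\notin\mathbb{N}$, and $\mathrm{Spec}(F)=\{\alpha>0:a(n_\alpha)\ne0\}$. Let $h_F(s)=\frac{\omega}{(2\pi)^r}Q^{1-2s}\prod_{j=1}^r\Gamma(\lambda_j(1-s)+\overline{\mu}_j)\Gamma(1-\lambda_js-\mu_j)$. The structural coefficients $d_\ell\in\mathbb{C}$ ($\ell\ge0$) are the coefficients of the asymptotic expansion $h_F(s)\approx\frac{\omega_F}{\sqrt{2\pi}}\big(\frac{q^{1/d}}{2\pi d}\big)^{d(\frac12-s)}\sum_{\ell\ge0}d_\ell\Gamma(d(s_\ell^*-s))$, valid for large $|s|$ outside an arbitrarily small angular region containing the positive real axis, meaning that for each $M\ge0$ truncating at $\ell=M$ leaves a meromorphic remainder bounded by the modulus of the $M$-th term times $1/|s|$; in particular $d_0=d^{id\theta_F}$. *)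

theory Defs
  imports "HOL-Complex_Analysis.Complex_Analysis"
begin

definition cexp1 :: "real \<Rightarrow> complex" where
  "cexp1 x = exp (2 * of_real pi * \<i> * of_real x)"

definition conj_fun :: "(complex \<Rightarrow> complex) \<Rightarrow> complex \<Rightarrow> complex" where
  "conj_fun f s = cnj (f (cnj s))"

text \<open>The value of \<open>f 0\<close> is never used for a coefficient sequence; sums start at 1.\<close>

definition dirichlet_abs_conv :: "(nat \<Rightarrow> complex) \<Rightarrow> complex \<Rightarrow> bool" where
  "dirichlet_abs_conv f s \<longleftrightarrow> (\<lambda>n. norm (f n * of_nat n powr (-s))) summable_on {1..}"

definition dirichlet_sum :: "(nat \<Rightarrow> complex) \<Rightarrow> complex \<Rightarrow> complex" where
  "dirichlet_sum f s = (\<Sum>\<^sub>\<infinity>n\<in>{1..}. f n * of_nat n powr (-s))"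

definition entire_finite_order :: "(complex \<Rightarrow> complex) \<Rightarrow> bool" where
  "entire_finite_order H \<longleftrightarrow> H holomorphic_on UNIV \<and>
     (\<exists>C \<rho>. \<forall>s. norm (H s) \<le> C * exp (norm s powr \<rho>))"


text \<open>The data of a functional equation; the families \<lambda> and \<mu> are indexed by
  \<open>j < num_gamma\<close>, and their values at other indices are irrelevant.\<close>

record fe_data =
  fe_Q :: real
  num_gamma :: nat
  fe_lambda :: "nat \<Rightarrow> real"
  fe_mu :: "nat \<Rightarrow> complex"
  fe_omega :: complex

definition valid_fe_data :: "fe_data \<Rightarrow> bool" where
  "valid_fe_data D \<longleftrightarrow> fe_Q D > 0 \<and> norm (fe_omega D) = 1 \<and>
     (\<forall>j<num_gamma D. fe_lambda D j > 0 \<and> Re (fe_mu D j) \<ge> 0)"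

definition gamma_factor :: "fe_data \<Rightarrow> complex \<Rightarrow> complex" where
  "gamma_factor D s = of_real (fe_Q D) powr s *
     (\<Prod>j<num_gamma D. Gamma (of_real (fe_lambda D j) * s + fe_mu D j))"

definition gamma_factor_regular :: "fe_data \<Rightarrow> complex \<Rightarrow> bool" where
  "gamma_factor_regular D s \<longleftrightarrow>
     (\<forall>j<num_gamma D. of_real (fe_lambda D j) * s + fe_mu D j \<notin> \<int>\<^sub>\<le>\<^sub>0)"

text \<open>An identity of meromorphic functions, stated at all points where no factor can have a pole
  (\<^const>\<open>Gamma\<close> has the junk value 0 at its poles, and the value of \<open>F\<close> at 1 is arbitrary).
  The second regularity condition concerns the conjugated gamma factor at \<open>1 - s\<close>.\<close>

definition functional_equation :: "fe_data \<Rightarrow> (complex \<Rightarrow> complex) \<Rightarrow> bool" where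
  "functional_equation D F \<longleftrightarrow>
     (\<forall>s. s \<noteq> 0 \<and> s \<noteq> 1 \<and> gamma_factor_regular D s \<and> gamma_factor_regular D (cnj (1 - s)) \<longrightarrow>
        F s * gamma_factor D s =
          fe_omega D * conj_fun (gamma_factor D) (1 - s) * conj_fun F (1 - s))"

text \<open>\<open>F\<close>, with Dirichlet coefficients \<open>a\<close>, is in the extended Selberg class,
  and \<open>D\<close> is a choice of data for its functional equation.\<close>

definition extended_selberg :: "(nat \<Rightarrow> complex) \<Rightarrow> fe_data \<Rightarrow> (complex \<Rightarrow> complex) \<Rightarrow> bool" where
  "extended_selberg a D F \<longleftrightarrow>
     (\<forall>s. Re s > 1 \<longrightarrow> dirichlet_abs_conv a s \<and> F s = dirichlet_sum a s) \<and>
     (\<exists>s. Re s > 1 \<and> F s \<noteq> 0) \<and>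
     (\<exists>(m::nat) H. entire_finite_order H \<and> (\<forall>s. s \<noteq> 1 \<longrightarrow> (s - 1) ^ m * F s = H s)) \<and>
     valid_fe_data D \<and> functional_equation D F"


definition sel_degree :: "fe_data \<Rightarrow> real" where
  "sel_degree D = 2 * (\<Sum>j<num_gamma D. fe_lambda D j)"

definition sel_conductor :: "fe_data \<Rightarrow> real" where
  "sel_conductor D = (2 * pi) powr sel_degree D * (fe_Q D)\<^sup>2 *
     (\<Prod>j<num_gamma D. fe_lambda D j powr (2 * fe_lambda D j))"

definition sel_xi :: "fe_data \<Rightarrow> complex" where
  "sel_xi D = 2 * (\<Sum>j<num_gamma D. fe_mu D j - 1 / 2)"

definition sel_theta :: "fe_data \<Rightarrow> real" where
  "sel_theta D = Im (sel_xi D) / sel_degree D"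

definition root_number :: "fe_data \<Rightarrow> complex" where
  "root_number D = fe_omega D *
     (\<Prod>j<num_gamma D. of_real (fe_lambda D j) powr (- 2 * \<i> * of_real (Im (fe_mu D j))))"

definition s_star :: "fe_data \<Rightarrow> nat \<Rightarrow> complex" where
  "s_star D l = of_real ((sel_degree D + 1) / (2 * sel_degree D) - real l / sel_degree D)
     - \<i> * of_real (sel_theta D)"


definition n_alpha :: "fe_data \<Rightarrow> real \<Rightarrow> real" where
  "n_alpha D \<alpha> = sel_conductor D * sel_degree D powr (- sel_degree D) * \<alpha> powr sel_degree D"

definition coeff_at :: "(nat \<Rightarrow> complex) \<Rightarrow> real \<Rightarrow> complex" where
  "coeff_at a x = (if x \<in> \<nat> then a (nat \<lfloor>x\<rfloor>) else 0)"

definition Spec :: "(nat \<Rightarrow> complex) \<Rightarrow> fe_data \<Rightarrow> real set" where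
  "Spec a D = {\<alpha>. \<alpha> > 0 \<and> coeff_at a (n_alpha D \<alpha>) \<noteq> 0}"

definition standard_twist_series :: "(nat \<Rightarrow> complex) \<Rightarrow> fe_data \<Rightarrow> real \<Rightarrow> complex \<Rightarrow> complex" where
  "standard_twist_series a D \<alpha> =
     dirichlet_sum (\<lambda>n. a n * cexp1 (- \<alpha> * real n powr (1 / sel_degree D)))"

text \<open>\<open>G\<close> is the standard twist as a meromorphic function on the whole plane. It is unique up to
  its values on a discrete set, which affect neither poles nor residues.\<close>

definition is_standard_twist ::
    "(nat \<Rightarrow> complex) \<Rightarrow> fe_data \<Rightarrow> real \<Rightarrow> (complex \<Rightarrow> complex) \<Rightarrow> bool" where
  "is_standard_twist a D \<alpha> G \<longleftrightarrow>
     G meromorphic_on UNIV \<and> (\<forall>s. Re s > 1 \<longrightarrow> G s = standard_twist_series a D \<alpha> s)"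


definition h_fun :: "fe_data \<Rightarrow> complex \<Rightarrow> complex" where
  "h_fun D s = fe_omega D / of_real ((2 * pi) ^ num_gamma D) * of_real (fe_Q D) powr (1 - 2 * s) *
     (\<Prod>j<num_gamma D. Gamma (of_real (fe_lambda D j) * (1 - s) + cnj (fe_mu D j)) *
                        Gamma (1 - of_real (fe_lambda D j) * s - fe_mu D j))"

definition conductor_base :: "fe_data \<Rightarrow> complex" where
  "conductor_base D =
     of_real (sel_conductor D powr (1 / sel_degree D) / (2 * pi * sel_degree D))"

text \<open>The \<open>l\<close>-th term of the asymptotic scale, without the coefficient \<open>c l\<close>.\<close>

definition structural_term :: "fe_data \<Rightarrow> nat \<Rightarrow> complex \<Rightarrow> complex" where
  "structural_term D l s = root_number D / of_real (sqrt (2 * pi)) *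
     conductor_base D powr (of_real (sel_degree D) * (1 / 2 - s)) *
     Gamma (of_real (sel_degree D) * (s_star D l - s))"

text \<open>The remainder after the term of index \<open>M\<close> is measured against the \<open>M\<close>-th term of the scale
  (not multiplied by \<open>c M\<close>, which may vanish), divided by \<open>norm s\<close>. The implied constant may depend
  on \<open>M\<close> and on the opening \<open>\<epsilon>\<close> of the excluded sector around the positive real axis. These
  conditions determine \<open>c\<close> uniquely.\<close>

definition structural_coeffs :: "fe_data \<Rightarrow> (nat \<Rightarrow> complex) \<Rightarrow> bool" where
  "structural_coeffs D c \<longleftrightarrow>
     (\<forall>M. \<forall>\<epsilon>>0. \<exists>R>0. \<exists>C. \<forall>s. norm s \<ge> R \<and> \<bar>Arg s\<bar> \<ge> \<epsilon> \<longrightarrow>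
        norm (h_fun D s - (\<Sum>l\<le>M. c l * structural_term D l s))
          \<le> C * norm (structural_term D M s) / norm s)"

end

theory Submission
  imports Defs
begin

text \<open>
  For \<open>L = ln (2 \<pi> \<alpha>) + \<i> \<phi>\<close> with \<open>\<bar>\<phi>\<bar> < \<pi> / 2\<close>, the Cahen--Mellin formula writes the damped twist
  \<open>\<Sum>n. a n n powr (-s) exp (- exp L n powr (1/d))\<close> as the integral of
  \<open>F (s + w/d) \<Gamma>(w) exp (- w L)\<close> over a line far to the right. Shift this line far to the left, to
  \<open>Re w = 1/2 - K\<close>: the poles contribute an integral over a fixed rectangle, holomorphic in \<open>s\<close>, and
  on the new line the limit \<open>\<phi> \<longlongrightarrow> \<pi>/2\<close> exists. There the functional equation gives
  \<open>F p = h p S p cnj (F (cnj (1 - p)))\<close> with a product \<open>S\<close> of sines, of which only the exponential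
  dominating in the upper half plane matters. Replacing \<open>h\<close> by its structural expansion, the error
  is holomorphic in \<open>s\<close>, and each structural term becomes a Dirichlet series whose coefficients are
  Mellin--Barnes integrals of \<open>\<Gamma>(u - w) \<Gamma>(w) (-r) powr (-w)\<close>, \<open>r = (n\<^sub>\<alpha> / n) powr (1/d)\<close>,
  \<open>u = d (s\<^sub>l\<^sup>* - s)\<close>. A recurrence \<open>u \<mapsto> u + 1\<close> with leading coefficient \<open>1 - r\<close> continues these
  integrals holomorphically when \<open>r \<noteq> 1\<close> and evaluates them when \<open>r = 1\<close>, that is for \<open>n = n\<^sub>\<alpha>\<close>, where
  the simple pole at \<open>u = 0\<close> appears.
\<close>

subsection \<open>Integrals depending on a parameter\<close>

text \<open>The obstacle is that \<open>\<phi> = \<pi> / 2\<close> is a boundary case. On the line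
  \<open>Re w = x\<close> the product \<open>Gamma (u - w) * Gamma w\<close> times
  \<open>exp (\<pi> Im w)\<close> has, for large \<open>Im w > 0\<close>, the size
  \<open>Im w powr (Re u - 1)\<close> whatever \<open>x\<close> is: all exponentials cancel, and
  moving the line further left gains nothing. Only the order of the structural term counts, because
  each index lowers \<open>Re u\<close> by one. Hence the two treatments of \<open>h\<close>: a late
  truncation makes the remainder absolutely integrable on a whole box of \<open>s\<close>, and the
  finitely many earlier terms are continued by hand. The far left position of the line serves other
  ends: the dual Dirichlet series converges absolutely, \<open>u - w\<close> stays in the right
  half-plane, and the factor \<open>r powr (K - 1/2)\<close> makes the sums over \<open>n\<close>
  converge. The twist is computed for \<open>Re s \<ge> 3\<close>, where all integrals converge, and
  the result is transferred by uniqueness of meromorphic functions. Gamma is estimated without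
  Stirling's formula, from its reflection formula on \<open>Re w = 1/2\<close> and its functional
  equation; hence the half-integral abscissae, which also keep the lines at distance 1/2 from the
  poles.\<close>

lemma power_div_fact_le_exp:
  fixes x :: real
  assumes "x \<ge> 0"
  shows "x ^ n / fact n \<le> exp x"
proof -
  have "x ^ n / fact n = (\<Sum>k\<in>{n}. x ^ k /\<^sub>R fact k)"
    by (simp add: divide_inverse mult.commute)
  also have "\<dots> \<le> (\<Sum>k. x ^ k /\<^sub>R fact k)"
    by (rule sum_le_suminf) (use assms summable_exp_generic[of x] in auto)
  finally show ?thesis
    by (simp add: exp_def)
qed

lemma integrable_inverse_quadratic: "integrable lborel (\<lambda>v::real. 1 / (1 + v\<^sup>2))"
proof -
  let ?g = "\<lambda>x::real. indicator {0..} x * (1 / (1 + x\<^sup>2))"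
  have meas: "(\<lambda>v::real. 1 / (1 + v\<^sup>2)) \<in> borel_measurable borel"
    by measurable
  have "(\<integral>\<^sup>+x. ennreal (1 / (1 + x\<^sup>2)) * indicator {0..} x \<partial>lborel) = ennreal (pi / 2 - arctan 0)"
  proof (rule nn_integral_FTC_atLeast[OF meas])
    show "(arctan has_real_derivative 1 / (1 + x\<^sup>2)) (at x)" for x
      using DERIV_arctan[of x] by (simp add: divide_inverse)
    show "(arctan \<longlongrightarrow> pi / 2) at_top"
      by (rule tendsto_arctan_at_top)
  qed auto
  moreover have "(\<integral>\<^sup>+x. ennreal (1 / (1 + x\<^sup>2)) * indicator {0..} x \<partial>lborel) = (\<integral>\<^sup>+x. ennreal (?g x) \<partial>lborel)"
    by (intro nn_integral_cong) (auto simp: indicator_def)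
  ultimately have g: "integrable lborel ?g"
    by (intro integrableI_nonneg) (simp_all flip: \<open>_ = (\<integral>\<^sup>+x. ennreal (?g x) \<partial>lborel)\<close>)
  have g': "integrable lborel (\<lambda>x. ?g (0 + (-1) * x))"
    using lborel_integrable_real_affine[OF g, of "-1" 0] by simp
  have "integrable lborel (\<lambda>x. ?g x + ?g (0 + (-1) * x))"
    using Bochner_Integration.integrable_add[OF g g'] .
  then show ?thesis
    by (rule Bochner_Integration.integrable_bound) (use meas in \<open>auto simp: indicator_def\<close>)
qed

lemma integrable_quadratic_decay:
  fixes f :: "real \<Rightarrow> complex"
  assumes "continuous_on UNIV f" "\<And>v. norm (f v) \<le> C / (1 + v\<^sup>2)"
  shows "integrable lborel f"
proof (rule Bochner_Integration.integrable_bound)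
  show "integrable lborel (\<lambda>v::real. C * (1 / (1 + v\<^sup>2)))"
    by (intro integrable_mult_right integrable_inverse_quadratic)
  show "f \<in> borel_measurable lborel"
    using assms(1) by (simp add: borel_measurable_continuous_onI)
  show "AE v in lborel. norm (f v) \<le> norm (C * (1 / (1 + v\<^sup>2)))"
  proof (intro always_eventually allI)
    fix v
    show "norm (f v) \<le> norm (C * (1 / (1 + v\<^sup>2)))"
      using assms(2)[of v] by (simp only: real_norm_def times_divide_eq_right mult_1_right)
  qed
qed

text \<open>Comparison of \<open>exp (\<delta> (1 + \<bar>v\<bar>))\<close> with the term of order
  \<open>N + 2\<close> of its series; the two extra powers pay for \<open>1 + v^2\<close>.\<close>

lemma power_exp_decay:
  fixes \<delta> :: real
  assumes "\<delta> > 0"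
  obtains C where "C > 0" "\<And>v::real. (1 + \<bar>v\<bar>) ^ N * exp (- \<delta> * \<bar>v\<bar>) \<le> C / (1 + v\<^sup>2)"
proof -
  define C where "C = fact (N + 2) / \<delta> ^ (N + 2) * exp \<delta>"
  have "(1 + \<bar>v\<bar>) ^ N * exp (- \<delta> * \<bar>v\<bar>) \<le> C / (1 + v\<^sup>2)" for v :: real
  proof -
    define k where "k = N + 2"
    have "(\<delta> * (1 + \<bar>v\<bar>)) ^ k / fact k \<le> exp (\<delta> * (1 + \<bar>v\<bar>))"
      using assms by (intro power_div_fact_le_exp) auto
    moreover have "(\<delta> * (1 + \<bar>v\<bar>)) ^ k = \<delta> ^ k * (1 + \<bar>v\<bar>) ^ k"
      by (rule power_mult_distrib)
    moreover have "exp (\<delta> * (1 + \<bar>v\<bar>)) = exp \<delta> * exp (\<delta> * \<bar>v\<bar>)"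
      by (simp add: distrib_left exp_add)
    ultimately have "\<delta> ^ k * (1 + \<bar>v\<bar>) ^ k \<le> fact k * (exp \<delta> * exp (\<delta> * \<bar>v\<bar>))"
      by (metis fact_gt_zero pos_divide_le_eq mult.commute)
    then have "(1 + \<bar>v\<bar>) ^ k \<le> fact k * (exp \<delta> * exp (\<delta> * \<bar>v\<bar>)) / \<delta> ^ k"
      using assms by (simp add: pos_le_divide_eq mult.commute)
    then have "(1 + \<bar>v\<bar>) ^ (N + 2) \<le> C * exp (\<delta> * \<bar>v\<bar>)"
      unfolding C_def k_def by (simp only: times_divide_eq_left mult.assoc)
    moreover have "(1 + \<bar>v\<bar>) ^ N * (1 + v\<^sup>2) \<le> (1 + \<bar>v\<bar>) ^ (N + 2)"
    proof -
      have "1 + v\<^sup>2 \<le> (1 + \<bar>v\<bar>)\<^sup>2"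
        by (simp add: power2_sum)
      then show ?thesis
        unfolding power_add by (intro mult_left_mono) auto
    qed
    ultimately have "(1 + \<bar>v\<bar>) ^ N * (1 + v\<^sup>2) \<le> C * exp (\<delta> * \<bar>v\<bar>)"
      by linarith
    moreover have "1 + v\<^sup>2 > 0"
      by (simp add: add_pos_nonneg)
    ultimately show ?thesis
      by (simp add: exp_minus field_simps)
  qed
  moreover have "C > 0"
    using assms by (simp add: C_def)
  ultimately show ?thesis
    using that by blast
qed

lemma holomorphic_series:
  fixes f :: "nat \<Rightarrow> complex \<Rightarrow> complex"
  assumes S: "open S" and hol: "\<And>n. f n holomorphic_on S"
    and bd: "\<And>n s. s \<in> S \<Longrightarrow> norm (f n s) \<le> h n" and h: "summable h"
  obtains g where "g holomorphic_on S" "\<And>s. s \<in> S \<Longrightarrow> (\<lambda>n. f n s) sums g s"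
proof -
  have deriv: "(f n has_field_derivative deriv (f n) s) (at s)" if "s \<in> S" for n s
    using hol S that by (rule holomorphic_derivI)
  have "\<forall>\<^sub>F n in sequentially. \<forall>s\<in>S. norm (f n s) \<le> h n"
    by (intro always_eventually allI ballI bd)
  from series_and_derivative_comparison[OF S h deriv this] obtain g g' where
    g: "\<forall>s\<in>S. (\<lambda>n. f n s) sums g s \<and> (\<lambda>n. deriv (f n) s) sums g' s \<and> (g has_field_derivative g' s) (at s)"
    by blast
  then have "g holomorphic_on S"
    using S by (auto simp: holomorphic_on_open)
  then show ?thesis
    using that g by blast
qed

text \<open>Differentiation under the integral sign. Cauchy's inequality on discs of fixed radius
  turns the majorant \<open>g\<close> of \<open>f\<close> into the majorant \<open>g / r\<close> of
  the difference quotients, so that dominated convergence applies.\<close>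

lemma holomorphic_integral_parameter:
  fixes f :: "complex \<Rightarrow> 'a \<Rightarrow> complex"
  assumes "open U"
    and hol: "\<And>v. (\<lambda>s. f s v) holomorphic_on U"
    and meas: "\<And>s. s \<in> U \<Longrightarrow> f s \<in> borel_measurable M"
    and g: "integrable M g"
    and bd: "\<And>s v. s \<in> U \<Longrightarrow> norm (f s v) \<le> g v"
  shows "(\<lambda>s. LINT v|M. f s v) holomorphic_on U"
proof (rule holomorphic_onI)
  fix s0 assume s0: "s0 \<in> U"
  obtain e where e: "e > 0" "cball s0 e \<subseteq> U"
    using \<open>open U\<close> s0 open_contains_cball by blast
  \<comment> \<open>Half the radius, so that discs of radius \<open>r\<close> around every point of
    \<open>ball s0 r\<close> still lie in \<open>U\<close>.\<close>
  define r where "r = e / 2"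
  have r: "r > 0" using e by (simp add: r_def)
  have sub: "cball s r \<subseteq> U" if "s \<in> ball s0 r" for s
  proof
    fix x assume "x \<in> cball s r"
    then have "dist s0 x \<le> e"
      using that dist_triangle[of s0 x s] by (simp add: r_def dist_commute)
    then show "x \<in> U" using e by auto
  qed
  have f_int: "integrable M (f s)" if "s \<in> U" for s
  proof (rule Bochner_Integration.integrable_bound[OF g meas[OF that]], intro always_eventually allI)
    show "norm (f s v) \<le> norm (g v)" for v
      using bd[OF that, of v] by simp
  qed
  have deriv_bd: "norm (deriv (\<lambda>s. f s v) s) \<le> g v / r" if "s \<in> ball s0 r" for s v
  proof -
    have "norm ((deriv ^^ 1) (\<lambda>s. f s v) s) \<le> fact 1 * g v / r ^ 1"
    proof (rule Cauchy_inequality)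
      show "(\<lambda>s. f s v) holomorphic_on ball s r" 
        using sub[OF that] hol[of v] by (meson ball_subset_cball holomorphic_on_subset order_trans)
      show "continuous_on (cball s r) (\<lambda>s. f s v)"
        using sub[OF that] hol[of v] by (meson holomorphic_on_imp_continuous_on holomorphic_on_subset)
      show "norm (f x v) \<le> g v" if "cmod (s - x) = r" for x
        using that sub[OF \<open>s \<in> ball s0 r\<close>] by (intro bd) (auto simp: dist_norm)
    qed (use r in auto)
    then show ?thesis by simp
  qed
  have has_deriv: "((\<lambda>s. f s v) has_field_derivative deriv (\<lambda>s. f s v) s) (at s)" if "s \<in> U" for s v
    using hol[of v] \<open>open U\<close> that holomorphic_derivI by blast
  have ballU: "ball s0 r \<subseteq> U"
    using sub[of s0] r by auto
  have lip: "norm (f s v - f s0 v) \<le> g v / r * norm (s - s0)" if "s \<in> ball s0 r" for s v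
  proof (rule field_differentiable_bound[OF convex_ball[of s0 r]])
    show "((\<lambda>s. f s v) has_field_derivative deriv (\<lambda>s. f s v) z) (at z within ball s0 r)"
      if "z \<in> ball s0 r" for z
      using has_deriv that ballU DERIV_subset by blast
  qed (use deriv_bd that r in auto)
  define D where "D = (LINT v|M. deriv (\<lambda>s. f s v) s0)"
  have lim: "(\<lambda>i. (f (X i) v - f s0 v) / (X i - s0)) \<longlonglongrightarrow> deriv (\<lambda>s. f s v) s0"
    if X: "\<And>i. X i \<in> ball s0 r - {s0}" "X \<longlonglongrightarrow> s0" for X v
  proof -
    have "((\<lambda>y. (f y v - f s0 v) / (y - s0)) \<longlongrightarrow> deriv (\<lambda>s. f s v) s0) (at s0)"
      using has_deriv[OF s0, of v] by (simp add: has_field_derivative_iff)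
    then show ?thesis
      using X by (auto simp: tendsto_at_iff_sequentially o_def)
  qed
  have "((\<lambda>y. ((LINT v|M. f y v) - (LINT v|M. f s0 v)) / (y - s0)) \<longlongrightarrow> D) (at s0 within ball s0 r)"
    unfolding tendsto_at_iff_sequentially o_def
  proof (intro allI impI)
    fix X :: "nat \<Rightarrow> complex"
    assume X': "\<forall>i. X i \<in> ball s0 r - {s0}" "X \<longlonglongrightarrow> s0"
    have X: "\<And>i. X i \<in> ball s0 r - {s0}" using X' by blast
    have XU: "X i \<in> U" for i using X[of i] ballU by auto
    have eq: "((LINT v|M. f (X i) v) - (LINT v|M. f s0 v)) / (X i - s0)
        = (LINT v|M. (f (X i) v - f s0 v) / (X i - s0))" for i
      using f_int[OF XU[of i]] f_int[OF s0] by simp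
    have measq: "(\<lambda>v. (f (X i) v - f s0 v) / (X i - s0)) \<in> borel_measurable M" for i
      using meas[OF XU[of i]] meas[OF s0] by measurable
    show "(\<lambda>i. ((LINT v|M. f (X i) v) - (LINT v|M. f s0 v)) / (X i - s0)) \<longlonglongrightarrow> D"
      unfolding eq D_def
    proof (rule integral_dominated_convergence)
      \<comment> \<open>Measurability of the derivative is inherited from the difference quotients,
        of which it is the pointwise limit.\<close>
      show "(\<lambda>v. deriv (\<lambda>s. f s v) s0) \<in> borel_measurable M"
        by (rule borel_measurable_LIMSEQ_metric[OF measq lim[OF X X'(2)]])
      show "integrable M (\<lambda>v. g v / r)" using g by simp
      show "AE v in M. (\<lambda>i. (f (X i) v - f s0 v) / (X i - s0)) \<longlonglongrightarrow> deriv (\<lambda>s. f s v) s0"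
        using lim[OF X X'(2)] by auto
      show "AE v in M. norm ((f (X i) v - f s0 v) / (X i - s0)) \<le> g v / r" for i
      proof (intro always_eventually allI)
        fix v
        show "norm ((f (X i) v - f s0 v) / (X i - s0)) \<le> g v / r"
          using lip[of "X i" v] X[of i] by (simp add: norm_divide divide_le_eq)
      qed
    qed (rule measq)
  qed
  then have "((\<lambda>y. LINT v|M. f y v) has_field_derivative D) (at s0)"
    using r by (simp add: has_field_derivative_iff at_within_open[of s0 "ball s0 r"])
  then show "(\<lambda>s. LINT v|M. f s v) field_differentiable at s0 within U"
    using field_differentiable_at_within field_differentiable_def by blast
qed

lemma contour_integral_rectpath:
  assumes "continuous_on (path_image (rectpath a c)) f"
  shows "contour_integral (rectpath a c) f =
    contour_integral (linepath a (Complex (Re c) (Im a))) f +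
    contour_integral (linepath (Complex (Re c) (Im a)) c) f +
    contour_integral (linepath c (Complex (Re a) (Im c))) f +
    contour_integral (linepath (Complex (Re a) (Im c)) a) f"
proof -
  define b d where "b = Complex (Re c) (Im a)" and "d = Complex (Re a) (Im c)"
  have im: "path_image (rectpath a c) = closed_segment a b \<union> closed_segment b c \<union> closed_segment c d \<union> closed_segment d a"
    by (simp add: rectpath_def Let_def path_image_join b_def d_def Un_assoc)
  have "f contour_integrable_on linepath a b" "f contour_integrable_on linepath b c"
       "f contour_integrable_on linepath c d" "f contour_integrable_on linepath d a"
    by (intro contour_integrable_continuous_linepath continuous_on_subset[OF assms]; force simp: im)+
  then show ?thesis
    unfolding rectpath_def Let_def b_def[symmetric] d_def[symmetric]
    by (simp add: contour_integral_join valid_path_join contour_integrable_join)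
qed

lemma contour_integral_linepath_dominated_limit:
  fixes h :: "complex \<Rightarrow> real"
  assumes f: "continuous_on (closed_segment p q) f"
    and g: "\<And>n. continuous_on (closed_segment p q) (g n)"
    and h: "continuous_on (closed_segment p q) h"
    and le: "\<And>n w. w \<in> closed_segment p q \<Longrightarrow> norm (g n w) \<le> h w"
    and lim: "\<And>w. w \<in> closed_segment p q \<Longrightarrow> (\<lambda>n. g n w) \<longlonglongrightarrow> f w"
  shows "(\<lambda>n. contour_integral (linepath p q) (g n)) \<longlonglongrightarrow> contour_integral (linepath p q) f"
proof -
  have lp: "linepath p q t \<in> closed_segment p q" if "t \<in> {0..1}" for t
    using that linepath_in_path by blast
  have c: "continuous_on {0..1} (\<lambda>t. k (linepath p q t) * (q - p))" if "continuous_on (closed_segment p q) k" for k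
    by (intro continuous_intros continuous_on_compose2[OF that]) (use lp in auto)
  have "(\<lambda>n. integral {0..1} (\<lambda>t. g n (linepath p q t) * (q - p))) \<longlonglongrightarrow> integral {0..1} (\<lambda>t. f (linepath p q t) * (q - p))"
  proof (rule dominated_convergence(2))
    show "(\<lambda>t. g n (linepath p q t) * (q - p)) integrable_on {0..1}" for n
      by (intro integrable_continuous_real c g)
    show "(\<lambda>t. h (linepath p q t) * norm (q - p)) integrable_on {0..1}"
      by (intro integrable_continuous_real continuous_intros continuous_on_compose2[OF h]) (use lp in auto)
    show "norm (g n (linepath p q t) * (q - p)) \<le> h (linepath p q t) * norm (q - p)" if "t \<in> {0..1}" for n t
      unfolding norm_mult using lp[OF that] by (intro mult_right_mono le) auto
    show "(\<lambda>n. g n (linepath p q t) * (q - p)) \<longlonglongrightarrow> f (linepath p q t) * (q - p)" if "t \<in> {0..1}" for t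
      by (intro tendsto_mult lim lp that tendsto_const)
  qed
  then show ?thesis
    by (simp add: contour_integral_integral)
qed

lemma contour_integral_rectpath_dominated_limit:
  fixes h :: "complex \<Rightarrow> real"
  assumes f: "continuous_on (path_image (rectpath p q)) f"
    and g: "\<And>n. continuous_on (path_image (rectpath p q)) (g n)"
    and h: "continuous_on (path_image (rectpath p q)) h"
    and le: "\<And>n w. w \<in> path_image (rectpath p q) \<Longrightarrow> norm (g n w) \<le> h w"
    and lim: "\<And>w. w \<in> path_image (rectpath p q) \<Longrightarrow> (\<lambda>n. g n w) \<longlonglongrightarrow> f w"
  shows "(\<lambda>n. contour_integral (rectpath p q) (g n)) \<longlonglongrightarrow> contour_integral (rectpath p q) f"
proof -
  have im: "path_image (rectpath p q) = closed_segment p (Complex (Re q) (Im p)) \<union> closed_segment (Complex (Re q) (Im p)) q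
      \<union> closed_segment q (Complex (Re p) (Im q)) \<union> closed_segment (Complex (Re p) (Im q)) p"
    by (simp add: rectpath_def Let_def path_image_join Un_assoc)
  have seg: "(\<lambda>n. contour_integral (linepath p' q') (g n)) \<longlonglongrightarrow> contour_integral (linepath p' q') f"
    if "closed_segment p' q' \<subseteq> path_image (rectpath p q)" for p' q'
    using that by (intro contour_integral_linepath_dominated_limit[where h = h] continuous_on_subset[OF f] continuous_on_subset[OF g] continuous_on_subset[OF h] le lim) auto
  show ?thesis
    unfolding contour_integral_rectpath[OF f] contour_integral_rectpath[OF g]
    by (intro tendsto_add seg) (auto simp: im)
qed

lemma tendsto_interval_integral_LINT:
  fixes f :: "real \<Rightarrow> complex"
  assumes f: "integrable lborel f"
  shows "((\<lambda>T. integral {-T..T} f) \<longlongrightarrow> (LINT v|lborel. f v)) at_top"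
proof -
  have eq: "(LINT v|lborel. indicator {-T..T} v *\<^sub>R f v) = integral {-T..T} f" for T
    using set_borel_integral_eq_integral(2)[of "{-T..T}" f] f
    by (simp add: set_integrable_def set_lebesgue_integral_def integrable_mult_indicator)
  have "((\<lambda>T. LINT v|lborel. indicator {-T..T} v *\<^sub>R f v) \<longlongrightarrow> (LINT v|lborel. f v)) at_top"
  proof (rule integral_dominated_convergence_at_top)
    show "integrable lborel (\<lambda>v. norm (f v))" using f by simp
    show "AE x in lborel. ((\<lambda>T. indicator {-T..T} x *\<^sub>R f x) \<longlongrightarrow> f x) at_top"
    proof (intro always_eventually allI, rule tendsto_eventually)
      fix x :: real
      show "\<forall>\<^sub>F T in at_top. indicator {-T..T} x *\<^sub>R f x = f x"
        using eventually_ge_at_top[of "\<bar>x\<bar>"] by eventually_elim (auto simp: indicator_def)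
    qed
    show "\<forall>\<^sub>F T in at_top. AE x in lborel. norm (indicator {-T..T} x *\<^sub>R f x) \<le> norm (f x)"
      by (auto simp: indicator_def)
  qed (use f in auto)
  then show ?thesis unfolding eq .
qed

subsection \<open>Shifting vertical lines of integration\<close>

text \<open>This is \<open>exp (- 2 \<eta> cos (\<beta> w))\<close>. On a strip where
  \<open>\<bar>\<beta> Re w\<bar> \<le> 1\<close> it decays doubly exponentially in
  \<open>\<bar>Im w\<bar>\<close>, which outweighs any function of finite order, and it tends to 1
  as \<open>\<eta>\<close> tends to 0.\<close>

definition damping :: "real \<Rightarrow> real \<Rightarrow> complex \<Rightarrow> complex" where
  "damping \<beta> \<eta> w = exp (- of_real \<eta> * (exp (\<i> * of_real \<beta> * w) + exp (- (\<i> * of_real \<beta> * w))))"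

lemma cmod_damping_le:
  assumes "\<eta> \<ge> 0" "\<beta> \<ge> 0" "\<bar>\<beta> * Re w\<bar> \<le> 1"
  shows "norm (damping \<beta> \<eta> w) \<le> exp (- (\<eta> / 2) * exp (\<beta> * \<bar>Im w\<bar>))"
proof -
  \<comment> \<open>The bound 1 on \<open>\<bar>\<beta> Re w\<bar>\<close> is below
    \<open>pi / 3\<close>, where the cosine is \<open>1 / 2\<close>.\<close>
  have c: "cos (\<beta> * Re w) \<ge> 1 / 2"
  proof -
    have "cos (\<bar>\<beta> * Re w\<bar>) \<ge> cos (pi / 3)"
      using assms pi_gt3 by (intro cos_monotone_0_pi_le) auto
    then show ?thesis by (simp add: cos_60)
  qed
  have "exp (\<beta> * \<bar>Im w\<bar>) \<le> exp (\<beta> * Im w) + exp (- (\<beta> * Im w))"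
    by (cases "Im w \<ge> 0") (auto intro: add_increasing add_increasing2)
  then have "exp (\<beta> * \<bar>Im w\<bar>) / 2 \<le> (exp (\<beta> * Im w) + exp (- (\<beta> * Im w))) * cos (\<beta> * Re w)"
    using mult_mono[OF _ c, of "exp (\<beta> * \<bar>Im w\<bar>)" "exp (\<beta> * Im w) + exp (- (\<beta> * Im w))"] 
    by (simp add: add_nonneg_nonneg)
  then have "\<eta> * (exp (\<beta> * \<bar>Im w\<bar>) / 2) \<le> \<eta> * ((exp (\<beta> * Im w) + exp (- (\<beta> * Im w))) * cos (\<beta> * Re w))"
    using assms by (intro mult_left_mono)
  then show ?thesis
    by (simp add: damping_def norm_exp_eq_Re Re_exp algebra_simps)
qed

lemma cmod_damping_le_1:
  assumes "\<eta> \<ge> 0" "\<beta> \<ge> 0" "\<bar>\<beta> * Re w\<bar> \<le> 1"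
  shows "norm (damping \<beta> \<eta> w) \<le> 1"
  by (rule order_trans[OF cmod_damping_le[OF assms]]) (use assms(1) in simp)

lemma holomorphic_on_damping [holomorphic_intros]: "damping \<beta> \<eta> holomorphic_on S"
  unfolding damping_def[abs_def] by (intro holomorphic_intros)

lemma damping_tendsto_1: "((\<lambda>n. damping \<beta> (inverse (real (Suc n))) w) \<longlongrightarrow> 1) sequentially"
proof -
  have "(\<lambda>n. complex_of_real (inverse (real (Suc n)))) \<longlonglongrightarrow> of_real 0"
    by (intro tendsto_of_real LIMSEQ_inverse_real_of_nat)
  then have "((\<lambda>n. damping \<beta> (inverse (real (Suc n))) w) \<longlongrightarrow>
     exp (- of_real 0 * (exp (\<i> * of_real \<beta> * w) + exp (- (\<i> * of_real \<beta> * w))))) sequentially"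
    unfolding damping_def by (intro tendsto_exp tendsto_mult tendsto_const tendsto_minus)
  then show ?thesis by simp
qed

lemma exp_power_times_double_exp_tendsto_0:
  fixes A B \<eta> \<beta> :: real
  assumes "\<eta> > 0" "\<beta> > 0"
  shows "((\<lambda>t. A * exp (B * t ^ N) * exp (- (\<eta> / 2) * exp (\<beta> * t))) \<longlongrightarrow> 0) at_top"
proof -
  \<comment> \<open>The term of order \<open>N + 2\<close> in the series of
    \<open>exp (\<beta> t)\<close> leaves, against \<open>\<bar>B\<bar> t ^ (N + 1)\<close>, one
    factor \<open>t\<close> to spare, so that the exponent eventually drops below
    \<open>- t\<close>.\<close>
  define k where "k = Suc (Suc N)"
  define c where "c = \<eta> / 2 * (\<beta> ^ k / fact k)"
  have c: "c > 0" using assms by (simp add: c_def)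
  have le: "B * t ^ N - \<eta> / 2 * exp (\<beta> * t) \<le> - t" if t: "t \<ge> 1" "t \<ge> (\<bar>B\<bar> + 1) / c" for t
  proof -
    have "(\<beta> * t) ^ k / fact k \<le> exp (\<beta> * t)"
      using assms t by (intro power_div_fact_le_exp) auto
    then have "\<eta> / 2 * ((\<beta> * t) ^ k / fact k) \<le> \<eta> / 2 * exp (\<beta> * t)"
      using assms by (intro mult_left_mono) auto
    moreover have "\<eta> / 2 * ((\<beta> * t) ^ k / fact k) = c * t ^ k"
      unfolding c_def power_mult_distrib by simp
    moreover have "B * t ^ N \<le> \<bar>B\<bar> * t ^ Suc N"
      using t by (intro mult_mono power_increasing) auto
    moreover have "t ^ Suc N * (\<bar>B\<bar> - c * t) \<le> t ^ Suc N * (-1)"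
    proof (rule mult_left_mono)
      show "\<bar>B\<bar> - c * t \<le> -1"
        using t(2) c by (simp add: pos_divide_le_eq mult.commute)
    qed (use t in simp)
    moreover have "t ^ Suc N * (\<bar>B\<bar> - c * t) = \<bar>B\<bar> * t ^ Suc N - c * t ^ k"
      by (simp add: k_def right_diff_distrib)
    moreover have "t ^ 1 \<le> t ^ Suc N"
      using t by (intro power_increasing) auto
    ultimately show ?thesis
      unfolding power_one_right mult_minus_right mult_1_right by linarith
  qed
  have "filterlim (\<lambda>t. B * t ^ N - \<eta> / 2 * exp (\<beta> * t)) at_bot at_top"
  proof (rule filterlim_at_bot_mono)
    show "filterlim (\<lambda>t::real. -t) at_bot at_top"
      by (rule filterlim_uminus_at_bot_at_top)
    show "\<forall>\<^sub>F t in at_top. B * t ^ N - \<eta> / 2 * exp (\<beta> * t) \<le> - t"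
      using eventually_ge_at_top[of "(\<bar>B\<bar> + 1) / c"] eventually_ge_at_top[of 1]
      by eventually_elim (rule le)
  qed
  then have "((\<lambda>t. A * exp (B * t ^ N - \<eta> / 2 * exp (\<beta> * t))) \<longlongrightarrow> A * 0) at_top"
    by (intro tendsto_mult tendsto_const filterlim_compose[OF exp_at_bot])
  moreover have "A * exp (B * t ^ N - \<eta> / 2 * exp (\<beta> * t)) = A * exp (B * t ^ N) * exp (- (\<eta> / 2) * exp (\<beta> * t))" for t
    unfolding mult.assoc exp_add[symmetric] by simp
  ultimately show ?thesis
    by (simp only: mult_zero_right)
qed


lemma contour_integral_linepath_vertical:
  assumes "t \<le> t'"
  shows "contour_integral (linepath (Complex x t) (Complex x t')) f = \<i> * integral {t..t'} (\<lambda>v. f (Complex x v))"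
proof (cases "t = t'")
  case False
  then show ?thesis
    using assms by (intro contour_integral_linepath_same_Re) auto
qed auto

text \<open>The damping factor makes the horizontal sides of a tall rectangle negligible for every
  function of finite order; it is removed by dominated convergence on the two vertical lines,
  so that no convexity bound inside the strip is needed.\<close>

lemma strip_shift:
  fixes f :: "complex \<Rightarrow> complex"
  assumes ab: "a < b" and T0: "T0 > 0"
    and S: "open S" "{w. a \<le> Re w \<and> Re w \<le> b} - box (Complex a (-T0)) (Complex b T0) \<subseteq> S"
    and hol: "f holomorphic_on S"
    and growth: "\<And>w. a \<le> Re w \<Longrightarrow> Re w \<le> b \<Longrightarrow> \<bar>Im w\<bar> \<ge> T0 \<Longrightarrow> norm (f w) \<le> A * exp (B * \<bar>Im w\<bar> ^ N)"
    and int_a: "integrable lborel (\<lambda>v. f (Complex a v))"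
    and int_b: "integrable lborel (\<lambda>v. f (Complex b v))"
  shows "\<i> * (LINT v|lborel. f (Complex b v)) - \<i> * (LINT v|lborel. f (Complex a v))
    = contour_integral (rectpath (Complex a (-T0)) (Complex b T0)) f"
proof -
  \<comment> \<open>Makes \<open>\<bar>\<beta> Re w\<bar> \<le> 1\<close> on the whole closed
    strip.\<close>
  define \<beta> where "\<beta> = 1 / (1 + \<bar>a\<bar> + \<bar>b\<bar>)"
  have \<beta>: "\<beta> > 0" by (simp add: \<beta>_def add_pos_nonneg)
  have \<beta>_le: "\<bar>\<beta> * Re w\<bar> \<le> 1" if "a \<le> Re w" "Re w \<le> b" for w
  proof -
    have "\<bar>Re w\<bar> \<le> 1 + \<bar>a\<bar> + \<bar>b\<bar>" using that by auto
    then show ?thesis by (simp add: \<beta>_def abs_mult divide_le_eq add_pos_nonneg)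
  qed
  define rect where "rect t t' g = contour_integral (rectpath (Complex a t) (Complex b t')) g" for t t' g
  define H where "H t g = contour_integral (linepath (Complex a t) (Complex b t)) g" for t and g :: "complex \<Rightarrow> complex"
  define V where "V x t t' g = integral {t..t'} (\<lambda>v. g (Complex x v))" for x t t' and g :: "complex \<Rightarrow> complex"
  define Z where "Z = {w. a \<le> Re w \<and> Re w \<le> b} - box (Complex a (-T0)) (Complex b T0)"
  have in_Z_line: "Complex a v \<in> Z" "Complex b v \<in> Z" for v
    using ab by (auto simp: Z_def in_box_complex_iff)
  have in_Z_seg: "closed_segment (Complex a t) (Complex b t) \<subseteq> Z" if "\<bar>t\<bar> \<ge> T0" for t
    using ab that by (auto simp: Z_def in_box_complex_iff closed_segment_same_Im closed_segment_eq_real_ivl)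
  have rect_eq: "rect t t' g = H t g + \<i> * V b t t' g - H t' g - \<i> * V a t t' g"
    if "continuous_on Z g" "\<bar>t\<bar> \<ge> T0" "\<bar>t'\<bar> \<ge> T0" "t < t'" for t t' g
  proof -
    have "path_image (rectpath (Complex a t) (Complex b t')) \<subseteq> Z"
      using ab that(2-4) by (subst path_image_rectpath) (auto simp: Z_def in_box_complex_iff)
    then have c: "continuous_on (path_image (rectpath (Complex a t) (Complex b t'))) g"
      using that(1) continuous_on_subset by blast
    have r1: "contour_integral (linepath (Complex b t') (Complex a t')) g = - H t' g"
      unfolding H_def using in_Z_seg[OF that(3)] continuous_on_subset[OF that(1)]
      by (intro contour_integral_reverse_linepath) (auto simp: closed_segment_commute)
    have r2: "contour_integral (linepath (Complex a t') (Complex a t)) g = - (\<i> * V a t t' g)"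
    proof -
      have "closed_segment (Complex a t') (Complex a t) \<subseteq> path_image (rectpath (Complex a t) (Complex b t'))"
        using ab that(4) by (subst path_image_rectpath) (auto simp: closed_segment_same_Re closed_segment_eq_real_ivl)
      then have "contour_integral (linepath (Complex a t') (Complex a t)) g = - contour_integral (linepath (Complex a t) (Complex a t')) g"
        by (intro contour_integral_reverse_linepath continuous_on_subset[OF c])
      then show ?thesis
        using that(4) by (simp add: V_def contour_integral_linepath_vertical)
    qed
    show ?thesis
      unfolding rect_def contour_integral_rectpath[OF c] complex.sel r1 r2
      using that(4) by (simp add: H_def V_def contour_integral_linepath_vertical)
  qed
  have V_cont: "continuous_on UNIV (\<lambda>v. g (Complex x v))" if "continuous_on Z g" "x = a \<or> x = b" for g x
  proof (rule continuous_on_compose2[OF that(1)])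
    show "continuous_on UNIV (\<lambda>v. Complex x v)"
      by (intro continuous_intros)
  qed (use in_Z_line that(2) in auto)
  have V_add: "V x (-T) T g = V x (-T) (-T0) g + V x (-T0) T0 g + V x T0 T g"
    if "continuous_on Z g" "x = a \<or> x = b" "T > T0" for x T g
  proof -
    have i: "(\<lambda>v. g (Complex x v)) integrable_on {t..t'}" for t t'
      by (intro integrable_continuous_real continuous_on_subset[OF V_cont[OF that(1,2)]]) auto
    have "V x (-T) (-T0) g + V x (-T0) T g = V x (-T) T g" "V x (-T0) T0 g + V x T0 T g = V x (-T0) T g"
      unfolding V_def using that(3) T0
      by (auto intro!: Henstock_Kurzweil_Integration.integral_combine[OF _ _ i])
    then show ?thesis by (metis add.assoc)
  qed
  have zero: "rect t t' g = 0" if g: "g holomorphic_on S" and "t < t'" "t' = -T0 \<or> t = T0" for t t' g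
  proof -
    have "cbox (Complex a t) (Complex b t') \<subseteq> S"
      using that(2,3) S(2) by (auto simp: in_cbox_complex_iff in_box_complex_iff)
    moreover have "path_image (rectpath (Complex a t) (Complex b t')) \<subseteq> cbox (Complex a t) (Complex b t')"
      using ab that(2) by (intro path_image_rectpath_subset_cbox) auto
    ultimately have "(g has_contour_integral 0) (rectpath (Complex a t) (Complex b t'))"
      by (intro Cauchy_theorem_convex_simple[of _ "cbox (Complex a t) (Complex b t')"] holomorphic_on_subset[OF g]) auto
    then show ?thesis
      unfolding rect_def by (rule contour_integral_unique)
  qed
  have ZS: "Z \<subseteq> S" using S(2) by (simp add: Z_def)
  \<comment> \<open>Above and below the central rectangle the function is holomorphic, so by
    Cauchy's theorem the height of the rectangle does not matter.\<close>
  have tall: "rect (-T) T g = rect (-T0) T0 g" if g: "g holomorphic_on S" and "T > T0" for T g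
  proof -
    have c: "continuous_on Z g"
      using holomorphic_on_imp_continuous_on[OF holomorphic_on_subset[OF g ZS]] .
    have "rect (-T) (-T0) g = 0" "rect T0 T g = 0"
      using that by (auto intro: zero)
    moreover have "rect (-T) T g = rect (-T) (-T0) g + rect (-T0) T0 g + rect T0 T g"
      using T0 that(2) V_add[OF c _ that(2)] by (simp add: rect_eq[OF c] algebra_simps)
    ultimately show ?thesis by simp
  qed
  define g where "g n w = f w * damping \<beta> (inverse (real (Suc n))) w" for n w
  have g_hol: "g n holomorphic_on S" for n
    unfolding g_def[abs_def] by (intro holomorphic_intros hol)
  have g_cont: "continuous_on Z (g n)" for n
    using holomorphic_on_imp_continuous_on[OF holomorphic_on_subset[OF g_hol ZS]] .
  have f_cont: "continuous_on Z f"
    using holomorphic_on_imp_continuous_on[OF holomorphic_on_subset[OF hol ZS]] .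
  have g_le: "norm (g n w) \<le> norm (f w)" if "a \<le> Re w" "Re w \<le> b" for n w
    using mult_left_mono[OF cmod_damping_le_1[of "inverse (real (Suc n))" \<beta> w], of "norm (f w)"] \<beta> \<beta>_le[OF that]
    by (simp add: g_def norm_mult)
  have g_lim: "(\<lambda>n. g n w) \<longlonglongrightarrow> f w" for w
    unfolding g_def using tendsto_mult[OF tendsto_const[of "f w"] damping_tendsto_1[of \<beta> w]] by simp
  have g_int: "integrable lborel (\<lambda>v. g n (Complex x v))" if "x = a \<or> x = b" for n x
  proof (rule Bochner_Integration.integrable_bound)
    show "integrable lborel (\<lambda>v. f (Complex x v))"
      using that int_a int_b by auto
    show "(\<lambda>v. g n (Complex x v)) \<in> borel_measurable lborel"
      using V_cont[OF g_cont that] by (simp add: borel_measurable_continuous_onI)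
    show "AE v in lborel. norm (g n (Complex x v)) \<le> norm (f (Complex x v))"
      using that ab by (intro always_eventually allI g_le) auto
  qed
  have H_bound: "norm (H t (g n)) \<le> A * exp (B * \<bar>t\<bar> ^ N) * exp (- (inverse (real (Suc n)) / 2) * exp (\<beta> * \<bar>t\<bar>)) * (b - a)"
    if "\<bar>t\<bar> \<ge> T0" for t n
  proof -
    let ?B = "A * exp (B * \<bar>t\<bar> ^ N) * exp (- (inverse (real (Suc n)) / 2) * exp (\<beta> * \<bar>t\<bar>))"
    have le: "norm (g n w) \<le> ?B" if "w \<in> closed_segment (Complex a t) (Complex b t)" for w
    proof -
      have w: "a \<le> Re w" "Re w \<le> b" "Im w = t"
        using that ab by (auto simp: closed_segment_same_Im closed_segment_eq_real_ivl)
      have "norm (f w) \<le> A * exp (B * \<bar>t\<bar> ^ N)"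
        using growth[OF w(1,2)] w(3) \<open>\<bar>t\<bar> \<ge> T0\<close> by simp
      moreover have "norm (damping \<beta> (inverse (real (Suc n))) w) \<le> exp (- (inverse (real (Suc n)) / 2) * exp (\<beta> * \<bar>t\<bar>))"
        using cmod_damping_le[of "inverse (real (Suc n))" \<beta> w] \<beta> \<beta>_le[OF w(1,2)] w(3) by simp
      moreover have "0 \<le> A * exp (B * \<bar>t\<bar> ^ N)"
        using calculation(1) norm_ge_zero order_trans by blast
      ultimately show ?thesis
        unfolding g_def norm_mult by (intro mult_mono) auto
    qed
    have "0 \<le> ?B"
      by (rule order_trans[OF norm_ge_zero[of "g n (Complex a t)"] le]) simp
    then have "norm (H t (g n)) \<le> ?B * norm (Complex b t - Complex a t)"
      unfolding H_def
      by (intro contour_integral_bound_linepath contour_integrable_continuous_linepath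
           continuous_on_subset[OF g_cont in_Z_seg[OF that]] le) auto
    moreover have "Complex b t - Complex a t = of_real (b - a)"
      by (simp add: complex_eq_iff)
    ultimately show ?thesis
      using ab by (metis abs_of_pos diff_gt_0_iff_gt norm_of_real)
  qed
  have H_lim: "((\<lambda>T. H T (g n)) \<longlongrightarrow> 0) at_top" "((\<lambda>T. H (-T) (g n)) \<longlongrightarrow> 0) at_top" for n
  proof -
    let ?B = "\<lambda>t. A * exp (B * t ^ N) * exp (- (inverse (real (Suc n)) / 2) * exp (\<beta> * t)) * (b - a)"
    have lim: "(?B \<longlongrightarrow> 0 * (b - a)) at_top"
      using \<beta> by (intro tendsto_mult tendsto_const exp_power_times_double_exp_tendsto_0) auto
    have "\<forall>\<^sub>F T in at_top. norm (H T (g n)) \<le> ?B T \<and> norm (H (-T) (g n)) \<le> ?B T"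
      using eventually_ge_at_top[of T0]
    proof eventually_elim
      case (elim T)
      then show ?case using H_bound[of T n] H_bound[of "-T" n] T0 by simp
    qed
    then have ev: "\<forall>\<^sub>F T in at_top. norm (H T (g n)) \<le> ?B T" "\<forall>\<^sub>F T in at_top. norm (H (-T) (g n)) \<le> ?B T"
      by (auto elim: eventually_mono)
    show "((\<lambda>T. H T (g n)) \<longlongrightarrow> 0) at_top"
      by (rule Lim_null_comparison[OF ev(1) lim[unfolded mult_zero_left]])
    show "((\<lambda>T. H (-T) (g n)) \<longlongrightarrow> 0) at_top"
      by (rule Lim_null_comparison[OF ev(2) lim[unfolded mult_zero_left]])
  qed
  \<comment> \<open>The order of the limits matters: the height goes to infinity for a fixed amount
    of damping, and only then is the damping removed.\<close>
  have damped: "\<i> * (LINT v|lborel. g n (Complex b v)) - \<i> * (LINT v|lborel. g n (Complex a v)) = rect (-T0) T0 (g n)" for n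
  proof -
    have "((\<lambda>T. H (-T) (g n) + \<i> * V b (-T) T (g n) - H T (g n) - \<i> * V a (-T) T (g n)) \<longlongrightarrow>
      0 + \<i> * (LINT v|lborel. g n (Complex b v)) - 0 - \<i> * (LINT v|lborel. g n (Complex a v))) at_top"
      unfolding V_def
      by (intro tendsto_add tendsto_diff tendsto_mult tendsto_const H_lim tendsto_interval_integral_LINT g_int) auto
    moreover have "\<forall>\<^sub>F T in at_top. H (-T) (g n) + \<i> * V b (-T) T (g n) - H T (g n) - \<i> * V a (-T) T (g n) = rect (-T0) T0 (g n)"
      using eventually_gt_at_top[of T0]
    proof eventually_elim
      case (elim T)
      then show ?case
        using tall[OF g_hol elim, of n] rect_eq[OF g_cont, of "-T" T n] T0 by simp
    qed
    ultimately have "((\<lambda>T::real. rect (-T0) T0 (g n)) \<longlongrightarrow>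
      0 + \<i> * (LINT v|lborel. g n (Complex b v)) - 0 - \<i> * (LINT v|lborel. g n (Complex a v))) at_top"
      using tendsto_cong by fast
    then show ?thesis
      by (simp add: tendsto_const_iff)
  qed
  have lineV: "(\<lambda>n. LINT v|lborel. g n (Complex x v)) \<longlonglongrightarrow> (LINT v|lborel. f (Complex x v))" if "x = a \<or> x = b" for x
  proof (rule integral_dominated_convergence)
    show "integrable lborel (\<lambda>v. norm (f (Complex x v)))"
      using that int_a int_b by auto
    show "AE v in lborel. norm (g n (Complex x v)) \<le> norm (f (Complex x v))" for n
      using that ab by (intro always_eventually allI g_le) auto
  qed (use that g_int int_a int_b g_lim in \<open>auto intro: borel_measurable_integrable\<close>)
  have "(\<lambda>n. rect (-T0) T0 (g n)) \<longlonglongrightarrow> rect (-T0) T0 f"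
  proof -
    have im: "path_image (rectpath (Complex a (-T0)) (Complex b T0)) \<subseteq> Z"
      using ab T0 by (subst path_image_rectpath) (auto simp: Z_def in_box_complex_iff)
    show ?thesis
      unfolding rect_def
      by (intro contour_integral_rectpath_dominated_limit[where h = "\<lambda>w. norm (f w)"] g_lim g_le
           continuous_on_norm continuous_on_subset[OF f_cont im] continuous_on_subset[OF g_cont im])
         (use im in \<open>auto simp: Z_def\<close>)
  qed
  moreover have "(\<lambda>n. rect (-T0) T0 (g n)) \<longlonglongrightarrow> \<i> * (LINT v|lborel. f (Complex b v)) - \<i> * (LINT v|lborel. f (Complex a v))"
    unfolding damped[symmetric] by (intro tendsto_diff tendsto_mult tendsto_const lineV) auto
  ultimately show ?thesis
    unfolding rect_def using LIMSEQ_unique by blast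
qed

subsection \<open>The Gamma function on vertical lines\<close>

text \<open>The quotient \<open>\<bar>Gamma (x + \<i> v)\<bar> / Gamma x\<close> increases with
  \<open>x > 0\<close>, because in Euler's product every factor
  \<open>(x + k) / \<bar>x + k + \<i> v\<bar>\<close> does. It carries an estimate from one vertical
  line to the lines between it and the imaginary axis.\<close>

lemma norm_Gamma_ratio_mono:
  assumes "0 < x" "x \<le> x'"
  shows "norm (Gamma (Complex x v)) * Gamma x' \<le> norm (Gamma (Complex x' v)) * Gamma x"
proof (rule LIMSEQ_le)
  show "(\<lambda>n. norm (Gamma_series (Complex x v) n) * Gamma_series x' n) \<longlonglongrightarrow> norm (Gamma (Complex x v)) * Gamma x'"
    by (intro tendsto_mult tendsto_norm Gamma_series_LIMSEQ)
  show "(\<lambda>n. norm (Gamma_series (Complex x' v) n) * Gamma_series x n) \<longlonglongrightarrow> norm (Gamma (Complex x' v)) * Gamma x"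
    by (intro tendsto_mult tendsto_norm Gamma_series_LIMSEQ)
  have "norm (Gamma_series (Complex x v) n) * Gamma_series x' n \<le> norm (Gamma_series (Complex x' v) n) * Gamma_series x n" for n
  proof -
    have ns: "norm (Gamma_series (Complex y v) n) = fact n * exp (y * ln (of_nat n)) / (\<Prod>k=0..<n+1. norm (Complex (y + real k) v))" for y :: real
    proof -
      have "Complex y v + of_nat k = Complex (y + real k) v" for k
        by (simp add: complex_eq_iff)
      then show ?thesis
        by (simp add: Gamma_series_def norm_divide norm_mult pochhammer_prod prod_norm[symmetric] norm_exp_eq_Re 
              del: prod.op_ivl_Suc)
    qed
    have rs: "Gamma_series y n = fact n * exp (y * ln (of_nat n)) / (\<Prod>k=0..<n+1. y + real k)" for y :: real
      by (simp add: Gamma_series_def pochhammer_prod del: prod.op_ivl_Suc)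
    have "norm (Complex (x' + real k) v) * (x + k) \<le> norm (Complex (x + real k) v) * (x' + k)" for k :: nat
    proof (rule power2_le_imp_le)
      have "v\<^sup>2 * (x + k)\<^sup>2 \<le> v\<^sup>2 * (x' + k)\<^sup>2"
        using assms by (intro mult_left_mono power_mono) auto
      then show "(norm (Complex (x' + real k) v) * (x + k))\<^sup>2 \<le> (norm (Complex (x + real k) v) * (x' + k))\<^sup>2"
        unfolding power_mult_distrib cmod_power2 complex.sel by (simp only: distrib_right) (simp add: mult.commute)
      show "0 \<le> norm (Complex (x + real k) v) * (x' + k)"
        using assms by simp
    qed
    then have "(\<Prod>k=0..<n+1. norm (Complex (x' + real k) v) * (x + real k)) \<le> (\<Prod>k=0..<n+1. norm (Complex (x + real k) v) * (x' + real k))"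
      using assms by (intro prod_mono) auto
    then have le: "(\<Prod>k=0..<n+1. norm (Complex (x' + real k) v)) * (\<Prod>k=0..<n+1. x + real k)
       \<le> (\<Prod>k=0..<n+1. norm (Complex (x + real k) v)) * (\<Prod>k=0..<n+1. x' + real k)"
      by (simp add: prod.distrib del: prod.op_ivl_Suc)
    have pos: "0 < (\<Prod>k=0..<n+1. norm (Complex (y + real k) v))" "0 < (\<Prod>k=0..<n+1. y + real k)" if "y > 0" for y :: real
      using that by (auto intro!: prod_pos simp: complex_eq_iff add_pos_nonneg simp del: prod.op_ivl_Suc)
    have x': "x' > 0" using assms by linarith
    define E where "E = fact n * exp (x * ln (of_nat n)) * (fact n * exp (x' * ln (of_nat n)) :: real)"
    have "E / ((\<Prod>k=0..<n+1. norm (Complex (x + real k) v)) * (\<Prod>k=0..<n+1. x' + real k))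
      \<le> E / ((\<Prod>k=0..<n+1. norm (Complex (x' + real k) v)) * (\<Prod>k=0..<n+1. x + real k))"
      using pos[OF assms(1)] pos[OF x'] le 
      by (intro divide_left_mono) (auto simp: E_def simp del: prod.op_ivl_Suc)
    then show ?thesis
      unfolding ns rs E_def times_divide_times_eq by (simp only: ac_simps)
  qed
  then show "\<exists>N. \<forall>n\<ge>N. norm (Gamma_series (Complex x v) n) * Gamma_series x' n \<le> norm (Gamma_series (Complex x' v) n) * Gamma_series x n"
    by blast
qed

text \<open>On this line \<open>1 - z = cnj z\<close>, so the reflection formula gives the exact
  value \<open>\<bar>Gamma z\<bar>^2 = pi / cosh (pi v)\<close>.\<close>

lemma norm_Gamma_half: "norm (Gamma (Complex (1 / 2) v)) \<le> sqrt (2 * pi) * exp (- (pi / 2) * \<bar>v\<bar>)"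
proof -
  define z where "z = Complex (1 / 2) v"
  have z1: "1 - z = cnj z" by (simp add: z_def complex_eq_iff)
  have "of_real pi * z = of_real pi / 2 + \<i> * of_real (pi * v)"
    by (simp add: z_def complex_eq_iff)
  then have "sin (of_real pi * z) = cos (\<i> * of_real (pi * v))"
    by (metis add.commute sin_cos_eq cos_minus minus_diff_eq diff_add_cancel add_diff_cancel_left' cos_sin_eq add_diff_cancel)
  also have "\<dots> = of_real (cosh (pi * v))"
    by (simp add: cosh_conv_cos[symmetric] cosh_field_def exp_of_real[symmetric])
  finally have s: "sin (of_real pi * z) = of_real (cosh (pi * v))" .
  have "Gamma z * Gamma (1 - z) = of_real pi / sin (of_real pi * z)"
    by (rule Gamma_reflection_complex)
  then have "Gamma z * cnj (Gamma z) = of_real (pi / cosh (pi * v))"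
    unfolding z1 s by (simp add: cnj_Gamma)
  then have n2: "(norm (Gamma z))\<^sup>2 = pi / cosh (pi * v)"
    by (metis complex_norm_square of_real_eq_iff)
  have "cosh (pi * v) \<ge> exp (pi * \<bar>v\<bar>) / 2"
  proof -
    have "exp (pi * \<bar>v\<bar>) \<le> exp (pi * v) + exp (- (pi * v))"
      by (cases "v \<ge> 0") auto
    then show ?thesis
      by (simp add: cosh_def)
  qed
  then have "(norm (Gamma z))\<^sup>2 \<le> pi / (exp (pi * \<bar>v\<bar>) / 2)"
    unfolding n2 by (intro divide_left_mono) (auto intro: mult_pos_pos cosh_real_pos)
  also have "\<dots> = (sqrt (2 * pi) * exp (- (pi / 2) * \<bar>v\<bar>))\<^sup>2"
    by (simp add: power_mult_distrib exp_minus exp_double[symmetric] field_simps flip: exp_of_nat_mult)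
  finally show ?thesis
    unfolding z_def by (rule power2_le_imp_le) auto
qed

lemma norm_Gamma_half_plus_nat:
  obtains C where "C > 0" "\<And>v. norm (Gamma (Complex (real N + 1 / 2) v)) \<le> C * (1 + \<bar>v\<bar>) ^ N * exp (- (pi / 2) * \<bar>v\<bar>)"
proof -
  have "\<exists>C>0. \<forall>v. norm (Gamma (Complex (real N + 1 / 2) v)) \<le> C * (1 + \<bar>v\<bar>) ^ N * exp (- (pi / 2) * \<bar>v\<bar>)"
  proof (induction N)
    case 0
    show ?case using norm_Gamma_half by (intro exI[of _ "sqrt (2 * pi)"]) auto
  next
    case (Suc N)
    then obtain C where C: "C > 0" "\<And>v. norm (Gamma (Complex (real N + 1 / 2) v)) \<le> C * (1 + \<bar>v\<bar>) ^ N * exp (- (pi / 2) * \<bar>v\<bar>)"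
      by blast
    have "norm (Gamma (Complex (real (Suc N) + 1 / 2) v)) \<le> ((real N + 1) * C) * (1 + \<bar>v\<bar>) ^ Suc N * exp (- (pi / 2) * \<bar>v\<bar>)" for v
    proof -
      define z where "z = Complex (real N + 1 / 2) v"
      have "z \<notin> \<int>\<^sub>\<le>\<^sub>0"
        by (auto simp: z_def complex_eq_iff elim!: nonpos_Ints_cases)
      then have "Gamma (z + 1) = z * Gamma z"
        by (rule Gamma_plus1)
      moreover have "z + 1 = Complex (real (Suc N) + 1 / 2) v"
        by (simp add: z_def complex_eq_iff)
      moreover have "norm z \<le> (real N + 1) * (1 + \<bar>v\<bar>)"
      proof -
        have "norm z \<le> \<bar>Re z\<bar> + \<bar>Im z\<bar>" by (rule cmod_le)
        also have "\<dots> \<le> (real N + 1) * (1 + \<bar>v\<bar>)" by (simp add: z_def algebra_simps)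
        finally show ?thesis .
      qed
      ultimately have "norm (Gamma (Complex (real (Suc N) + 1 / 2) v)) 
        \<le> ((real N + 1) * (1 + \<bar>v\<bar>)) * (C * (1 + \<bar>v\<bar>) ^ N * exp (- (pi / 2) * \<bar>v\<bar>))"
        using C(2)[of v] by (auto simp: norm_mult z_def intro!: mult_mono)
      then show ?thesis
        by (simp add: mult_ac)
    qed
    then show ?case
      using C(1) by (intro exI[of _ "(real N + 1) * C"]) (auto intro: mult_pos_pos add_nonneg_pos)
  qed
  then show ?thesis using that by blast
qed

text \<open>The half-integral line \<open>N + 1 / 2\<close> bounds the strip on the right;
  monotonicity of the Gamma quotient extends its estimate leftwards to any positive abscissa, with
  the same exponent \<open>N\<close>.\<close>

lemma norm_Gamma_strip:
  assumes "x1 > 0"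
  obtains C where "C > 0" 
    "\<And>z. x1 \<le> Re z \<Longrightarrow> Re z \<le> real N + 1 / 2 \<Longrightarrow> norm (Gamma z) \<le> C * (1 + \<bar>Im z\<bar>) ^ N * exp (- (pi / 2) * \<bar>Im z\<bar>)"
proof -
  define X where "X = real N + 1 / 2"
  have X: "X > 0" by (simp add: X_def add_nonneg_pos)
  obtain C where C: "C > 0" "\<And>v. norm (Gamma (Complex X v)) \<le> C * (1 + \<bar>v\<bar>) ^ N * exp (- (pi / 2) * \<bar>v\<bar>)"
    using norm_Gamma_half_plus_nat[of N] unfolding X_def by blast
  have "continuous_on {x1..X} (Gamma :: real \<Rightarrow> real)"
    using assms by (intro continuous_intros) auto
  then have "compact ((Gamma :: real \<Rightarrow> real) ` {x1..X})"
    by (intro compact_continuous_image) auto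
  then obtain B where B: "\<And>x. x \<in> {x1..X} \<Longrightarrow> norm (Gamma x :: real) \<le> B"
    using compact_imp_bounded bounded_iff by (metis imageI)
  define B' where "B' = max B 1"
  have B': "B' > 0" "\<And>x. x \<in> {x1..X} \<Longrightarrow> Gamma x \<le> B'"
    using B by (force simp: B'_def)+
  have GX: "Gamma X > 0" using X by (rule Gamma_real_pos)
  have "norm (Gamma z) \<le> (B' / Gamma X * C) * (1 + \<bar>Im z\<bar>) ^ N * exp (- (pi / 2) * \<bar>Im z\<bar>)"
    if z: "x1 \<le> Re z" "Re z \<le> X" for z
  proof -
    have "norm (Gamma (Complex (Re z) (Im z))) * Gamma X \<le> norm (Gamma (Complex X (Im z))) * Gamma (Re z)"
      using assms z by (intro norm_Gamma_ratio_mono) auto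
    also have "\<dots> \<le> (C * (1 + \<bar>Im z\<bar>) ^ N * exp (- (pi / 2) * \<bar>Im z\<bar>)) * B'"
      using C B' z assms by (intro mult_mono) (auto simp: Gamma_real_pos intro: less_imp_le)
    finally show ?thesis
      using GX by (simp add: field_simps)
  qed
  then show ?thesis
    using that[of "B' / Gamma X * C"] B' C GX unfolding X_def by simp
qed

lemma half_int_not_nonpos_Int: "Complex (1 / 2 - real K) v \<notin> \<int>\<^sub>\<le>\<^sub>0"
proof
  assume "Complex (1 / 2 - real K) v \<in> \<int>\<^sub>\<le>\<^sub>0"
  then obtain m where "Complex (1 / 2 - real K) v = of_int m"
    by (auto elim!: nonpos_Ints_cases)
  then have "1 / 2 - real K = real_of_int m" by (simp add: complex_eq_iff)
  then have "real_of_int (2 * (m + int K)) = 1" by simp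
  then have "2 * (m + int K) = 1" by (simp only: of_int_eq_1_iff)
  then show False by presburger
qed

lemma Gamma_left_step:
  "Gamma (Complex (1 / 2 - real (Suc K)) v) = Gamma (Complex (1 / 2 - real K) v) / Complex (1 / 2 - real (Suc K)) v"
proof -
  have "Complex (1 / 2 - real (Suc K)) v + 1 = Complex (1 / 2 - real K) v"
    by (simp add: complex_eq_iff)
  then have "Gamma (Complex (1 / 2 - real K) v) = Complex (1 / 2 - real (Suc K)) v * Gamma (Complex (1 / 2 - real (Suc K)) v)"
    using Gamma_plus1[OF half_int_not_nonpos_Int[of "Suc K" v]] by simp
  moreover have "Complex (1 / 2 - real (Suc K)) v \<noteq> 0"
    using half_int_not_nonpos_Int[of "Suc K" v] by auto
  ultimately show ?thesis by (simp add: field_simps)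
qed

lemma norm_Gamma_left:
  "norm (Gamma (Complex (1 / 2 - real K) v)) \<le> sqrt (2 * pi) * 3 ^ K / (1 + \<bar>v\<bar>) ^ K * exp (- (pi / 2) * \<bar>v\<bar>)"
proof (induction K)
  case 0
  then show ?case using norm_Gamma_half[of v] by simp
next
  case (Suc K)
  define w where "w = Complex (1 / 2 - real (Suc K)) v"
  \<comment> \<open>Here \<open>\<bar>Re w\<bar> \<ge> 1 / 2\<close> is used: it suffices when
    \<open>\<bar>v\<bar> \<le> 1 / 2\<close>, and otherwise \<open>\<bar>v\<bar>\<close> itself
    does. This is the origin of the constant 3.\<close>
  have "(1 + \<bar>v\<bar>) / 3 \<le> norm w"
    using abs_Re_le_cmod[of w] abs_Im_le_cmod[of w] by (simp add: w_def)
  then have "norm (Gamma (Complex (1 / 2 - real K) v)) / norm w 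
      \<le> (sqrt (2 * pi) * 3 ^ K / (1 + \<bar>v\<bar>) ^ K * exp (- (pi / 2) * \<bar>v\<bar>)) / ((1 + \<bar>v\<bar>) / 3)"
    by (intro frac_le Suc.IH) auto
  then show ?case
    unfolding Gamma_left_step norm_divide w_def by (simp add: mult_ac)
qed

text \<open>Decay in \<open>v\<close> is traded for decay in \<open>K\<close>: the half-integer
  product grows like a factorial, which makes the integrals vanish when the line recedes to the
  left.\<close>

lemma norm_Gamma_left_prod:
  "norm (Gamma (Complex (1 / 2 - real K) v)) \<le> sqrt (2 * pi) / (\<Prod>j<K. real j + 1 / 2) * exp (- (pi / 2) * \<bar>v\<bar>)"
proof (induction K)
  case 0
  then show ?case using norm_Gamma_half[of v] by simp
next
  case (Suc K)
  define w where "w = Complex (1 / 2 - real (Suc K)) v"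
  have "real K + 1 / 2 \<le> norm w"
    using abs_Re_le_cmod[of w] by (simp add: w_def)
  then have "norm (Gamma (Complex (1 / 2 - real K) v)) / norm w 
      \<le> (sqrt (2 * pi) / (\<Prod>j<K. real j + 1 / 2) * exp (- (pi / 2) * \<bar>v\<bar>)) / (real K + 1 / 2)"
    by (intro frac_le Suc.IH) (auto intro!: divide_nonneg_nonneg prod_nonneg add_nonneg_pos)
  then show ?case
    unfolding Gamma_left_step norm_divide w_def by (simp add: mult_ac)
qed

text \<open>The condition \<open>\<bar>Im w\<bar> \<ge> 1\<close> avoids the poles on the real axis.
  Returning from \<open>w + n\<close> in the right half-plane only divides by a Pochhammer product
  all of whose factors have modulus at least 1.\<close>

lemma norm_Gamma_bounded_strip:
  assumes "a \<le> b"
  obtains C where "C > 0" "\<And>w. a \<le> Re w \<Longrightarrow> Re w \<le> b \<Longrightarrow> \<bar>Im w\<bar> \<ge> 1 \<Longrightarrow> norm (Gamma w) \<le> C"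
proof -
  define n where "n = nat \<lceil>\<bar>a\<bar>\<rceil> + 1"
  have n: "a + n \<ge> 1" by (simp add: n_def) linarith
  define N where "N = nat \<lceil>\<bar>b + n\<bar>\<rceil>"
  have N: "b + n \<le> N + 1 / 2" by (simp add: N_def) linarith
  obtain C where C: "C > 0" "\<And>z. 1 \<le> Re z \<Longrightarrow> Re z \<le> real N + 1 / 2 \<Longrightarrow> norm (Gamma z) \<le> C * (1 + \<bar>Im z\<bar>) ^ N * exp (- (pi / 2) * \<bar>Im z\<bar>)"
    using norm_Gamma_strip[of 1 N] by auto
  obtain C' where C': "C' > 0" "\<And>v::real. (1 + \<bar>v\<bar>) ^ N * exp (- (pi / 2) * \<bar>v\<bar>) \<le> C' / (1 + v\<^sup>2)"
    using power_exp_decay[of "pi / 2" N] by auto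
  have "norm (Gamma w) \<le> C * C'" if w: "a \<le> Re w" "Re w \<le> b" "\<bar>Im w\<bar> \<ge> 1" for w
  proof -
    have nz: "w \<notin> \<int>\<^sub>\<le>\<^sub>0" using w(3) by (auto elim!: nonpos_Ints_cases)
    have "pochhammer w n = Gamma (w + of_nat n) / Gamma w"
      by (rule pochhammer_Gamma[OF nz])
    then have "norm (pochhammer w n) * norm (Gamma w) = norm (Gamma (w + of_nat n))"
      using nz by (simp add: norm_divide Gamma_eq_zero_iff)
    moreover have "norm (pochhammer w n) \<ge> 1"
    proof -
      have "1 \<le> norm (w + of_nat k)" for k
        using abs_Im_le_cmod[of "w + of_nat k"] w(3) by simp
      then show ?thesis
        by (simp add: pochhammer_prod prod_norm[symmetric] prod_ge_1)
    qed
    ultimately have "norm (Gamma w) \<le> norm (Gamma (w + of_nat n))"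
      using mult_right_mono[of 1 "norm (pochhammer w n)" "norm (Gamma w)"] by simp
    also have "\<dots> \<le> C * ((1 + \<bar>Im w\<bar>) ^ N * exp (- (pi / 2) * \<bar>Im w\<bar>))"
      using C(2)[of "w + of_nat n"] w n N by (simp add: mult.assoc)
    also have "\<dots> \<le> C * (C' / (1 + (Im w)\<^sup>2))"
      using C(1) C'(2) by (intro mult_left_mono) auto
    also have "\<dots> \<le> C * (C' / 1)"
      using C(1) C'(1) by (intro mult_left_mono divide_left_mono) (auto simp: add_pos_nonneg)
    finally show ?thesis by simp
  qed
  then show ?thesis using that[of "C * C'"] C(1) C'(1) by simp
qed

lemma norm_exp_strip:
  assumes "\<bar>Re w\<bar> \<le> X"
  shows "norm (exp (- w * L)) \<le> exp (X * \<bar>Re L\<bar>) * exp (\<bar>Im L\<bar> * \<bar>Im w\<bar>)"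
proof -
  have "- (Re w * Re L) \<le> \<bar>Re w\<bar> * \<bar>Re L\<bar>"
    by (metis abs_ge_minus_self abs_mult)
  also have "\<dots> \<le> X * \<bar>Re L\<bar>"
    using assms by (intro mult_right_mono) auto
  finally have "- (Re w * Re L) \<le> X * \<bar>Re L\<bar>" .
  moreover have "Im w * Im L \<le> \<bar>Im L\<bar> * \<bar>Im w\<bar>"
    by (metis abs_ge_self abs_mult mult.commute)
  moreover have "Re (- w * L) = Im w * Im L - Re w * Re L"
    by simp
  ultimately show ?thesis
    unfolding norm_exp_eq_Re exp_add[symmetric] exp_le_cancel_iff by linarith
qed

lemma Re_pos_not_nonpos_Int: "Re z > 0 \<Longrightarrow> z \<notin> \<int>\<^sub>\<le>\<^sub>0"
  by (auto elim!: nonpos_Ints_cases)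

text \<open>Between the two lines Gamma has the single pole \<open>- k\<close>, with residue
  \<open>(-1) ^ k / fact k\<close>. The cofactor is kept general because the lemma serves both the
  Cahen--Mellin formula, with an exponential, and the Mellin--Barnes recurrence, with an additional
  Gamma factor.\<close>

lemma Gamma_shift_one_pole:
  fixes \<phi> :: "complex \<Rightarrow> complex"
  assumes S: "open S" "{w. 1 / 2 - real (Suc k) \<le> Re w \<and> Re w \<le> 1 / 2 - real k} \<subseteq> S"
    and hol: "\<phi> holomorphic_on S"
    and growth: "\<And>w. 1 / 2 - real (Suc k) \<le> Re w \<Longrightarrow> Re w \<le> 1 / 2 - real k \<Longrightarrow> \<bar>Im w\<bar> \<ge> 1 \<Longrightarrow>
        norm (\<phi> w) \<le> A * exp (B * \<bar>Im w\<bar> ^ N)"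
    and int_l: "integrable lborel (\<lambda>v. Gamma (Complex (1 / 2 - real (Suc k)) v) * \<phi> (Complex (1 / 2 - real (Suc k)) v))"
    and int_r: "integrable lborel (\<lambda>v. Gamma (Complex (1 / 2 - real k) v) * \<phi> (Complex (1 / 2 - real k) v))"
  shows "(LINT v|lborel. Gamma (Complex (1 / 2 - real k) v) * \<phi> (Complex (1 / 2 - real k) v)) -
    (LINT v|lborel. Gamma (Complex (1 / 2 - real (Suc k)) v) * \<phi> (Complex (1 / 2 - real (Suc k)) v))
    = 2 * of_real pi * ((-1) ^ k / fact k) * \<phi> (- of_nat k)"
proof -
  define a b where "a = 1 / 2 - real (Suc k)" and "b = 1 / 2 - real k"
  have ab: "a < b" "b = a + 1" by (simp_all add: a_def b_def)
  define f where "f w = Gamma w * \<phi> w" for w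
  obtain C where C: "C > 0" "\<And>w. a \<le> Re w \<Longrightarrow> Re w \<le> b \<Longrightarrow> \<bar>Im w\<bar> \<ge> 1 \<Longrightarrow> norm (Gamma w :: complex) \<le> C"
    using norm_Gamma_bounded_strip[of a b] ab by auto
  let ?R = "rectpath (Complex a (-1)) (Complex b 1)"
  have nonpos: "w \<notin> \<int>\<^sub>\<le>\<^sub>0" if "a \<le> Re w" "Re w \<le> b" "w \<notin> box (Complex a (-1)) (Complex b 1)" for w
  proof
    assume w: "w \<in> \<int>\<^sub>\<le>\<^sub>0"
    then have "Im w = 0" by (auto elim!: nonpos_Ints_cases)
    then have "Re w = a \<or> Re w = b"
      using that by (auto simp: in_box_complex_iff)
    moreover have "w = Complex (Re w) (Im w)" by simp
    ultimately show False
      using w half_int_not_nonpos_Int[of k "Im w"] half_int_not_nonpos_Int[of "Suc k" "Im w"]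
      unfolding a_def b_def by metis
  qed
  have main: "\<i> * (LINT v|lborel. f (Complex b v)) - \<i> * (LINT v|lborel. f (Complex a v)) = contour_integral ?R f"
  proof (rule strip_shift[where S = "S - \<int>\<^sub>\<le>\<^sub>0" and A = "C * A" and B = B and N = N])
    show "open (S - \<int>\<^sub>\<le>\<^sub>0)"
      using S(1) by (intro open_Diff) auto
    show "{w. a \<le> Re w \<and> Re w \<le> b} - box (Complex a (- 1)) (Complex b 1) \<subseteq> S - \<int>\<^sub>\<le>\<^sub>0"
      using S(2) nonpos unfolding a_def b_def by blast
    show "f holomorphic_on S - \<int>\<^sub>\<le>\<^sub>0"
      unfolding f_def by (intro holomorphic_intros holomorphic_on_subset[OF hol]) auto
    show "norm (f w) \<le> C * A * exp (B * \<bar>Im w\<bar> ^ N)" if "a \<le> Re w" "Re w \<le> b" "1 \<le> \<bar>Im w\<bar>" for w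
    proof -
      have "norm (f w) \<le> C * (A * exp (B * \<bar>Im w\<bar> ^ N))"
        unfolding f_def norm_mult using C that growth[of w]
        by (intro mult_mono) (auto simp: a_def b_def)
      then show ?thesis by (simp add: mult.assoc)
    qed
  qed (use ab int_l int_r in \<open>simp_all add: f_def a_def b_def\<close>)
  have "contour_integral ?R f = 2 * of_real pi * \<i> * ((-1) ^ k / fact k * \<phi> (- of_nat k))"
  proof -
    \<comment> \<open>The numerator of the simple pole:
      \<open>Gamma w * \<phi> w = g w / (w + k)\<close> by \<open>k + 1\<close> applications of the
      functional equation, and \<open>g\<close> has no pole in the box. Cauchy's integral formula
      then plays the part of the residue theorem.\<close>
    define g where "g w = Gamma (w + of_nat (Suc k)) * \<phi> w / pochhammer w k" for w
    have re: "Re w + real j \<noteq> 0" if "a \<le> Re w" "Re w \<le> b" "j < k" for w j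
      using that by (simp add: a_def b_def)
    have poch: "pochhammer w k \<noteq> 0" if "a \<le> Re w" "Re w \<le> b" for w
    proof -
      have "w + of_nat j \<noteq> 0" if "j < k" for j
        using re[OF \<open>a \<le> Re w\<close> \<open>Re w \<le> b\<close> that] by (auto simp: complex_eq_iff)
      then show ?thesis by (simp add: pochhammer_prod)
    qed
    have box: "- of_nat k \<in> box (Complex a (-1)) (Complex b 1)"
      by (simp add: in_box_complex_iff a_def b_def)
    have holg: "g holomorphic_on cbox (Complex a (-1)) (Complex b 1)"
      unfolding g_def
    proof (intro holomorphic_on_divide holomorphic_on_mult holomorphic_Gamma')
      show "(\<lambda>w. w + of_nat (Suc k)) holomorphic_on cbox (Complex a (-1)) (Complex b 1)"
        by (intro holomorphic_intros)
      show "w + of_nat (Suc k) \<notin> \<int>\<^sub>\<le>\<^sub>0" if "w \<in> cbox (Complex a (-1)) (Complex b 1)" for w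
      proof
        assume "w + of_nat (Suc k) \<in> \<int>\<^sub>\<le>\<^sub>0"
        then have "\<not> Re (w + of_nat (Suc k)) > 0" using Re_pos_not_nonpos_Int by blast
        then show False using that by (simp add: in_cbox_complex_iff a_def)
      qed
      show "\<phi> holomorphic_on cbox (Complex a (-1)) (Complex b 1)"
        using S(2) by (intro holomorphic_on_subset[OF hol]) (auto simp: in_cbox_complex_iff a_def b_def)
      show "(\<lambda>w. pochhammer w k) holomorphic_on cbox (Complex a (-1)) (Complex b 1)"
        unfolding pochhammer_prod by (intro holomorphic_intros)
    qed (use poch in \<open>auto simp: in_cbox_complex_iff\<close>)
    have "((\<lambda>w. g w / (w - (- of_nat k))) has_contour_integral
        (2 * pi * \<i> * winding_number ?R (- of_nat k) * g (- of_nat k))) ?R"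
    proof (rule Cauchy_integral_formula_convex_simple[OF convex_box(1) holg])
      show "- of_nat k \<in> interior (cbox (Complex a (-1)) (Complex b 1))"
        using box by (simp add: interior_cbox)
      show "path_image ?R \<subseteq> cbox (Complex a (-1)) (Complex b 1) - {- of_nat k}"
        using box ab by (subst path_image_rectpath_cbox_minus_box) auto
    qed (rule valid_path_rectpath, simp)
    then have "(f has_contour_integral (2 * pi * \<i> * winding_number ?R (- of_nat k) * g (- of_nat k))) ?R"
    proof (rule has_contour_integral_eq)
      fix w assume "w \<in> path_image ?R"
      then have w: "w \<notin> box (Complex a (-1)) (Complex b 1)" "a \<le> Re w" "Re w \<le> b"
        using ab by (auto simp: path_image_rectpath_cbox_minus_box in_cbox_complex_iff)
      then have "w \<notin> \<int>\<^sub>\<le>\<^sub>0" using nonpos by blast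
      then have "pochhammer w (Suc k) = Gamma (w + of_nat (Suc k)) / Gamma w" "Gamma w \<noteq> 0"
        using pochhammer_Gamma Gamma_eq_zero_iff by blast+
      then have "Gamma (w + of_nat (Suc k)) = Gamma w * (pochhammer w k * (w + of_nat k))"
        by (simp add: pochhammer_Suc field_simps)
      moreover have "w + of_nat k \<noteq> 0"
        using w(1) box by (metis add_eq_0_iff2)
      ultimately show "g w / (w - (- of_nat k)) = f w"
        using poch[OF w(2,3)] by (simp add: g_def f_def del: of_nat_Suc)
    qed
    then have "contour_integral ?R f = 2 * pi * \<i> * winding_number ?R (- of_nat k) * g (- of_nat k)"
      by (rule contour_integral_unique)
    also have "winding_number ?R (- of_nat k) = 1"
      by (rule winding_number_rectpath[OF box])
    also have "g (- of_nat k) = (-1) ^ k / fact k * \<phi> (- of_nat k)"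
    proof -
      have "(-1 :: complex) ^ k * (-1) ^ k = 1"
        by (simp flip: power_mult_distrib)
      then have "1 / ((-1) ^ k * fact k) = (-1 :: complex) ^ k / fact k"
        by (simp add: field_simps)
      then have "\<phi> (- of_nat k) / ((-1) ^ k * fact k) = (-1) ^ k / fact k * \<phi> (- of_nat k)"
        by (metis mult.commute mult_1 times_divide_eq_right)
      then show ?thesis
        by (simp add: g_def pochhammer_same)
    qed
    finally show ?thesis by simp
  qed
  with main have "\<i> * ((LINT v|lborel. f (Complex b v)) - (LINT v|lborel. f (Complex a v))) 
     = \<i> * (2 * of_real pi * ((-1) ^ k / fact k) * \<phi> (- of_nat k))"
    by (simp add: algebra_simps)
  then have "(LINT v|lborel. f (Complex b v)) - (LINT v|lborel. f (Complex a v)) = 2 * of_real pi * ((-1) ^ k / fact k) * \<phi> (- of_nat k)"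
    by (simp only: mult_left_cancel[OF complex_i_not_zero])
  then show ?thesis
    by (simp only: f_def a_def b_def)
qed

section \<open>Mellin integrals and the Cahen--Mellin formula\<close>

lemma norm_exp_line: "norm (exp (- Complex x v * L)) = exp (- (x * Re L)) * exp (v * Im L)"
  by (simp add: norm_exp_eq_Re exp_add[symmetric])

lemma continuous_on_Gamma_compose:
  fixes f :: "_ \<Rightarrow> complex"
  assumes "continuous_on A f" "\<And>x. x \<in> A \<Longrightarrow> f x \<notin> \<int>\<^sub>\<le>\<^sub>0"
  shows "continuous_on A (\<lambda>x. Gamma (f x))"
proof -
  have "continuous_on (- \<int>\<^sub>\<le>\<^sub>0) (Gamma :: complex \<Rightarrow> complex)"
    by (intro holomorphic_on_imp_continuous_on holomorphic_Gamma) auto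
  then show ?thesis
    by (rule continuous_on_compose2) (use assms in auto)
qed

text \<open>The constant depends on \<open>L\<close> through \<open>Im L\<close> only: a series over
  \<open>n\<close> is later integrated termwise, with \<open>Re L\<close> growing like
  \<open>ln n / d\<close>.\<close>

lemma Mellin_bound:
  assumes "b > 0" "\<bar>t\<bar> < pi / 2"
  obtains C where "C > 0" 
    "\<And>v L. Im L = t \<Longrightarrow> norm (Gamma (Complex b v) * exp (- Complex b v * L)) \<le> C * exp (- (b * Re L)) / (1 + v\<^sup>2)"
proof -
  define N where "N = nat \<lceil>b\<rceil>"
  have N: "b \<le> real N + 1 / 2" unfolding N_def by linarith
  obtain C where C: "C > 0" "\<And>z. b \<le> Re z \<Longrightarrow> Re z \<le> real N + 1 / 2 \<Longrightarrow> norm (Gamma z) \<le> C * (1 + \<bar>Im z\<bar>) ^ N * exp (- (pi / 2) * \<bar>Im z\<bar>)"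
    using norm_Gamma_strip[of b N] assms by auto
  define \<delta> where "\<delta> = pi / 2 - \<bar>t\<bar>"
  have "\<delta> > 0" using assms by (simp add: \<delta>_def)
  then obtain C' where C': "C' > 0" "\<And>v::real. (1 + \<bar>v\<bar>) ^ N * exp (- \<delta> * \<bar>v\<bar>) \<le> C' / (1 + v\<^sup>2)"
    using power_exp_decay[of \<delta> N] by auto
  have "norm (Gamma (Complex b v) * exp (- Complex b v * L)) \<le> (C * C') * exp (- (b * Re L)) / (1 + v\<^sup>2)" if "Im L = t" for v L
  proof -
    have "norm (Gamma (Complex b v) * exp (- Complex b v * L)) 
       \<le> (C * (1 + \<bar>v\<bar>) ^ N * exp (- (pi / 2) * \<bar>v\<bar>)) * (exp (- (b * Re L)) * exp (v * t))"
      unfolding norm_mult norm_exp_line that using C(2)[of "Complex b v"] N by (intro mult_right_mono) auto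
    also have "\<dots> \<le> (C * (1 + \<bar>v\<bar>) ^ N * exp (- (pi / 2) * \<bar>v\<bar>)) * (exp (- (b * Re L)) * exp (\<bar>v\<bar> * \<bar>t\<bar>))"
      using C(1) by (intro mult_left_mono) (auto simp: abs_mult[symmetric])
    also have "\<dots> = C * exp (- (b * Re L)) * ((1 + \<bar>v\<bar>) ^ N * exp (- \<delta> * \<bar>v\<bar>))"
    proof -
      have "exp (- (pi / 2) * \<bar>v\<bar>) * exp (\<bar>v\<bar> * \<bar>t\<bar>) = exp (- \<delta> * \<bar>v\<bar>)"
        unfolding exp_add[symmetric] by (simp add: \<delta>_def algebra_simps)
      moreover have "(C * (1 + \<bar>v\<bar>) ^ N * exp (- (pi / 2) * \<bar>v\<bar>)) * (exp (- (b * Re L)) * exp (\<bar>v\<bar> * \<bar>t\<bar>))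
        = C * exp (- (b * Re L)) * ((1 + \<bar>v\<bar>) ^ N * (exp (- (pi / 2) * \<bar>v\<bar>) * exp (\<bar>v\<bar> * \<bar>t\<bar>)))"
        by (simp only: ac_simps)
      ultimately show ?thesis by simp
    qed
    also have "\<dots> \<le> C * exp (- (b * Re L)) * (C' / (1 + v\<^sup>2))"
      using C(1) C'(2) by (intro mult_left_mono) auto
    finally show ?thesis by (simp add: mult_ac)
  qed
  then show ?thesis using that[of "C * C'"] C(1) C'(1) by simp
qed

lemma integrable_Mellin:
  assumes "b > 0" "\<bar>Im L\<bar> < pi / 2"
  shows "integrable lborel (\<lambda>v. Gamma (Complex b v) * exp (- Complex b v * L))"
proof -
  obtain C where "\<And>v. norm (Gamma (Complex b v) * exp (- Complex b v * L)) \<le> C * exp (- (b * Re L)) / (1 + v\<^sup>2)"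
    using Mellin_bound[OF assms] by metis
  then show ?thesis
    by (intro integrable_quadratic_decay continuous_intros continuous_on_Gamma_compose)
       (use assms Re_pos_not_nonpos_Int in auto)
qed

lemma Mellin_left_bound:
  assumes "\<bar>Im L\<bar> < pi / 2"
  obtains C where "C > 0"
    "\<And>k v. norm (Gamma (Complex (1 / 2 - real k) v) * exp (- Complex (1 / 2 - real k) v * L))
       \<le> C * (exp (real k * Re L) / (\<Prod>j<k. real j + 1 / 2)) / (1 + v\<^sup>2)"
proof -
  define \<delta> where "\<delta> = pi / 2 - \<bar>Im L\<bar>"
  have "\<delta> > 0" using assms by (simp add: \<delta>_def)
  then obtain C' where C': "C' > 0" "\<And>v::real. (1 + \<bar>v\<bar>) ^ 0 * exp (- \<delta> * \<bar>v\<bar>) \<le> C' / (1 + v\<^sup>2)"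
    using power_exp_decay[of \<delta> 0] by metis
  define C where "C = sqrt (2 * pi) * exp (- (Re L / 2)) * C'"
  have "norm (Gamma (Complex (1 / 2 - real k) v) * exp (- Complex (1 / 2 - real k) v * L))
       \<le> C * (exp (real k * Re L) / (\<Prod>j<k. real j + 1 / 2)) / (1 + v\<^sup>2)" for k v
  proof -
    define P where "P = (\<Prod>j<k. real j + 1 / 2)"
    have P: "P > 0" unfolding P_def by (auto intro!: prod_pos add_nonneg_pos)
    have "exp (v * Im L) \<le> exp (\<bar>v\<bar> * \<bar>Im L\<bar>)"
      by (auto simp: abs_mult[symmetric])
    then have "norm (Gamma (Complex (1 / 2 - real k) v) * exp (- Complex (1 / 2 - real k) v * L))
      \<le> (sqrt (2 * pi) / P * exp (- (pi / 2) * \<bar>v\<bar>)) * (exp (- ((1 / 2 - real k) * Re L)) * exp (\<bar>v\<bar> * \<bar>Im L\<bar>))"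
      unfolding norm_mult norm_exp_line P_def
      by (intro mult_mono norm_Gamma_left_prod) (auto intro!: divide_nonneg_nonneg prod_nonneg add_nonneg_pos)
    also have "\<dots> = sqrt (2 * pi) / P * exp (- ((1 / 2 - real k) * Re L)) * (exp (- (pi / 2) * \<bar>v\<bar>) * exp (\<bar>v\<bar> * \<bar>Im L\<bar>))"
      by (simp only: ac_simps)
    also have "exp (- (pi / 2) * \<bar>v\<bar>) * exp (\<bar>v\<bar> * \<bar>Im L\<bar>) = exp (- \<delta> * \<bar>v\<bar>)"
      unfolding exp_add[symmetric] by (simp add: \<delta>_def algebra_simps)
    also have "exp (- ((1 / 2 - real k) * Re L)) = exp (- (Re L / 2)) * exp (real k * Re L)"
      unfolding exp_add[symmetric] by (simp add: algebra_simps)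
    also have "sqrt (2 * pi) / P * (exp (- (Re L / 2)) * exp (real k * Re L)) * exp (- \<delta> * \<bar>v\<bar>)
        \<le> sqrt (2 * pi) / P * (exp (- (Re L / 2)) * exp (real k * Re L)) * (C' / (1 + v\<^sup>2))"
      using P C'(2)[of v] by (intro mult_left_mono) auto
    finally show ?thesis
      by (simp add: C_def P_def mult_ac)
  qed
  moreover have "C > 0" using C' by (simp add: C_def)
  ultimately show ?thesis using that by blast
qed

lemma integrable_Mellin_left:
  assumes "\<bar>Im L\<bar> < pi / 2"
  shows "integrable lborel (\<lambda>v. Gamma (Complex (1 / 2 - real k) v) * exp (- Complex (1 / 2 - real k) v * L))"
proof -
  obtain C where "\<And>k v. norm (Gamma (Complex (1 / 2 - real k) v) * exp (- Complex (1 / 2 - real k) v * L))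
       \<le> C * (exp (real k * Re L) / (\<Prod>j<k. real j + 1 / 2)) / (1 + v\<^sup>2)"
    using Mellin_left_bound[OF assms] by blast
  then show ?thesis
    by (intro integrable_quadratic_decay continuous_intros continuous_on_Gamma_compose half_int_not_nonpos_Int)
qed

lemma exp_over_half_factorial_tendsto_0: "(\<lambda>k. exp (real k * R) / (\<Prod>j<k. real j + 1 / 2)) \<longlonglongrightarrow> 0"
proof (rule summable_LIMSEQ_zero, rule summable_ratio_test[of "1 / 2"])
  fix k assume k: "nat \<lceil>2 * exp R\<rceil> \<le> k"
  have P: "(\<Prod>j<k. real j + 1 / 2) > 0" by (auto intro!: prod_pos add_nonneg_pos)
  have "exp R / (real k + 1 / 2) \<le> 1 / 2"
    using k by (simp add: divide_le_eq)
  then have "(exp (real k * R) / (\<Prod>j<k. real j + 1 / 2)) * (exp R / (real k + 1 / 2)) \<le> (exp (real k * R) / (\<Prod>j<k. real j + 1 / 2)) * (1 / 2)"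
    using P by (intro mult_left_mono) auto
  moreover have "exp (real (Suc k) * R) = exp (real k * R) * exp R"
    by (simp add: exp_add[symmetric] algebra_simps)
  ultimately show "norm (exp (real (Suc k) * R) / (\<Prod>j<Suc k. real j + 1 / 2)) \<le> 1 / 2 * norm (exp (real k * R) / (\<Prod>j<k. real j + 1 / 2))"
    using P by simp
qed simp

text \<open>Moving the line to the left by one unit \<open>k\<close> times collects the first
  \<open>k\<close> terms of the series of \<open>exp (- exp L)\<close>; the remaining integral tends
  to 0.\<close>

lemma Cahen_Mellin_half:
  assumes L: "\<bar>Im L\<bar> < pi / 2"
  shows "(LINT v|lborel. Gamma (Complex (1 / 2) v) * exp (- Complex (1 / 2) v * L)) = 2 * of_real pi * exp (- exp L)"
proof -
  define J where "J k = (LINT v|lborel. Gamma (Complex (1 / 2 - real k) v) * exp (- Complex (1 / 2 - real k) v * L))" for k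
  have step: "J k - J (Suc k) = 2 * of_real pi * ((- exp L) ^ k / fact k)" for k
  proof -
    have "J k - J (Suc k) = 2 * of_real pi * ((-1) ^ k / fact k) * exp (- (- of_nat k) * L)"
      unfolding J_def
    proof (rule Gamma_shift_one_pole[where S = UNIV and A = "exp ((real k + 1) * \<bar>Re L\<bar>)" and B = "\<bar>Im L\<bar>" and N = 1])
      show "norm (exp (- w * L)) \<le> exp ((real k + 1) * \<bar>Re L\<bar>) * exp (\<bar>Im L\<bar> * \<bar>Im w\<bar> ^ 1)"
        if "1 / 2 - real (Suc k) \<le> Re w" "Re w \<le> 1 / 2 - real k" for w
        using norm_exp_strip[of w "real k + 1" L] that by simp
    qed (use integrable_Mellin_left[OF L, of k] integrable_Mellin_left[OF L, of "Suc k"] in \<open>auto intro!: holomorphic_intros\<close>)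
    also have "exp (- (- of_nat k) * L) = exp L ^ k"
      by (simp add: exp_of_nat_mult)
    finally show ?thesis
      by (simp add: power_minus[of "exp L"])
  qed
  have sum: "J 0 - J k = 2 * of_real pi * (\<Sum>j<k. (- exp L) ^ j / fact j)" for k
  proof (induction k)
    case (Suc k)
    have "J 0 - J (Suc k) = (J 0 - J k) + (J k - J (Suc k))" by simp
    then show ?case unfolding Suc.IH step by (simp add: distrib_left)
  qed simp
  obtain C where C: "\<And>k v. norm (Gamma (Complex (1 / 2 - real k) v) * exp (- Complex (1 / 2 - real k) v * L))
       \<le> C * (exp (real k * Re L) / (\<Prod>j<k. real j + 1 / 2)) / (1 + v\<^sup>2)"
    using Mellin_left_bound[OF L] by blast
  have "norm (J k) \<le> C * (exp (real k * Re L) / (\<Prod>j<k. real j + 1 / 2)) * (LINT v|lborel. 1 / (1 + v\<^sup>2))" for k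
  proof -
    have "norm (J k) \<le> (LINT v|lborel. C * (exp (real k * Re L) / (\<Prod>j<k. real j + 1 / 2)) * (1 / (1 + v\<^sup>2)))"
      unfolding J_def
    proof (rule Bochner_Integration.integral_norm_bound_integral)
      show "norm (Gamma (Complex (1 / 2 - real k) v) * exp (- Complex (1 / 2 - real k) v * L)) 
         \<le> C * (exp (real k * Re L) / (\<Prod>j<k. real j + 1 / 2)) * (1 / (1 + v\<^sup>2))" for v
        using C[of k v] by simp
    qed (intro integrable_Mellin_left[OF L] integrable_mult_right integrable_inverse_quadratic)+
    also have "\<dots> = C * (exp (real k * Re L) / (\<Prod>j<k. real j + 1 / 2)) * (LINT v|lborel. 1 / (1 + v\<^sup>2))"
      by (rule integral_mult_right_zero)
    finally show ?thesis .
  qed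
  moreover have "(\<lambda>k. C * (exp (real k * Re L) / (\<Prod>j<k. real j + 1 / 2)) * (LINT v|lborel. 1 / (1 + v\<^sup>2))) \<longlonglongrightarrow> 0"
    by (intro tendsto_mult_left_zero tendsto_mult_right_zero exp_over_half_factorial_tendsto_0)
  ultimately have J0: "J \<longlonglongrightarrow> 0"
    using Lim_null_comparison[of J] by (metis (no_types, lifting) always_eventually)
  have "(\<lambda>k. 2 * of_real pi * (\<Sum>j<k. (- exp L) ^ j / fact j)) \<longlonglongrightarrow> 2 * of_real pi * exp (- exp L)"
    using exp_converges[of "- exp L"]
    by (intro tendsto_mult tendsto_const) (simp add: sums_def scaleR_conv_of_real divide_inverse mult.commute)
  moreover have "(\<lambda>k. 2 * of_real pi * (\<Sum>j<k. (- exp L) ^ j / fact j)) \<longlonglongrightarrow> J 0 - 0"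
    unfolding sum[symmetric] by (intro tendsto_diff tendsto_const J0)
  ultimately have "2 * of_real pi * exp (- exp L) = J 0 - 0"
    by (rule LIMSEQ_unique)
  then show ?thesis by (simp add: J_def)
qed

text \<open>No pole lies between the abscissae \<open>1 / 2\<close> and \<open>b\<close>, so the
  value of the integral is unchanged.\<close>

lemma Cahen_Mellin:
  assumes L: "\<bar>Im L\<bar> < pi / 2" and b: "b > 1 / 2"
  shows "(LINT v|lborel. Gamma (Complex b v) * exp (- Complex b v * L)) = 2 * of_real pi * exp (- exp L)"
proof -
  let ?f = "\<lambda>w. Gamma w * exp (- w * L)"
  have hol: "?f holomorphic_on {w. Re w > 0}"
    by (intro holomorphic_intros) (auto dest: Re_pos_not_nonpos_Int)
  obtain C where C: "C > 0" "\<And>w. 1 / 2 \<le> Re w \<Longrightarrow> Re w \<le> b \<Longrightarrow> \<bar>Im w\<bar> \<ge> 1 \<Longrightarrow> norm (Gamma w :: complex) \<le> C"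
    using norm_Gamma_bounded_strip[of "1 / 2" b] b by auto
  have "\<i> * (LINT v|lborel. ?f (Complex b v)) - \<i> * (LINT v|lborel. ?f (Complex (1 / 2) v))
     = contour_integral (rectpath (Complex (1 / 2) (-1)) (Complex b 1)) ?f"
  proof (rule strip_shift[where S = "{w. Re w > 0}" and A = "C * exp (b * \<bar>Re L\<bar>)" and B = "\<bar>Im L\<bar>" and N = 1])
    show "open {w. Re w > 0}" by (rule open_halfspace_Re_gt)
    show "norm (Gamma w * exp (- w * L)) \<le> C * exp (b * \<bar>Re L\<bar>) * exp (\<bar>Im L\<bar> * \<bar>Im w\<bar> ^ 1)"
      if "1 / 2 \<le> Re w" "Re w \<le> b" "1 \<le> \<bar>Im w\<bar>" for w
    proof -
      have "norm (exp (- w * L)) \<le> exp (b * \<bar>Re L\<bar>) * exp (\<bar>Im L\<bar> * \<bar>Im w\<bar> ^ 1)"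
        using norm_exp_strip[of w b L] that by simp
      then show ?thesis
        unfolding norm_mult mult.assoc using C that by (intro mult_mono) auto
    qed
  qed (use b hol integrable_Mellin[OF _ L] in auto)
  also have "\<dots> = 0"
  proof (rule contour_integral_unique, rule Cauchy_theorem_convex_simple[OF hol convex_halfspace_Re_gt])
    show "path_image (rectpath (Complex (1 / 2) (-1)) (Complex b 1)) \<subseteq> {w. Re w > 0}"
      using b by (subst path_image_rectpath) auto
  qed (rule valid_path_rectpath, simp)
  finally show ?thesis
    using Cahen_Mellin_half[OF L] by simp
qed

subsection \<open>A Mellin--Barnes integral\<close>

lemma norm_Gamma_shifted:
  assumes "x1 > 0" "B \<ge> 0"
  obtains C where "C > 0"
    "\<And>u x v. x1 \<le> Re u - x \<Longrightarrow> Re u - x \<le> real N + 1 / 2 \<Longrightarrow> \<bar>Im u\<bar> \<le> B \<Longrightarrow>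
      norm (Gamma (u - Complex x v)) \<le> C * (1 + \<bar>v\<bar>) ^ N * exp (- (pi / 2) * \<bar>v\<bar>)"
proof -
  obtain C where C: "C > 0" 
    "\<And>z. x1 \<le> Re z \<Longrightarrow> Re z \<le> real N + 1 / 2 \<Longrightarrow> norm (Gamma z) \<le> C * (1 + \<bar>Im z\<bar>) ^ N * exp (- (pi / 2) * \<bar>Im z\<bar>)"
    using norm_Gamma_strip[OF assms(1), of N] by blast
  have "norm (Gamma (u - Complex x v)) \<le> (C * (1 + B) ^ N * exp (pi / 2 * B)) * (1 + \<bar>v\<bar>) ^ N * exp (- (pi / 2) * \<bar>v\<bar>)"
    if "x1 \<le> Re u - x" "Re u - x \<le> real N + 1 / 2" "\<bar>Im u\<bar> \<le> B" for u x v
  proof -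
    have "1 + \<bar>Im u - v\<bar> \<le> (1 + B) * (1 + \<bar>v\<bar>)"
    proof -
      have "(1 + B) * (1 + \<bar>v\<bar>) = 1 + B + \<bar>v\<bar> + B * \<bar>v\<bar>" by (simp add: algebra_simps)
      moreover have "0 \<le> B * \<bar>v\<bar>" using assms(2) by simp
      ultimately show ?thesis using that(3) by linarith
    qed
    then have "(1 + \<bar>Im u - v\<bar>) ^ N \<le> ((1 + B) * (1 + \<bar>v\<bar>)) ^ N"
      by (intro power_mono) auto
    moreover have "exp (- (pi / 2) * \<bar>Im u - v\<bar>) \<le> exp (pi / 2 * B) * exp (- (pi / 2) * \<bar>v\<bar>)"
    proof -
      have "\<bar>v\<bar> \<le> B + \<bar>Im u - v\<bar>" using that(3) by linarith
      then have "pi / 2 * \<bar>v\<bar> \<le> pi / 2 * (B + \<bar>Im u - v\<bar>)"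
        by (intro mult_left_mono) auto
      then show ?thesis
        unfolding exp_add[symmetric] by (simp add: algebra_simps)
    qed
    ultimately have "C * (1 + \<bar>Im u - v\<bar>) ^ N * exp (- (pi / 2) * \<bar>Im u - v\<bar>) 
       \<le> C * ((1 + B) * (1 + \<bar>v\<bar>)) ^ N * (exp (pi / 2 * B) * exp (- (pi / 2) * \<bar>v\<bar>))"
      using C(1) assms(2) by (intro mult_mono) auto
    moreover have "norm (Gamma (u - Complex x v)) \<le> C * (1 + \<bar>Im u - v\<bar>) ^ N * exp (- (pi / 2) * \<bar>Im u - v\<bar>)"
      using C(2)[of "u - Complex x v"] that by simp
    ultimately show ?thesis
      by (simp add: power_mult_distrib mult_ac)
  qed
  then show ?thesis
    using that[of "C * (1 + B) ^ N * exp (pi / 2 * B)"] C(1) assms(2) by simp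
qed

text \<open>Formally the integral below is \<open>\<Gamma>(u) (1 - r) powr (-u)\<close> minus the first \<open>K\<close> terms of its
  binomial series; the argument \<open>\<pi>\<close> is on the boundary of convergence, which forces \<open>Re u < 0\<close>.\<close>

definition MB_integrand :: "nat \<Rightarrow> complex \<Rightarrow> real \<Rightarrow> real \<Rightarrow> complex" where
  "MB_integrand K u r v = Gamma (u - Complex (1 / 2 - real K) v) * Gamma (Complex (1 / 2 - real K) v) *
     exp (- Complex (1 / 2 - real K) v * Complex (ln r) pi)"

definition MB :: "nat \<Rightarrow> complex \<Rightarrow> real \<Rightarrow> complex" where
  "MB K u r = (LINT v|lborel. MB_integrand K u r v) / (2 * of_real pi)"

text \<open>The exponential decay of the two Gamma factors is used up by \<open>exp (pi v)\<close>.
  What is left is \<open>(1 + \<bar>v\<bar>) ^ K / (1 + \<bar>v\<bar>) ^ (K + 2)\<close>; the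
  exponent \<open>K\<close> for the first Gamma factor is available precisely when
  \<open>Re u \<le> - 1\<close>.\<close>

lemma norm_MB_integrand:
  assumes "x1 > 0" "B \<ge> 0"
  obtains C where "C > 0"
    "\<And>u r v. x1 + 1 / 2 - real (K + 2) \<le> Re u \<Longrightarrow> Re u \<le> - 1 \<Longrightarrow> \<bar>Im u\<bar> \<le> B \<Longrightarrow> r > 0 \<Longrightarrow>
       norm (MB_integrand (K + 2) u r v) \<le> C * r powr (real (K + 2) - 1 / 2) / (1 + v\<^sup>2)"
proof -
  define x where "x = 1 / 2 - real (K + 2)"
  obtain C where C: "C > 0" 
    "\<And>u x v. x1 \<le> Re u - x \<Longrightarrow> Re u - x \<le> real K + 1 / 2 \<Longrightarrow> \<bar>Im u\<bar> \<le> B \<Longrightarrow>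
      norm (Gamma (u - Complex x v)) \<le> C * (1 + \<bar>v\<bar>) ^ K * exp (- (pi / 2) * \<bar>v\<bar>)"
    using norm_Gamma_shifted[OF assms, of K] by blast
  have "norm (MB_integrand (K + 2) u r v) \<le> (C * (sqrt (2 * pi) * 3 ^ (K + 2))) * r powr (real (K + 2) - 1 / 2) / (1 + v\<^sup>2)"
    if u: "x1 + x \<le> Re u" "Re u \<le> - 1" "\<bar>Im u\<bar> \<le> B" and r: "r > 0" for u r v
  proof -
    have "norm (exp (- Complex x v * Complex (ln r) pi)) = r powr (real (K + 2) - 1 / 2) * exp (v * pi)"
      unfolding norm_exp_line using r by (simp add: powr_def x_def algebra_simps)
    also have "\<dots> \<le> r powr (real (K + 2) - 1 / 2) * exp (pi * \<bar>v\<bar>)"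
      by (intro mult_left_mono) auto
    finally have e: "norm (exp (- Complex x v * Complex (ln r) pi)) \<le> r powr (real (K + 2) - 1 / 2) * exp (pi * \<bar>v\<bar>)" .
    have "norm (MB_integrand (K + 2) u r v) \<le> (C * (1 + \<bar>v\<bar>) ^ K * exp (- (pi / 2) * \<bar>v\<bar>))
       * (sqrt (2 * pi) * 3 ^ (K + 2) / (1 + \<bar>v\<bar>) ^ (K + 2) * exp (- (pi / 2) * \<bar>v\<bar>)) * (r powr (real (K + 2) - 1 / 2) * exp (pi * \<bar>v\<bar>))"
      unfolding MB_integrand_def norm_mult x_def[symmetric]
    proof (intro mult_mono e)
      show "norm (Gamma (u - Complex x v)) \<le> C * (1 + \<bar>v\<bar>) ^ K * exp (- (pi / 2) * \<bar>v\<bar>)"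
        using u by (intro C(2)) (auto simp: x_def)
      show "norm (Gamma (Complex x v)) \<le> sqrt (2 * pi) * 3 ^ (K + 2) / (1 + \<bar>v\<bar>) ^ (K + 2) * exp (- (pi / 2) * \<bar>v\<bar>)"
        unfolding x_def by (rule norm_Gamma_left)
    qed (use C(1) in auto)
    also have "\<dots> = (C * (sqrt (2 * pi) * 3 ^ (K + 2))) * r powr (real (K + 2) - 1 / 2) * 
        ((1 + \<bar>v\<bar>) ^ K / (1 + \<bar>v\<bar>) ^ (K + 2)) * (exp (- (pi / 2) * \<bar>v\<bar>) * exp (- (pi / 2) * \<bar>v\<bar>) * exp (pi * \<bar>v\<bar>))"
      by (simp only: times_divide_eq_left times_divide_eq_right ac_simps)
    also have "exp (- (pi / 2) * \<bar>v\<bar>) * exp (- (pi / 2) * \<bar>v\<bar>) * exp (pi * \<bar>v\<bar>) = 1"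
      unfolding exp_add[symmetric] by simp
    also have "(1 + \<bar>v\<bar>) ^ K / (1 + \<bar>v\<bar>) ^ (K + 2) = 1 / (1 + \<bar>v\<bar>) ^ 2"
      by (simp add: power_add power2_eq_square)
    also have "(C * (sqrt (2 * pi) * 3 ^ (K + 2))) * r powr (real (K + 2) - 1 / 2) * (1 / (1 + \<bar>v\<bar>)\<^sup>2) * 1
       \<le> (C * (sqrt (2 * pi) * 3 ^ (K + 2))) * r powr (real (K + 2) - 1 / 2) * (1 / (1 + v\<^sup>2)) * 1"
      using C(1) by (intro mult_right_mono mult_left_mono divide_left_mono) 
        (auto simp: power2_sum intro!: add_pos_nonneg mult_pos_pos)
    finally show ?thesis by simp
  qed
  then show ?thesis
    using that[of "C * (sqrt (2 * pi) * 3 ^ (K + 2))"] C(1) unfolding x_def by (simp add: add_ac add_diff_eq)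
qed

lemma continuous_on_MB_integrand:
  assumes "Re u > 1 / 2 - real K"
  shows "continuous_on UNIV (MB_integrand K u r)"
  unfolding MB_integrand_def[abs_def]
  by (intro continuous_intros continuous_on_Gamma_compose half_int_not_nonpos_Int Re_pos_not_nonpos_Int)
     (use assms in auto)

lemma integrable_MB_integrand:
  assumes "K \<ge> 2" "Re u > 1 / 2 - real K" "Re u \<le> - 1" "r > 0"
  shows "integrable lborel (MB_integrand K u r)"
proof -
  obtain K' where K: "K = K' + 2" using assms(1) by (metis add.commute le_Suc_ex)
  define x1 where "x1 = Re u - (1 / 2 - real K)"
  have x1: "x1 > 0" using assms by (simp add: x1_def)
  obtain C where C: "\<And>u' r v. x1 + 1 / 2 - real K \<le> Re u' \<Longrightarrow> Re u' \<le> - 1 \<Longrightarrow> \<bar>Im u'\<bar> \<le> \<bar>Im u\<bar> \<Longrightarrow> r > 0 \<Longrightarrow>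
       norm (MB_integrand K u' r v) \<le> C * r powr (real K - 1 / 2) / (1 + v\<^sup>2)"
    using norm_MB_integrand[OF x1 abs_ge_zero[of "Im u"], of K'] unfolding K by metis
  have "norm (MB_integrand K u r v) \<le> C * r powr (real K - 1 / 2) / (1 + v\<^sup>2)" for v
    using assms by (intro C) (auto simp: x1_def)
  then show ?thesis
    by (intro integrable_quadratic_decay continuous_on_MB_integrand assms)
qed

text \<open>The constant in front of \<open>r powr (K - 1 / 2)\<close> is independent of
  \<open>r\<close>: this power is what later makes the sum over \<open>n\<close> converge.\<close>

lemma MB_holomorphic_bounded:
  assumes "K \<ge> 2" "x1 > 0" "B \<ge> 0"
  defines "U \<equiv> {u. x1 + 1 / 2 - real K < Re u \<and> Re u < - 1 \<and> \<bar>Im u\<bar> < B}"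
  shows "r > 0 \<Longrightarrow> (\<lambda>u. MB K u r) holomorphic_on U"
    and "\<exists>C>0. \<forall>u\<in>U. \<forall>r>0. norm (MB K u r) \<le> C * r powr (real K - 1 / 2)"
proof -
  obtain K' where K: "K = K' + 2" using assms(1) by (metis add.commute le_Suc_ex)
  obtain C where C: "C > 0"
    "\<And>u r v. x1 + 1 / 2 - real K \<le> Re u \<Longrightarrow> Re u \<le> - 1 \<Longrightarrow> \<bar>Im u\<bar> \<le> B \<Longrightarrow> r > 0 \<Longrightarrow>
       norm (MB_integrand K u r v) \<le> C * r powr (real K - 1 / 2) / (1 + v\<^sup>2)"
    using norm_MB_integrand[OF assms(2,3), of K'] unfolding K by metis
  have "U = {u. x1 + 1 / 2 - real K < Re u} \<inter> {u. Re u < -1} \<inter> ({u. - B < Im u} \<inter> {u. Im u < B})"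
    by (auto simp: U_def)
  then have U: "open U"
    by (simp add: open_Int open_halfspace_Re_gt open_halfspace_Re_lt open_halfspace_Im_gt open_halfspace_Im_lt)
  have int: "integrable lborel (\<lambda>v. C * r powr (real K - 1 / 2) * (1 / (1 + v\<^sup>2)))" for r
    by (intro integrable_mult_right integrable_inverse_quadratic)
  show "(\<lambda>u. MB K u r) holomorphic_on U" if r: "r > 0"
    unfolding MB_def
  proof (intro holomorphic_intros holomorphic_integral_parameter[OF U _ _ int[of r]])
    show "(\<lambda>s. MB_integrand K s r v) holomorphic_on U" for v
      unfolding MB_integrand_def using assms(2)
      by (intro holomorphic_intros) (auto simp: U_def intro!: Re_pos_not_nonpos_Int)
    show "MB_integrand K s r \<in> borel_measurable lborel" if "s \<in> U" for s
      using continuous_on_MB_integrand[of K s r] that assms(2) by (simp add: U_def borel_measurable_continuous_onI)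
    show "norm (MB_integrand K s r v) \<le> C * r powr (real K - 1 / 2) * (1 / (1 + v\<^sup>2))" if "s \<in> U" for s v
      using C(2)[of s r v] that r by (simp add: U_def)
  qed auto
  define I where "I = (LINT v|lborel. 1 / (1 + v\<^sup>2 :: real))"
  have I: "I \<ge> 0" unfolding I_def by (intro Bochner_Integration.integral_nonneg) auto
  have "norm (MB K u r) \<le> (C * I + 1) * r powr (real K - 1 / 2)" if "u \<in> U" "r > 0" for u r
  proof -
    have "norm (LINT v|lborel. MB_integrand K u r v) \<le> (LINT v|lborel. C * r powr (real K - 1 / 2) * (1 / (1 + v\<^sup>2)))"
    proof (rule Bochner_Integration.integral_norm_bound_integral)
      show "integrable lborel (MB_integrand K u r)"
        using that assms by (intro integrable_MB_integrand) (auto simp: U_def)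
      show "norm (MB_integrand K u r v) \<le> C * r powr (real K - 1 / 2) * (1 / (1 + v\<^sup>2))" for v
        using C(2)[of u r v] that by (simp add: U_def)
    qed (rule int)
    also have "\<dots> = C * r powr (real K - 1 / 2) * I"
      unfolding I_def by (rule integral_mult_right_zero)
    finally have le: "norm (LINT v|lborel. MB_integrand K u r v) \<le> C * r powr (real K - 1 / 2) * I" .
    have "norm (MB K u r) = norm (LINT v|lborel. MB_integrand K u r v) / (2 * pi)"
      by (simp add: MB_def norm_divide norm_mult)
    also have "\<dots> \<le> norm (LINT v|lborel. MB_integrand K u r v) / 1"
      using pi_gt3 by (intro divide_left_mono) auto
    also have "\<dots> \<le> C * r powr (real K - 1 / 2) * I" using le by simp
    also have "\<dots> \<le> (C * I + 1) * r powr (real K - 1 / 2)" by (simp add: algebra_simps)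
    finally show ?thesis .
  qed
  then show "\<exists>C>0. \<forall>u\<in>U. \<forall>r>0. norm (MB K u r) \<le> C * r powr (real K - 1 / 2)"
    using C(1) I by (intro exI[of _ "C * I + 1"]) (auto intro: add_nonneg_pos)
qed

text \<open>Shifting the line of integration across the single pole at \<open>1 - K\<close> and using
  \<open>\<Gamma>(u + 1 - w) = (u - w) \<Gamma>(u - w)\<close> gives a recurrence in \<open>u\<close>. For \<open>r = 1\<close> it evaluates the integral,
  for \<open>r \<noteq> 1\<close> it continues the integral to the right, so that only \<open>r = 1\<close> produces a pole.\<close>

lemma MB_recurrence:
  assumes K: "K \<ge> 2" and u: "1 / 2 - real K < Re u" "Re u \<le> - 2" and r: "r > 0"
  shows "(1 - of_real r) * MB K (u + 1) r = u * MB K u r + of_real (r ^ K) * Gamma (u + of_nat K) / fact (K - 1)"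
proof -
  obtain k where k: "K = Suc k" using K by (cases K) auto
  define l where "l = Complex (ln r) pi"
  define x where "x = 1 / 2 - real K"
  define \<phi> where "\<phi> w = Gamma (u + 1 - w) * exp (- w * l)" for w
  define I0 where "I0 v = MB_integrand K u r v" for v
  define I1 where "I1 v = MB_integrand K (u + 1) r v" for v
  have l: "l = of_real (ln r) + of_real pi * \<i>" by (simp add: l_def complex_eq_iff)
  have exp_l: "exp l = - of_real r"
    using r unfolding l exp_add by (simp add: exp_of_real)
  then have el: "exp (- l) = - of_real (1 / r)"
    by (simp add: exp_minus inverse_eq_divide)
  have int0: "integrable lborel I0" and int1: "integrable lborel I1"
    unfolding I0_def[abs_def] I1_def[abs_def] using K u r by (auto intro!: integrable_MB_integrand)
  have I1: "Gamma (Complex x v) * \<phi> (Complex x v) = I1 v" for v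
    by (simp add: \<phi>_def I1_def MB_integrand_def x_def l_def mult_ac)
  \<comment> \<open>On the right-hand line one writes \<open>w = u - (u - w)\<close>: both parts are
    Mellin--Barnes integrands on the left-hand line, one for \<open>u\<close> and one for
    \<open>u + 1\<close>, and \<open>exp (- l) = - 1 / r\<close> supplies the factor.\<close>
  have right: "Gamma (Complex (x + 1) v) * \<phi> (Complex (x + 1) v) = - of_real (1 / r) * (u * I0 v - I1 v)" for v
  proof -
    define w where "w = Complex x v"
    have w1: "Complex (x + 1) v = w + 1" by (simp add: w_def complex_eq_iff)
    have "w \<notin> \<int>\<^sub>\<le>\<^sub>0" unfolding w_def x_def by (rule half_int_not_nonpos_Int)
    then have G1: "Gamma (w + 1) = w * Gamma w" by (rule Gamma_plus1)
    have "u - w \<notin> \<int>\<^sub>\<le>\<^sub>0" using u by (intro Re_pos_not_nonpos_Int) (simp add: w_def x_def)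
    then have G2: "Gamma (u - w + 1) = (u - w) * Gamma (u - w)" by (rule Gamma_plus1)
    have "Gamma (w + 1) * \<phi> (w + 1) = w * Gamma w * Gamma (u - w) * exp (- w * l) * exp (- l)"
    proof -
      have "exp (- (w + 1) * l) = exp (- w * l) * exp (- l)"
        unfolding exp_add[symmetric] by (simp add: algebra_simps)
      moreover have "u + 1 - (w + 1) = u - w" by simp
      ultimately show ?thesis unfolding \<phi>_def G1 by (simp only: mult.assoc)
    qed
    also have "w * Gamma w * Gamma (u - w) * exp (- w * l) = u * I0 v - I1 v"
    proof -
      have "I1 v = Gamma (u - w + 1) * Gamma w * exp (- w * l)"
        by (simp add: I1_def MB_integrand_def w_def x_def l_def algebra_simps)
      moreover have "I0 v = Gamma (u - w) * Gamma w * exp (- w * l)"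
        by (simp add: I0_def MB_integrand_def w_def x_def l_def)
      ultimately show ?thesis unfolding G2 by (simp add: algebra_simps)
    qed
    finally show ?thesis unfolding w1 el by simp
  qed
  have xk: "1 / 2 - real (Suc k) = x" "1 / 2 - real k = x + 1" by (simp_all add: x_def k)
  define x1 where "x1 = Re u - x"
  have x1: "x1 > 0" using u by (simp add: x1_def x_def)
  obtain C where C: "C > 0"
    "\<And>t y v. x1 \<le> Re t - y \<Longrightarrow> Re t - y \<le> real K + 1 / 2 \<Longrightarrow> \<bar>Im t\<bar> \<le> \<bar>Im u\<bar> \<Longrightarrow>
      norm (Gamma (t - Complex y v)) \<le> C * (1 + \<bar>v\<bar>) ^ K * exp (- (pi / 2) * \<bar>v\<bar>)"
    using norm_Gamma_shifted[OF x1, of "\<bar>Im u\<bar>" K] by auto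
  obtain C' where C': "C' > 0" "\<And>v::real. (1 + \<bar>v\<bar>) ^ K * exp (- (pi / 2) * \<bar>v\<bar>) \<le> C' / (1 + v\<^sup>2)"
    using power_exp_decay[of "pi / 2" K] by auto
  have growth: "norm (\<phi> w) \<le> (C * C' * exp ((real K + 1) * \<bar>ln r\<bar>)) * exp (pi * \<bar>Im w\<bar> ^ 1)"
    if w: "x \<le> Re w" "Re w \<le> x + 1" for w
  proof -
    have "norm (Gamma (u + 1 - Complex (Re w) (Im w))) \<le> C * (1 + \<bar>Im w\<bar>) ^ K * exp (- (pi / 2) * \<bar>Im w\<bar>)"
      using u w by (intro C(2)) (auto simp: x1_def x_def)
    also have "\<dots> \<le> C * (C' / (1 + (Im w)\<^sup>2))"
      unfolding mult.assoc using C(1) C'(2) by (intro mult_left_mono) auto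
    also have "\<dots> \<le> C * (C' / 1)"
      using C(1) C'(1) by (intro mult_left_mono divide_left_mono) (auto simp: add_pos_nonneg)
    finally have g: "norm (Gamma (u + 1 - w)) \<le> C * C'" by simp
    have "norm (exp (- w * l)) \<le> exp ((real K + 1) * \<bar>ln r\<bar>) * exp (pi * \<bar>Im w\<bar> ^ 1)"
      using norm_exp_strip[of w "real K + 1" l] w K by (simp add: l_def x_def)
    then have "norm (\<phi> w) \<le> (C * C') * (exp ((real K + 1) * \<bar>ln r\<bar>) * exp (pi * \<bar>Im w\<bar> ^ 1))"
      unfolding \<phi>_def norm_mult using g C(1) C'(1) by (intro mult_mono) (auto simp del: norm_exp_eq_Re)
    then show ?thesis by (simp only: mult.assoc)
  qed
  have "(LINT v|lborel. Gamma (Complex (1 / 2 - real k) v) * \<phi> (Complex (1 / 2 - real k) v)) -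
    (LINT v|lborel. Gamma (Complex (1 / 2 - real (Suc k)) v) * \<phi> (Complex (1 / 2 - real (Suc k)) v))
    = 2 * of_real pi * ((-1) ^ k / fact k) * \<phi> (- of_nat k)"
  proof (rule Gamma_shift_one_pole[where S = "{w. Re w < Re u + 1}"])
    show "open {w. Re w < Re u + 1}" by (rule open_halfspace_Re_lt)
    show "{w. 1 / 2 - real (Suc k) \<le> Re w \<and> Re w \<le> 1 / 2 - real k} \<subseteq> {w. Re w < Re u + 1}"
      using u by (auto simp: k)
    show "\<phi> holomorphic_on {w. Re w < Re u + 1}"
      unfolding \<phi>_def by (intro holomorphic_intros) (auto intro!: Re_pos_not_nonpos_Int)
    show "norm (\<phi> w) \<le> (C * C' * exp ((real K + 1) * \<bar>ln r\<bar>)) * exp (pi * \<bar>Im w\<bar> ^ 1)"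
      if "1 / 2 - real (Suc k) \<le> Re w" "Re w \<le> 1 / 2 - real k" for w
      using that unfolding xk by (rule growth)
  qed (unfold xk I1 right, use int0 int1 in auto)
  then have eq: "- of_real (1 / r) * (u * (LINT v|lborel. I0 v) - (LINT v|lborel. I1 v)) - (LINT v|lborel. I1 v)
     = 2 * of_real pi * ((-1) ^ k / fact k) * \<phi> (- of_nat k)"
    unfolding xk I1 right using int0 int1 by simp
  have "\<phi> (- of_nat k) = Gamma (u + of_nat K) * ((-1) ^ k * of_real r ^ k)"
    by (simp add: \<phi>_def k exp_of_nat_mult exp_l add_ac power_minus[of "of_real r"])
  moreover have "((-1) ^ k :: complex) * (-1) ^ k = 1"
    by (simp flip: power_mult_distrib)
  ultimately have phi: "2 * of_real pi * ((-1) ^ k / fact k) * \<phi> (- of_nat k) = 2 * of_real pi * (Gamma (u + of_nat K) * of_real r ^ k / fact k)"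
    by (simp add: mult_ac)
  have "- of_real r * (- of_real (1 / r) * (u * (LINT v|lborel. I0 v) - (LINT v|lborel. I1 v)) - (LINT v|lborel. I1 v))
    = - of_real r * (2 * of_real pi * (Gamma (u + of_nat K) * of_real r ^ k / fact k))"
    unfolding eq phi ..
  then have "(1 - of_real r) * (LINT v|lborel. I1 v) = u * (LINT v|lborel. I0 v) 
     + 2 * of_real pi * (of_real (r ^ K) * Gamma (u + of_nat K) / fact (K - 1))"
    using r by (simp add: k algebra_simps)
  then have "(1 - of_real r) * ((LINT v|lborel. I1 v) / (2 * of_real pi)) = u * ((LINT v|lborel. I0 v) / (2 * of_real pi))
     + of_real (r ^ K) * Gamma (u + of_nat K) / fact (K - 1)"
  proof -
    have alg: "q * (X1 / t) = u * (X0 / t) + Z" if "q * X1 = u * X0 + t * Z" "t \<noteq> 0" for q X0 X1 Z t :: complex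
      using that by (simp add: add_divide_distrib)
    assume "(1 - of_real r) * (LINT v|lborel. I1 v) = u * (LINT v|lborel. I0 v) 
     + 2 * of_real pi * (of_real (r ^ K) * Gamma (u + of_nat K) / fact (K - 1))"
    then show ?thesis by (rule alg) simp
  qed
  then show ?thesis
    by (simp only: MB_def I0_def I1_def)
qed

lemma MB_at_1:
  assumes "K \<ge> 2" "1 / 2 - real K < Re u" "Re u \<le> - 2"
  shows "MB K u 1 = - Gamma (u + of_nat K) / (u * fact (K - 1))"
proof -
  have "u \<noteq> 0" using assms by auto
  then show ?thesis
    using MB_recurrence[OF assms, of 1] by (simp add: field_simps eq_neg_iff_add_eq_0)
qed

text \<open>The recurrence solved for the value at the larger argument: each application moves the
  strip where the integral makes sense one unit to the right. For \<open>r = 1\<close> a step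
  divides by zero and gives 0; that case is treated apart.\<close>

fun MB_cont :: "nat \<Rightarrow> real \<Rightarrow> nat \<Rightarrow> complex \<Rightarrow> complex" where
  "MB_cont K r 0 u = MB K u r"
| "MB_cont K r (Suc P) u =
     ((u - 1) * MB_cont K r P (u - 1) + of_real (r ^ K) * Gamma (u - 1 + of_nat K) / fact (K - 1)) / (1 - of_real r)"

lemma MB_cont_eq_MB:
  assumes "K \<ge> 2" "r > 0" "r \<noteq> 1"
  shows "1 / 2 - real K + real P < Re u \<Longrightarrow> Re u \<le> - 1 \<Longrightarrow> MB_cont K r P u = MB K u r"
proof (induction P arbitrary: u)
  case (Suc P)
  have "MB_cont K r P (u - 1) = MB K (u - 1) r"
    using Suc.prems by (intro Suc.IH) auto
  moreover have "(1 - of_real r) * MB K (u - 1 + 1) r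
      = (u - 1) * MB K (u - 1) r + of_real (r ^ K) * Gamma (u - 1 + of_nat K) / fact (K - 1)"
    using Suc.prems by (intro MB_recurrence assms) auto
  moreover have "1 - complex_of_real r \<noteq> 0" using assms(3) by (metis eq_iff_diff_eq_0 of_real_eq_1_iff)
  ultimately show ?case
    by (simp add: nonzero_divide_eq_eq mult.commute)
qed simp

lemma MB_cont_holomorphic:
  assumes "K \<ge> 2" "x1 > 0" "B \<ge> 0" "r > 0"
  shows "MB_cont K r P holomorphic_on {u. x1 + 1 / 2 - real K + real P < Re u \<and> Re u < real P - 1 \<and> \<bar>Im u\<bar> < B}"
proof (induction P)
  case 0
  show ?case using MB_holomorphic_bounded(1)[OF assms] by simp
next
  case (Suc P)
  let ?U = "\<lambda>P. {u. x1 + 1 / 2 - real K + real P < Re u \<and> Re u < real P - 1 \<and> \<bar>Im u\<bar> < B}"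
  have "(\<lambda>u. MB_cont K r P (u - 1)) holomorphic_on ?U (Suc P)"
  proof -
    have "(MB_cont K r P \<circ> (\<lambda>u. u - 1)) holomorphic_on ?U (Suc P)"
      by (rule holomorphic_on_compose_gen[OF _ Suc.IH]) (auto intro!: holomorphic_intros)
    then show ?thesis by (simp only: o_def)
  qed
  \<comment> \<open>Read as multiplication by the constant \<open>inverse (1 - of_real r)\<close>,
    the division is holomorphic for every \<open>r\<close>, including \<open>r = 1\<close>.\<close>
  then show ?case
    unfolding MB_cont.simps divide_inverse[of _ "1 - of_real r"] using assms(2)
    by (intro holomorphic_intros) (auto intro!: Re_pos_not_nonpos_Int)
qed

text \<open>Uniformity in \<open>r\<close> is the point. Each step multiplies by a bounded
  \<open>u - 1\<close>, adds a term with \<open>r ^ K = r powr (1 / 2) * r powr (K - 1 / 2)\<close>,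
  and divides by at least \<open>\<delta>\<close>; the decay \<open>r powr (K - 1 / 2)\<close>
  survives all steps.\<close>

lemma MB_cont_bounded:
  assumes "K \<ge> 2" "x1 > 0" "B \<ge> 0" "\<delta> > 0"
  shows "\<exists>C>0. \<forall>u r. x1 + 1 / 2 - real K + real P < Re u \<longrightarrow> Re u < real P - 1 \<longrightarrow> \<bar>Im u\<bar> < B \<longrightarrow>
     0 < r \<longrightarrow> r \<le> R \<longrightarrow> \<delta> \<le> \<bar>1 - r\<bar> \<longrightarrow> norm (MB_cont K r P u) \<le> C * r powr (real K - 1 / 2)"
proof (induction P)
  case 0
  obtain C where "C > 0" "\<forall>u\<in>{u. x1 + 1 / 2 - real K < Re u \<and> Re u < - 1 \<and> \<bar>Im u\<bar> < B}. \<forall>r>0. norm (MB K u r) \<le> C * r powr (real K - 1 / 2)"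
    using MB_holomorphic_bounded(2)[OF assms(1-3)] by blast
  then show ?case by (intro exI[of _ C]) auto
next
  case (Suc P)
  then obtain C where C: "C > 0" "\<And>u r. x1 + 1 / 2 - real K + real P < Re u \<Longrightarrow> Re u < real P - 1 \<Longrightarrow> \<bar>Im u\<bar> < B \<Longrightarrow>
     0 < r \<Longrightarrow> r \<le> R \<Longrightarrow> \<delta> \<le> \<bar>1 - r\<bar> \<Longrightarrow> norm (MB_cont K r P u) \<le> C * r powr (real K - 1 / 2)"
    by blast
  obtain C1 where C1: "C1 > 0" "\<And>t y v. x1 \<le> Re t - y \<Longrightarrow> Re t - y \<le> real (K + P) + 1 / 2 \<Longrightarrow> \<bar>Im t\<bar> \<le> B \<Longrightarrow>
      norm (Gamma (t - Complex y v)) \<le> C1 * (1 + \<bar>v\<bar>) ^ (K + P) * exp (- (pi / 2) * \<bar>v\<bar>)"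
    using norm_Gamma_shifted[OF assms(2,3), of "K + P"] by blast
  define M where "M = real K + real P + B + 2"
  have M: "M > 0" using assms(3) by (simp add: M_def)
  define C2 where "C2 = (M * C + \<bar>R\<bar> powr (1 / 2) * C1) / \<delta>"
  have "norm (MB_cont K r (Suc P) u) \<le> C2 * r powr (real K - 1 / 2)"
    if u: "x1 + 1 / 2 - real K + real (Suc P) < Re u" "Re u < real (Suc P) - 1" "\<bar>Im u\<bar> < B"
      and r: "0 < r" "r \<le> R" "\<delta> \<le> \<bar>1 - r\<bar>" for u r
  proof -
    have "norm (u - 1) \<le> M"
    proof -
      have "norm (u - 1) \<le> \<bar>Re (u - 1)\<bar> + \<bar>Im (u - 1)\<bar>" by (rule cmod_le)
      then show ?thesis using u assms(1,2) by (simp add: M_def abs_if split: if_splits)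
    qed
    then have 1: "norm ((u - 1) * MB_cont K r P (u - 1)) \<le> M * (C * r powr (real K - 1 / 2))"
      unfolding norm_mult using u r M by (intro mult_mono C(2)) auto
    have "norm (Gamma (u - 1 - Complex (- real K) 0)) \<le> C1 * (1 + \<bar>0\<bar>) ^ (K + P) * exp (- (pi / 2) * \<bar>0\<bar>)"
      using u by (intro C1(2)) auto
    moreover have "u - 1 - Complex (- real K) 0 = u - 1 + of_nat K" by (simp add: complex_eq_iff)
    ultimately have G: "norm (Gamma (u - 1 + of_nat K)) \<le> C1" by simp
    have "r ^ K = r powr (1 / 2) * r powr (real K - 1 / 2)"
      using r by (simp add: powr_realpow[symmetric] powr_add[symmetric])
    also have "\<dots> \<le> \<bar>R\<bar> powr (1 / 2) * r powr (real K - 1 / 2)"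
      using r by (intro mult_right_mono powr_mono2) auto
    finally have rK: "r ^ K \<le> \<bar>R\<bar> powr (1 / 2) * r powr (real K - 1 / 2)" .
    have "norm (of_real (r ^ K) * Gamma (u - 1 + of_nat K) / fact (K - 1)) 
        \<le> \<bar>r ^ K\<bar> * norm (Gamma (u - 1 + of_nat K)) / 1"
      unfolding norm_divide norm_mult norm_of_real by (intro frac_le) (auto simp: fact_ge_1)
    also have "\<dots> \<le> (\<bar>R\<bar> powr (1 / 2) * r powr (real K - 1 / 2)) * C1"
      using r rK G by (auto intro!: mult_mono)
    finally have 2: "norm (of_real (r ^ K) * Gamma (u - 1 + of_nat K) / fact (K - 1)) \<le> (\<bar>R\<bar> powr (1 / 2) * r powr (real K - 1 / 2)) * C1" .
    have d: "norm (1 - complex_of_real r) = \<bar>1 - r\<bar>"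
      by (metis norm_of_real of_real_1 of_real_diff)
    have "norm (MB_cont K r (Suc P) u) \<le> (M * (C * r powr (real K - 1 / 2)) + (\<bar>R\<bar> powr (1 / 2) * r powr (real K - 1 / 2)) * C1) / \<delta>"
      unfolding MB_cont.simps norm_divide[of _ "1 - of_real r"] d
    proof (rule frac_le)
      show "0 \<le> M * (C * r powr (real K - 1 / 2)) + (\<bar>R\<bar> powr (1 / 2) * r powr (real K - 1 / 2)) * C1"
        using M C(1) C1(1) by (intro add_nonneg_nonneg mult_nonneg_nonneg) auto
    qed (use r assms(4) order_trans[OF norm_triangle_ineq add_mono[OF 1 2]] in auto)
    then show ?thesis by (simp add: C2_def algebra_simps add_divide_distrib)
  qed
  moreover have "C2 > 0"
    unfolding C2_def using assms(4) M C(1) C1(1) by (auto intro!: divide_pos_pos add_pos_nonneg)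
  ultimately show ?case by blast
qed

subsection \<open>Functions in the extended Selberg class\<close>

lemma powr_nat_neg_eq_exp:
  fixes s :: complex
  shows "of_nat (Suc n) powr (- s) = exp (- s * of_real (ln (real (Suc n))))"
  by (simp add: powr_def Ln_of_nat del: of_nat_Suc)

text \<open>Passes from the unordered sum over \<open>{1..}\<close> to an ordinary series with index
  shifted by one, and from \<open>powr\<close> to exponentials, the form in which all later products
  are combined.\<close>

lemma dirichlet_series_sums:
  assumes "dirichlet_abs_conv f s"
  shows "summable (\<lambda>n. norm (f (Suc n)) * exp (- Re s * ln (real (Suc n))))"
    and "(\<lambda>n. f (Suc n) * exp (- s * of_real (ln (real (Suc n))))) sums dirichlet_sum f s"
proof -
  let ?g = "\<lambda>n. f n * of_nat n powr (- s)"
  have bij: "bij_betw Suc UNIV {1..}"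
    by (auto simp: bij_betw_def image_iff) (metis Suc_le_D)
  have g_eq: "?g (Suc n) = f (Suc n) * exp (- s * of_real (ln (real (Suc n))))" for n
    by (simp only: powr_nat_neg_eq_exp)
  have "(\<lambda>n. norm (?g n)) summable_on {1..}"
    using assms by (simp add: dirichlet_abs_conv_def)
  then have on: "(\<lambda>n. norm (?g (Suc n))) summable_on UNIV"
    using summable_on_reindex_bij_betw[OF bij, of "\<lambda>n. norm (?g n)"] by simp
  then have "summable (\<lambda>n. norm (?g (Suc n)))"
    by (rule summable_on_imp_summable)
  then show "summable (\<lambda>n. norm (f (Suc n)) * exp (- Re s * ln (real (Suc n))))"
    unfolding g_eq by (simp add: norm_mult norm_exp_eq_Re del: of_nat_Suc)
  have "dirichlet_sum f s = (\<Sum>\<^sub>\<infinity>n. ?g (Suc n))"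
    unfolding dirichlet_sum_def using infsum_reindex_bij_betw[OF bij, of ?g] by simp
  moreover have "((\<lambda>n. ?g (Suc n)) has_sum (\<Sum>\<^sub>\<infinity>n. ?g (Suc n))) UNIV"
    by (intro has_sum_infsum abs_summable_summable[OF on])
  ultimately show "(\<lambda>n. f (Suc n) * exp (- s * of_real (ln (real (Suc n))))) sums dirichlet_sum f s"
    unfolding g_eq[symmetric] by (metis has_sum_imp_sums)
qed

locale selberg_class =
  fixes a :: "nat \<Rightarrow> complex" and D :: fe_data and F :: "complex \<Rightarrow> complex"
  assumes selberg: "extended_selberg a D F" and degree_ge_1: "sel_degree D \<ge> 1"
begin

abbreviation d :: real where "d \<equiv> sel_degree D"

lemma d_pos: "d > 0" using degree_ge_1 by simp

abbreviation A :: "nat \<Rightarrow> complex" where "A n \<equiv> a (Suc n)"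

definition ln_Suc :: "nat \<Rightarrow> real" where "ln_Suc n = ln (real (Suc n))"

lemma ln_Suc_nonneg: "ln_Suc n \<ge> 0" by (simp add: ln_Suc_def)

lemma summable_coeffs: 
  assumes "\<sigma> > 1"
  shows "summable (\<lambda>n. norm (A n) * exp (- \<sigma> * ln_Suc n))"
proof -
  have "dirichlet_abs_conv a (of_real \<sigma>)"
    using selberg assms by (simp add: extended_selberg_def)
  from dirichlet_series_sums(1)[OF this] show ?thesis by (simp add: ln_Suc_def)
qed

lemma F_sums:
  assumes "Re s > 1"
  shows "(\<lambda>n. A n * exp (- s * of_real (ln_Suc n))) sums F s"
proof -
  have "dirichlet_abs_conv a s" "F s = dirichlet_sum a s"
    using selberg assms by (auto simp: extended_selberg_def)
  from dirichlet_series_sums(2)[OF this(1)] this(2) show ?thesis by (simp add: ln_Suc_def)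
qed

lemma norm_F_le:
  assumes "\<sigma> > 1"
  shows "Re s \<ge> \<sigma> \<Longrightarrow> norm (F s) \<le> (\<Sum>n. norm (A n) * exp (- \<sigma> * ln_Suc n))"
proof -
  assume s: "Re s \<ge> \<sigma>"
  have le: "norm (A n * exp (- s * of_real (ln_Suc n))) \<le> norm (A n) * exp (- \<sigma> * ln_Suc n)" for n
    using s ln_Suc_nonneg[of n] by (simp add: norm_mult norm_exp_eq_Re mult_left_mono mult_right_mono)
  have "F s = (\<Sum>n. A n * exp (- s * of_real (ln_Suc n)))"
    using F_sums[of s] s assms by (simp add: sums_iff)
  also have "norm \<dots> \<le> (\<Sum>n. norm (A n) * exp (- \<sigma> * ln_Suc n))"
    by (intro norm_suminf_le le summable_coeffs assms)
  finally show ?thesis .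
qed

lemma F_holomorphic: "F holomorphic_on - {1}"
proof -
  obtain m H where H: "entire_finite_order H" "\<And>s. s \<noteq> 1 \<Longrightarrow> (s - 1) ^ m * F s = H s"
    using selberg by (auto simp: extended_selberg_def)
  have "(\<lambda>s. H s / (s - 1) ^ m) holomorphic_on - {1}"
    using H(1) by (intro holomorphic_intros) (auto simp: entire_finite_order_def intro: holomorphic_on_subset)
  then show ?thesis
    by (rule holomorphic_transform) (use H(2) in \<open>simp flip: H(2)\<close>)
qed

text \<open>The conditions \<open>norm (s - 1) \<ge> 1\<close> and \<open>norm s \<ge> 1\<close>
  allow dropping the polar factor \<open>(s - 1) ^ m\<close> and replacing the real order
  \<open>\<rho>\<close> by a natural exponent.\<close>

lemma F_growth:
  obtains C N where "C > 0" "\<And>s. norm (s - 1) \<ge> 1 \<Longrightarrow> norm s \<ge> 1 \<Longrightarrow> norm (F s) \<le> C * exp (norm s ^ N)"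
proof -
  obtain m H where H: "entire_finite_order H" "\<And>s. s \<noteq> 1 \<Longrightarrow> (s - 1) ^ m * F s = H s"
    using selberg by (auto simp: extended_selberg_def)
  obtain C \<rho> where C: "\<And>s. norm (H s) \<le> C * exp (norm s powr \<rho>)"
    using H(1) by (auto simp: entire_finite_order_def)
  define N where "N = nat \<lceil>\<bar>\<rho>\<bar>\<rceil>"
  have N: "\<rho> \<le> real N" by (simp add: N_def) linarith
  have "norm (F s) \<le> (\<bar>C\<bar> + 1) * exp (norm s ^ N)" if s: "norm (s - 1) \<ge> 1" "norm s \<ge> 1" for s
  proof -
    have "norm (F s) \<le> norm (s - 1) ^ m * norm (F s)"
      using mult_right_mono[OF one_le_power[OF s(1), of m], of "norm (F s)"] by simp
    also have "\<dots> = norm (H s)"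
    proof -
      have "s \<noteq> 1" using s(1) by auto
      then show ?thesis by (metis H(2) norm_mult norm_power)
    qed
    also have "\<dots> \<le> C * exp (norm s powr \<rho>)" by (rule C)
    also have "\<dots> \<le> (\<bar>C\<bar> + 1) * exp (norm s powr real N)"
      using s N by (intro mult_mono) (auto intro: powr_mono)
    also have "norm s powr real N = norm s ^ N"
      using s by (intro powr_realpow) auto
    finally show ?thesis .
  qed
  then show ?thesis using that[of "\<bar>C\<bar> + 1" N] by simp
qed

definition Fbar :: "complex \<Rightarrow> complex" where "Fbar p = conj_fun F (1 - p)"

lemma Fbar_sums:
  assumes "Re p < 0"
  shows "(\<lambda>n. cnj (A n) * exp (- (1 - p) * of_real (ln_Suc n))) sums Fbar p"
proof -
  have "(\<lambda>n. cnj (A n * exp (- cnj (1 - p) * of_real (ln_Suc n)))) sums cnj (F (cnj (1 - p)))"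
    using assms by (intro sums_cnj[THEN iffD2] F_sums) simp
  then show ?thesis
    by (simp add: Fbar_def conj_fun_def exp_cnj)
qed

lemma norm_Fbar_le:
  assumes "Re p \<le> - 1"
  shows "norm (Fbar p) \<le> (\<Sum>n. norm (A n) * exp (- 2 * ln_Suc n))"
  using norm_F_le[of 2 "cnj (1 - p)"] assms by (simp add: Fbar_def conj_fun_def)

lemma continuous_on_F: "continuous_on (- {1}) F"
  by (intro holomorphic_on_imp_continuous_on F_holomorphic)

lemma Fbar_holomorphic: "Fbar holomorphic_on - {0}"
proof -
  have "x \<in> cnj ` (- {1})" if "x \<noteq> 1" for x
    using that by (intro image_eqI[of _ _ "cnj x"]) (auto simp: complex_eq_iff)
  then have "cnj ` (- {1}) = - {1}"
    by force
  then have hol: "(cnj \<circ> F \<circ> cnj) holomorphic_on - {1}"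
    by (intro holomorphic_on_compose_cnj_cnj) (simp_all add: F_holomorphic open_Compl)
  have "((cnj \<circ> F \<circ> cnj) \<circ> (\<lambda>p. 1 - p)) holomorphic_on - {0}"
    by (rule holomorphic_on_compose_gen[OF _ hol]) (auto intro!: holomorphic_intros)
  then show ?thesis
    by (simp add: Fbar_def[abs_def] conj_fun_def o_def)
qed

section \<open>The functional equation with a product of sines\<close>

definition zarg :: "nat \<Rightarrow> complex \<Rightarrow> complex" where
  "zarg j p = of_real (fe_lambda D j) * p + fe_mu D j"

definition sine_factor :: "complex \<Rightarrow> complex" where
  "sine_factor p = (\<Prod>j<num_gamma D. 2 * sin (of_real pi * zarg j p))"

text \<open>Since \<open>2 sin z = \<i> exp (- \<i> z) - \<i> exp (\<i> z)\<close>, this is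
  \<open>sine_factor\<close> with each sine replaced by the exponential that dominates as
  \<open>Im p\<close> tends to infinity. As an exponential of a linear function it only shifts the
  argument of the Mellin--Barnes kernel.\<close>

definition sine_main :: "complex \<Rightarrow> complex" where
  "sine_main p = (\<Prod>j<num_gamma D. \<i> * exp (- \<i> * of_real pi * zarg j p))"

lemma data_valid: "fe_Q D > 0" "norm (fe_omega D) = 1" "j < num_gamma D \<Longrightarrow> fe_lambda D j > 0" "j < num_gamma D \<Longrightarrow> Re (fe_mu D j) \<ge> 0"
  using selberg by (auto simp: extended_selberg_def valid_fe_data_def)

text \<open>The reflection formula turns each \<open>1 / Gamma (zarg j p)\<close> into
  \<open>Gamma (1 - zarg j p)\<close> times a sine. Nonreal \<open>zarg j p\<close> keep these Gamma
  factors away from their poles, where the functional equation is not asserted, and the sines away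
  from 0.\<close>

lemma F_eq_h_sine:
  assumes p: "Re p < 0" and im: "\<And>j. j < num_gamma D \<Longrightarrow> Im (zarg j p) \<noteq> 0"
  shows "F p = h_fun D p * sine_factor p * Fbar p"
proof -
  define Q where "Q = fe_Q D"
  define r where "r = num_gamma D"
  have Q: "Q > 0" using data_valid by (simp add: Q_def)
  have nonpos: "z \<notin> \<int>\<^sub>\<le>\<^sub>0" if "Im z \<noteq> 0" for z
    using that by (auto elim!: nonpos_Ints_cases)
  have reg1: "gamma_factor_regular D p"
    using im nonpos by (auto simp: gamma_factor_regular_def zarg_def)
  have pos: "Re (of_real (fe_lambda D j) * (1 - p) + cnj (fe_mu D j)) > 0" if "j < r" for j
    using p data_valid(3,4)[of j] that by (auto simp: r_def intro!: add_pos_nonneg mult_pos_pos)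
  have reg2: "gamma_factor_regular D (cnj (1 - p))"
    unfolding gamma_factor_regular_def
  proof (intro allI impI)
    fix j assume "j < num_gamma D"
    then have "Re (of_real (fe_lambda D j) * cnj (1 - p) + fe_mu D j) > 0"
      using pos[of j] by (simp add: r_def)
    then show "of_real (fe_lambda D j) * cnj (1 - p) + fe_mu D j \<notin> \<int>\<^sub>\<le>\<^sub>0"
      by (rule Re_pos_not_nonpos_Int)
  qed
  define G1 where "G1 = (\<Prod>j<r. Gamma (zarg j p))"
  define G2 where "G2 = (\<Prod>j<r. Gamma (of_real (fe_lambda D j) * (1 - p) + cnj (fe_mu D j)))"
  define G3 where "G3 = (\<Prod>j<r. Gamma (1 - zarg j p))"
  have fe: "F p * gamma_factor D p = fe_omega D * conj_fun (gamma_factor D) (1 - p) * Fbar p"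
  proof -
    have "functional_equation D F" using selberg by (simp add: extended_selberg_def)
    moreover have "p \<noteq> 0" "p \<noteq> 1" using p by auto
    ultimately show ?thesis
      using reg1 reg2 unfolding functional_equation_def Fbar_def by simp
  qed
  have g1: "gamma_factor D p = exp (p * of_real (ln Q)) * G1"
    using Q by (simp add: gamma_factor_def G1_def zarg_def r_def powr_def Q_def Ln_of_real)
  have g2: "conj_fun (gamma_factor D) (1 - p) = exp ((1 - p) * of_real (ln Q)) * G2"
    using Q by (simp add: conj_fun_def gamma_factor_def G2_def r_def powr_def Q_def Ln_of_real exp_cnj cnj_Gamma)
  have h: "h_fun D p = fe_omega D / of_real ((2 * pi) ^ r) * exp ((1 - 2 * p) * of_real (ln Q)) * (G2 * G3)"
    using Q by (simp add: h_fun_def G2_def G3_def zarg_def r_def powr_def Q_def Ln_of_real prod.distrib diff_diff_eq)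
  have reflection: "Gamma (zarg j p) * Gamma (1 - zarg j p) * (2 * sin (of_real pi * zarg j p)) = of_real (2 * pi)" if "j < r" for j
  proof -
    have "sin (of_real pi * zarg j p) \<noteq> 0"
    proof
      assume "sin (of_real pi * zarg j p) = 0"
      then obtain m :: int where "of_real pi * zarg j p = of_real (real_of_int m * pi)"
        by (auto simp: sin_eq_0)
      then have "Im (of_real pi * zarg j p) = 0" by (metis Im_complex_of_real)
      then show False using im[of j] that by (simp add: r_def)
    qed
    then show ?thesis
      by (simp add: Gamma_reflection_complex)
  qed
  have "G1 * G3 * sine_factor p = (\<Prod>j<r. Gamma (zarg j p) * Gamma (1 - zarg j p) * (2 * sin (of_real pi * zarg j p)))"
    by (simp add: G1_def G3_def sine_factor_def r_def prod.distrib)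
  also have "\<dots> = (\<Prod>j<r. of_real (2 * pi))"
    by (intro prod.cong) (auto simp: reflection)
  finally have G13: "G1 * G3 * sine_factor p = of_real ((2 * pi) ^ r)" by simp
  have "G1 \<noteq> 0"
    unfolding G1_def using im nonpos by (auto simp: Gamma_eq_zero_iff r_def)
  then have ne: "gamma_factor D p \<noteq> 0" by (simp add: g1)
  have "h_fun D p * sine_factor p * Fbar p * gamma_factor D p
     = fe_omega D * (exp ((1 - 2 * p) * of_real (ln Q)) * exp (p * of_real (ln Q))) * G2 * Fbar p * ((G1 * G3 * sine_factor p) / of_real ((2 * pi) ^ r))"
    unfolding h g1 by simp
  also have "\<dots> = fe_omega D * exp ((1 - p) * of_real (ln Q)) * G2 * Fbar p"
    unfolding G13 exp_add[symmetric] by (simp add: algebra_simps)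
  also have "\<dots> = F p * gamma_factor D p"
    unfolding fe g2 by simp
  finally show ?thesis using ne by simp
qed

end

lemma two_sin_eq: "2 * sin z = \<i> * exp (- \<i> * z) - \<i> * exp (\<i> * z)"
proof -
  have "2 * sin z = (exp (\<i> * z) - exp (- (\<i> * z))) / \<i>"
    by (simp add: sin_exp_eq)
  then show ?thesis
    by (simp add: divide_i algebra_simps)
qed

text \<open>Induction over the factors, the difference by telescoping:
  \<open>(e1 - e2) S - e1 E = (e1 - e2) (S - E) - e2 E\<close>. Upwards each neglected exponential
  is smaller than the main one by \<open>exp (- 2 pi lam j Im p)\<close>, up to a constant, hence
  the condition on \<open>\<delta>\<close>; downwards the factor
  \<open>exp (- \<delta> Im p)\<close> is a harmless loss.\<close>

lemma sine_product_bounds: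
  fixes lam :: "nat \<Rightarrow> real" and \<mu> :: "nat \<Rightarrow> complex"
  assumes "finite J" "\<And>j. j \<in> J \<Longrightarrow> lam j > 0 \<and> \<delta> \<le> 2 * pi * lam j" "\<delta> \<ge> 0"
  shows "\<exists>C>0. \<forall>p. 
      norm (\<Prod>j\<in>J. 2 * sin (of_real pi * (of_real (lam j) * p + \<mu> j))) \<le> C * exp (pi * sum lam J * \<bar>Im p\<bar>) \<and>
      norm (\<Prod>j\<in>J. \<i> * exp (- \<i> * of_real pi * (of_real (lam j) * p + \<mu> j))) \<le> C * exp (pi * sum lam J * Im p) \<and>
      norm ((\<Prod>j\<in>J. 2 * sin (of_real pi * (of_real (lam j) * p + \<mu> j))) - 
         (\<Prod>j\<in>J. \<i> * exp (- \<i> * of_real pi * (of_real (lam j) * p + \<mu> j)))) \<le> C * exp (pi * sum lam J * \<bar>Im p\<bar> - \<delta> * Im p)"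
  using assms(1,2)
proof (induction J rule: finite_induct)
  case empty
  show ?case by (intro exI[of _ 1]) auto
next
  case (insert k J)
  let ?z = "\<lambda>p. of_real (lam k) * p + \<mu> k"
  define S where "S p = (\<Prod>j\<in>J. 2 * sin (of_real pi * (of_real (lam j) * p + \<mu> j)))" for p
  define E where "E p = (\<Prod>j\<in>J. \<i> * exp (- \<i> * of_real pi * (of_real (lam j) * p + \<mu> j)))" for p
  obtain C where C: "C > 0" 
    "\<And>p. norm (S p) \<le> C * exp (pi * sum lam J * \<bar>Im p\<bar>)"
    "\<And>p. norm (E p) \<le> C * exp (pi * sum lam J * Im p)"
    "\<And>p. norm (S p - E p) \<le> C * exp (pi * sum lam J * \<bar>Im p\<bar> - \<delta> * Im p)"
    using insert.IH insert.prems unfolding S_def E_def by blast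
  have k: "lam k > 0" "\<delta> \<le> 2 * pi * lam k" using insert.prems by auto
  define \<Lambda> where "\<Lambda> = sum lam J"
  have \<Lambda>: "\<Lambda> \<ge> 0" unfolding \<Lambda>_def using insert.prems by (intro sum_nonneg) (auto intro: less_imp_le)
  have sum: "sum lam (insert k J) = \<Lambda> + lam k" using insert.hyps by (simp add: \<Lambda>_def)
  define B where "B = exp (pi * \<bar>Im (\<mu> k)\<bar>)"
  have B: "B > 0" by (simp add: B_def)
  define e1 e2 where "e1 p = \<i> * exp (- \<i> * of_real pi * ?z p)" and "e2 p = \<i> * exp (\<i> * of_real pi * ?z p)" for p
  have s: "2 * sin (of_real pi * ?z p) = e1 p - e2 p" for p
    unfolding two_sin_eq e1_def e2_def by (simp add: mult.assoc)
  have n1: "norm (e1 p) \<le> B * exp (pi * lam k * Im p)" and n2: "norm (e2 p) \<le> B * exp (- (pi * lam k * Im p))" for p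
  proof -
    have "pi * Im (\<mu> k) \<le> pi * \<bar>Im (\<mu> k)\<bar>" "- (pi * Im (\<mu> k)) \<le> pi * \<bar>Im (\<mu> k)\<bar>"
      unfolding mult_minus_right[symmetric] by (intro mult_left_mono; simp)+
    then show "norm (e1 p) \<le> B * exp (pi * lam k * Im p)" "norm (e2 p) \<le> B * exp (- (pi * lam k * Im p))"
      by (auto simp: e1_def e2_def B_def norm_mult norm_exp_eq_Re exp_add[symmetric] algebra_simps)
  qed
  have n3: "norm (e1 p - e2 p) \<le> 2 * B * exp (pi * lam k * \<bar>Im p\<bar>)" for p
  proof -
    have "exp (pi * lam k * Im p) \<le> exp (pi * lam k * \<bar>Im p\<bar>)" "exp (- (pi * lam k * Im p)) \<le> exp (pi * lam k * \<bar>Im p\<bar>)"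
      using k by (auto simp: abs_if)
    then have "norm (e1 p) \<le> B * exp (pi * lam k * \<bar>Im p\<bar>)" "norm (e2 p) \<le> B * exp (pi * lam k * \<bar>Im p\<bar>)"
      using n1[of p] n2[of p] B by (meson mult_left_mono order_trans less_imp_le)+
    then show ?thesis using norm_triangle_ineq4[of "e1 p" "e2 p"] by linarith
  qed
  have p1: "norm ((e1 p - e2 p) * S p) \<le> (4 * B * C) * exp (pi * (\<Lambda> + lam k) * \<bar>Im p\<bar>)" for p
  proof -
    have "norm ((e1 p - e2 p) * S p) \<le> (2 * B * exp (pi * lam k * \<bar>Im p\<bar>)) * (C * exp (pi * \<Lambda> * \<bar>Im p\<bar>))"
      unfolding norm_mult \<Lambda>_def using n3 C(1,2) B by (intro mult_mono) auto
    also have "\<dots> = (2 * B * C) * exp (pi * (\<Lambda> + lam k) * \<bar>Im p\<bar>)"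
      by (simp add: exp_add algebra_simps)
    also have "\<dots> \<le> (4 * B * C) * exp (pi * (\<Lambda> + lam k) * \<bar>Im p\<bar>)"
      using B C(1) by simp
    finally show ?thesis .
  qed
  have p2: "norm (e1 p * E p) \<le> (4 * B * C) * exp (pi * (\<Lambda> + lam k) * Im p)" for p
  proof -
    have "norm (e1 p * E p) \<le> (B * exp (pi * lam k * Im p)) * (C * exp (pi * \<Lambda> * Im p))"
      unfolding norm_mult \<Lambda>_def using n1 C(1,3) B by (intro mult_mono) auto
    also have "\<dots> = (B * C) * exp (pi * (\<Lambda> + lam k) * Im p)"
      by (simp add: exp_add algebra_simps)
    also have "\<dots> \<le> (4 * B * C) * exp (pi * (\<Lambda> + lam k) * Im p)"
      using B C(1) by simp
    finally show ?thesis .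
  qed
  have p3: "norm ((e1 p - e2 p) * S p - e1 p * E p) \<le> (4 * B * C) * exp (pi * (\<Lambda> + lam k) * \<bar>Im p\<bar> - \<delta> * Im p)" for p
  proof -
    have "norm ((e1 p - e2 p) * (S p - E p)) \<le> (2 * B * exp (pi * lam k * \<bar>Im p\<bar>)) * (C * exp (pi * \<Lambda> * \<bar>Im p\<bar> - \<delta> * Im p))"
      unfolding norm_mult \<Lambda>_def using n3 C(1,4) B by (intro mult_mono) auto
    also have "\<dots> = (2 * B * C) * exp (pi * (\<Lambda> + lam k) * \<bar>Im p\<bar> - \<delta> * Im p)"
      by (simp add: exp_add exp_diff algebra_simps)
    finally have q1: "norm ((e1 p - e2 p) * (S p - E p)) \<le> (2 * B * C) * exp (pi * (\<Lambda> + lam k) * \<bar>Im p\<bar> - \<delta> * Im p)" .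
    \<comment> \<open>Upwards this is \<open>\<delta> \<le> 2 pi lam k\<close>; downwards the
      left-hand side is at most \<open>pi lam k \<bar>Im p\<bar>\<close>.\<close>
    have ex: "pi * \<Lambda> * Im p - pi * lam k * Im p \<le> pi * (\<Lambda> + lam k) * \<bar>Im p\<bar> - \<delta> * Im p"
    proof (cases "Im p \<ge> 0")
      case True
      then have "\<delta> * Im p \<le> 2 * pi * lam k * Im p" using k by (intro mult_right_mono)
      then show ?thesis using True by (simp add: algebra_simps)
    next
      case False
      then have "pi * \<Lambda> * Im p \<le> 0" "\<delta> * Im p \<le> 0" "0 \<le> pi * \<Lambda> * \<bar>Im p\<bar>"
        using \<Lambda> assms(3) by (auto simp: mult_nonneg_nonpos)
      then show ?thesis using False by (simp add: algebra_simps)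
    qed
    have "norm (e2 p * E p) \<le> (B * exp (- (pi * lam k * Im p))) * (C * exp (pi * \<Lambda> * Im p))"
      unfolding norm_mult \<Lambda>_def using n2 C(1,3) B by (intro mult_mono) auto
    also have "\<dots> = (B * C) * exp (pi * \<Lambda> * Im p - pi * lam k * Im p)"
      by (simp add: exp_diff exp_minus divide_inverse)
    also have "\<dots> \<le> (B * C) * exp (pi * (\<Lambda> + lam k) * \<bar>Im p\<bar> - \<delta> * Im p)"
      using ex B C(1) by simp
    finally have q2: "norm (e2 p * E p) \<le> (B * C) * exp (pi * (\<Lambda> + lam k) * \<bar>Im p\<bar> - \<delta> * Im p)" .
    have "(e1 p - e2 p) * S p - e1 p * E p = (e1 p - e2 p) * (S p - E p) - e2 p * E p"
      by (simp add: algebra_simps)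
    then have "norm ((e1 p - e2 p) * S p - e1 p * E p) \<le> norm ((e1 p - e2 p) * (S p - E p)) + norm (e2 p * E p)"
      by (metis norm_triangle_ineq4)
    also have "\<dots> \<le> (3 * B * C) * exp (pi * (\<Lambda> + lam k) * \<bar>Im p\<bar> - \<delta> * Im p)"
      using q1 q2 by simp
    also have "\<dots> \<le> (4 * B * C) * exp (pi * (\<Lambda> + lam k) * \<bar>Im p\<bar> - \<delta> * Im p)"
      using B C(1) by simp
    finally show ?thesis .
  qed
  show ?case
  proof (intro exI[of _ "4 * B * C"] conjI allI)
    show "4 * B * C > 0" using B C(1) by simp
  qed (unfold prod.insert[OF insert.hyps] s sum e1_def[symmetric] S_def[symmetric] E_def[symmetric], (rule p1 p2 p3)+)
qed

subsection \<open>The standard twist\<close>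

locale standard_twist = selberg_class +
  fixes \<alpha> :: real and c :: "nat \<Rightarrow> complex"
  assumes \<alpha>_pos: "\<alpha> > 0" and structural: "structural_coeffs D c"
begin

definition base :: real where "base = sel_conductor D powr (1 / d) / (2 * pi * d)"

lemma conductor_pos: "sel_conductor D > 0"
  using data_valid d_pos unfolding sel_conductor_def by (auto intro!: mult_pos_pos prod_pos simp: less_imp_neq[symmetric])

lemma base_pos: "base > 0"
  using conductor_pos d_pos by (simp add: base_def)

text \<open>The variable of the \<open>l\<close>-th structural term, normalised so that its
  candidate pole \<open>s_star D l\<close> becomes 0.\<close>

definition u :: "nat \<Rightarrow> complex \<Rightarrow> complex" where "u l s = of_real d * (s_star D l - s)"

lemma Re_u: "Re (u l s) = (d + 1) / 2 - real l - d * Re s"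
  using d_pos by (simp add: u_def s_star_def field_simps)

lemma Im_u: "Im (u l s) = - d * (sel_theta D + Im s)"
  by (simp add: u_def s_star_def algebra_simps)

definition coeff0 :: complex where "coeff0 = root_number D / of_real (sqrt (2 * pi))"

text \<open>With \<open>p = s + w / d\<close> the dependence on \<open>w\<close> reduces to one
  exponential and one Gamma factor, the shape of a Mellin--Barnes kernel.\<close>

lemma structural_term_eq:
  "structural_term D l (s + w / of_real d) =
     coeff0 * exp ((of_real (d / 2) - of_real d * s) * of_real (ln base)) * exp (- w * of_real (ln base)) * Gamma (u l s - w)"
proof -
  have d: "complex_of_real d \<noteq> 0" using d_pos by simp
  have 1: "of_real d * (s_star D l - (s + w / of_real d)) = u l s - w"
    using d by (simp add: u_def field_simps)
  have "of_real d * (1 / 2 - (s + w / of_real d)) = (of_real (d / 2) - of_real d * s) - w"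
    using d by (simp add: field_simps)
  then have powr_base: "conductor_base D powr (of_real d * (1 / 2 - (s + w / of_real d)))
     = exp (((of_real (d / 2) - of_real d * s) - w) * of_real (ln base))"
  proof -
    have "conductor_base D = of_real base" by (simp only: conductor_base_def base_def)
    then show ?thesis
      using \<open>of_real d * (1 / 2 - (s + w / of_real d)) = (of_real (d / 2) - of_real d * s) - w\<close> base_pos
      by (simp only: powr_def Ln_of_real of_real_eq_0_iff) simp
  qed
  then show ?thesis
  proof -
    have "exp (((of_real (d / 2) - of_real d * s) - w) * of_real (ln base))
      = exp ((of_real (d / 2) - of_real d * s) * of_real (ln base)) * exp (- w * of_real (ln base))"
      unfolding exp_add[symmetric] by (simp add: left_diff_distrib)
    then show ?thesis
      unfolding structural_term_def 1 coeff0_def powr_base by (simp only: mult.assoc)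
  qed
qed

lemma norm_cexp1: "norm (cexp1 t) = 1"
  by (simp add: cexp1_def norm_exp_eq_Re)

lemma twist_series_sums:
  assumes "Re s > 1"
  shows "(\<lambda>n. A n * cexp1 (- \<alpha> * real (Suc n) powr (1 / d)) * exp (- s * of_real (ln_Suc n))) sums
    standard_twist_series a D \<alpha> s"
proof -
  have "dirichlet_abs_conv a s"
    using selberg assms by (simp add: extended_selberg_def)
  then have "dirichlet_abs_conv (\<lambda>n. a n * cexp1 (- \<alpha> * real n powr (1 / d))) s"
    by (simp add: dirichlet_abs_conv_def norm_mult norm_cexp1)
  from dirichlet_series_sums(2)[OF this] show ?thesis
    unfolding ln_Suc_def standard_twist_series_def .
qed

definition sum_mu :: complex where "sum_mu = (\<Sum>j<num_gamma D. fe_mu D j)"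

lemma sum_lambda: "(\<Sum>j<num_gamma D. fe_lambda D j) = d / 2"
  by (simp add: sel_degree_def)

lemma sine_main_eq: 
  "sine_main p = \<i> ^ num_gamma D * exp (- \<i> * of_real pi * (of_real (d / 2) * p + sum_mu))"
proof -
  have "(\<Sum>j<num_gamma D. zarg j p) = of_real (d / 2) * p + sum_mu"
    by (simp add: zarg_def sum.distrib sum_mu_def sum_lambda[symmetric] sum_distrib_right)
  then show ?thesis
    by (simp add: sine_main_def prod.distrib exp_sum[symmetric] sum_distrib_left[symmetric] sum_negf)
qed

end

text \<open>The variable \<open>s\<close> ranges over the box \<open>\<sigma>1 < Re s < 4\<close>, \<open>\<bar>Im s\<bar> < Bd\<close>; the series converges where
  \<open>Re s \<ge> 3\<close>. The line of integration is \<open>Re w = 1/2 - K\<close>, the rectangle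
  \<open>[1/2 - K, b] \<times> [-T0, T0]\<close> contains all poles met on the way for every such \<open>s\<close>, \<open>M\<close> is the last
  structural term that is used (so that the remainder is integrable on the whole box), and \<open>P\<close> is the
  number of applications of the recurrence for the Mellin--Barnes integrals.\<close>

locale twist_box = standard_twist +
  fixes \<sigma>1 Bd b T0 :: real and M P K :: nat
  assumes \<sigma>1: "\<sigma>1 < 3" and Bd: "Bd > 0"
    and hM: "(d + 1) / 2 - real M - d * \<sigma>1 \<le> - 1"
    and hP: "(d + 1) / 2 - d * \<sigma>1 < real P - 1"
    and hK: "real K \<ge> real M + 5 * d + real P + 3"
    and hb: "b > d * (1 - \<sigma>1)" "b > 1 / 2"
    and hT0: "T0 \<ge> d * (Bd + 1)"
begin

definition x :: real where "x = 1 / 2 - real K"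

definition U :: "complex set" where "U = {s. \<sigma>1 < Re s \<and> Re s < 4 \<and> \<bar>Im s\<bar> < Bd}"

text \<open>The closed box is compact, so that estimates valid outside a bounded range of
  \<open>v\<close> extend to all \<open>v\<close>.\<close>

definition Ucl :: "complex set" where "Ucl = cbox (Complex \<sigma>1 (-Bd)) (Complex 4 Bd)"

definition pt :: "complex \<Rightarrow> real \<Rightarrow> complex" where "pt s v = s + Complex x v / of_real d"

lemma U_subset: "U \<subseteq> Ucl"
  by (auto simp: U_def Ucl_def in_cbox_complex_iff)

lemma UclD: "s \<in> Ucl \<Longrightarrow> \<sigma>1 \<le> Re s \<and> Re s \<le> 4 \<and> \<bar>Im s\<bar> \<le> Bd"
  by (auto simp: Ucl_def in_cbox_complex_iff)

lemma U_box: "U = box (Complex \<sigma>1 (-Bd)) (Complex 4 Bd)"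
  by (auto simp: U_def in_box_complex_iff)

lemma open_U: "open U" and convex_U: "convex U"
  unfolding U_box by (auto simp: open_box convex_box)

lemma Re_pt: "Re (pt s v) = Re s + x / d" and Im_pt: "Im (pt s v) = Im s + v / d"
  by (simp_all add: pt_def)

lemma x_le: "x \<le> - 5 * d" and x_le': "x + real P + real M + 5 * d + 2 \<le> 0"
  using hK by (simp_all add: x_def)

lemma Re_pt_le: "s \<in> Ucl \<Longrightarrow> Re (pt s v) \<le> - 1"
proof -
  assume s: "s \<in> Ucl"
  have "x / d \<le> -5" using x_le d_pos by (simp add: divide_le_eq)
  then show ?thesis using UclD[OF s] by (simp add: Re_pt)
qed

lemma Re_u_bounds:
  assumes "s \<in> Ucl" "l \<le> M"
  shows "1 + x + real P \<le> Re (u l s)" "Re (u l s) \<le> real P - 1"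
proof -
  have "d * Re s \<le> d * 4" "d * \<sigma>1 \<le> d * Re s"
    using UclD[OF assms(1)] d_pos by (auto intro: mult_left_mono)
  moreover have "real l \<le> real M" "real l \<ge> 0" using assms(2) by auto
  moreover have "0 \<le> d" using d_pos by simp
  ultimately show "1 + x + real P \<le> Re (u l s)" "Re (u l s) \<le> real P - 1"
    using hP x_le' unfolding Re_u add_divide_distrib by linarith+
qed

lemma Re_u_M: "s \<in> Ucl \<Longrightarrow> Re (u M s) \<le> - 1"
proof -
  assume s: "s \<in> Ucl"
  then have "d * \<sigma>1 \<le> d * Re s"
    using UclD[OF s] d_pos by (auto intro: mult_left_mono)
  then show ?thesis using hM unfolding Re_u by linarith
qed

text \<open>This explains the bound 3: \<open>(d + 1) / 2 - 3 d \<le> - 2\<close> is equivalent to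
  \<open>d \<ge> 1\<close>.\<close>

lemma Re_u_initial: "Re s \<ge> 3 \<Longrightarrow> Re (u l s) \<le> - 2"
proof -
  assume "Re s \<ge> 3"
  then have "d * 3 \<le> d * Re s" using d_pos by (intro mult_left_mono) auto
  moreover have "real l \<ge> 0" by simp
  ultimately show ?thesis using degree_ge_1 unfolding Re_u add_divide_distrib by linarith
qed

definition Bu :: real where "Bu = d * (\<bar>sel_theta D\<bar> + Bd)"

lemma Im_u_le: "s \<in> Ucl \<Longrightarrow> \<bar>Im (u l s)\<bar> \<le> Bu"
  using UclD[of s] d_pos unfolding Im_u Bu_def by (auto simp: abs_mult intro!: mult_left_mono)

lemma Bu_nonneg: "Bu \<ge> 0" using d_pos Bd by (simp add: Bu_def)

section \<open>Uniform estimates on the left line of integration\<close>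

lemma continuous_on_pt: "continuous_on S (\<lambda>(s, v). pt s v)"
  unfolding pt_def case_prod_beta divide_inverse by (intro continuous_intros)

text \<open>Asymptotic information is available for large \<open>\<bar>v\<bar>\<close> only; for
  small \<open>\<bar>v\<bar>\<close> continuity on the compact set
  \<open>Ucl \<times> {-V..V}\<close> supplies a bound, absorbed in the constant.\<close>

lemma bounded_on_box:
  fixes f :: "complex \<Rightarrow> real \<Rightarrow> complex"
  assumes "continuous_on (Ucl \<times> UNIV) (\<lambda>(s, v). f s v)"
    and "S \<subseteq> Ucl"
    and "\<exists>C V. \<forall>s\<in>S. \<forall>v. \<bar>v\<bar> \<ge> V \<longrightarrow> norm (f s v) \<le> C / (1 + v\<^sup>2)"
  obtains C where "C > 0" "\<And>s v. s \<in> S \<Longrightarrow> norm (f s v) \<le> C / (1 + v\<^sup>2)"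
proof -
  obtain C V where C: "\<And>s v. s \<in> S \<Longrightarrow> \<bar>v\<bar> \<ge> V \<Longrightarrow> norm (f s v) \<le> C / (1 + v\<^sup>2)"
    using assms(3) by blast
  have "compact (Ucl \<times> {-V..V})"
    by (intro compact_Times) (auto simp: Ucl_def)
  then have "compact ((\<lambda>(s, v). f s v) ` (Ucl \<times> {-V..V}))"
    by (intro compact_continuous_image continuous_on_subset[OF assms(1)]) auto
  then obtain B where B: "\<And>z. z \<in> (\<lambda>(s, v). f s v) ` (Ucl \<times> {-V..V}) \<Longrightarrow> norm z \<le> B"
    using compact_imp_bounded bounded_iff by metis
  define C' where "C' = max (max C (B * (1 + V\<^sup>2))) 1"
  have "norm (f s v) \<le> C' / (1 + v\<^sup>2)" if s: "s \<in> S" for s v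
  proof (cases "\<bar>v\<bar> \<ge> V")
    case True
    have "C / (1 + v\<^sup>2) \<le> C' / (1 + v\<^sup>2)"
      by (intro divide_right_mono) (auto simp: C'_def add_nonneg_nonneg)
    then show ?thesis using C[OF s True] by linarith
  next
    case False
    then have n: "norm (f s v) \<le> B"
      using s assms(2) by (intro B image_eqI[of _ _ "(s, v)"]) auto
    then have "B \<ge> 0" using norm_ge_zero order_trans by blast
    have "v\<^sup>2 \<le> V\<^sup>2"
    proof -
      have "\<bar>v\<bar> \<le> \<bar>V\<bar>" using False by linarith
      then show ?thesis by (simp add: abs_le_square_iff)
    qed
    then have "B * (1 + v\<^sup>2) \<le> B * (1 + V\<^sup>2)"
      using \<open>B \<ge> 0\<close> by (intro mult_left_mono) auto
    then have "B * (1 + v\<^sup>2) \<le> C'" by (simp add: C'_def)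
    then have "B \<le> C' / (1 + v\<^sup>2)"
      by (simp add: pos_le_divide_eq add_pos_nonneg)
    then show ?thesis using n by linarith
  qed
  then show ?thesis using that[of C'] by (simp add: C'_def)
qed

text \<open>The exponent \<open>N\<close> is left open, as the uses differ: a sharp one where only
  polynomial decay remains, a crude one where an exponential factor absorbs it.\<close>

lemma structural_term_bound:
  assumes "l \<le> M"
  obtains C where "C > 0" "\<And>s v. s \<in> Ucl \<Longrightarrow> Re (u l s) \<le> real N + 1 - real K \<Longrightarrow>
    norm (structural_term D l (pt s v)) \<le> C * (1 + \<bar>v\<bar>) ^ N * exp (- (pi / 2) * \<bar>v\<bar>)"
proof -
  obtain C where C: "C > 0"
    "\<And>t y v. 1 \<le> Re t - y \<Longrightarrow> Re t - y \<le> real N + 1 / 2 \<Longrightarrow> \<bar>Im t\<bar> \<le> Bu \<Longrightarrow>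
      norm (Gamma (t - Complex y v)) \<le> C * (1 + \<bar>v\<bar>) ^ N * exp (- (pi / 2) * \<bar>v\<bar>)"
    using norm_Gamma_shifted[OF zero_less_one Bu_nonneg, of N] by blast
  define L where "L = ln base"
  define B where "B = exp ((d / 2 + d * (\<bar>\<sigma>1\<bar> + 4)) * \<bar>L\<bar>) * exp (- (x * L))"
  have "norm (structural_term D l (pt s v)) \<le> (norm coeff0 * B * C + 1) * (1 + \<bar>v\<bar>) ^ N * exp (- (pi / 2) * \<bar>v\<bar>)"
    if s: "s \<in> Ucl" and le: "Re (u l s) \<le> real N + 1 - real K" for s v
  proof -
    have G: "norm (Gamma (u l s - Complex x v)) \<le> C * (1 + \<bar>v\<bar>) ^ N * exp (- (pi / 2) * \<bar>v\<bar>)"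
      using Re_u_bounds[OF s assms] le Im_u_le[OF s] by (intro C(2)) (auto simp: x_def)
    have "norm (exp ((of_real (d / 2) - of_real d * s) * of_real L)) \<le> exp ((d / 2 + d * (\<bar>\<sigma>1\<bar> + 4)) * \<bar>L\<bar>)"
    proof -
      have "\<bar>d / 2 - d * Re s\<bar> \<le> d / 2 + d * \<bar>Re s\<bar>"
        using d_pos abs_triangle_ineq4[of "d / 2" "d * Re s"] by (simp add: abs_mult)
      also have "\<dots> \<le> d / 2 + d * (\<bar>\<sigma>1\<bar> + 4)"
        using UclD[OF s] d_pos by (intro add_left_mono mult_left_mono) auto
      finally have "\<bar>d / 2 - d * Re s\<bar> * \<bar>L\<bar> \<le> (d / 2 + d * (\<bar>\<sigma>1\<bar> + 4)) * \<bar>L\<bar>"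
        by (intro mult_right_mono) auto
      moreover have "(d / 2 - d * Re s) * L \<le> \<bar>d / 2 - d * Re s\<bar> * \<bar>L\<bar>"
        unfolding abs_mult[symmetric] by (rule abs_ge_self)
      ultimately have "(d / 2 - d * Re s) * L \<le> (d / 2 + d * (\<bar>\<sigma>1\<bar> + 4)) * \<bar>L\<bar>"
        by (rule order_trans[rotated])
      then show ?thesis by (simp add: norm_exp_eq_Re)
    qed
    moreover have "norm (exp (- Complex x v * of_real L)) = exp (- (x * L))"
      by (simp add: norm_exp_eq_Re)
    ultimately have "norm (structural_term D l (pt s v)) \<le> norm coeff0 * exp ((d / 2 + d * (\<bar>\<sigma>1\<bar> + 4)) * \<bar>L\<bar>) * exp (- (x * L)) *
         (C * (1 + \<bar>v\<bar>) ^ N * exp (- (pi / 2) * \<bar>v\<bar>))"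
      unfolding pt_def structural_term_eq norm_mult L_def[symmetric] using G
      by (intro mult_mono) auto
    also have "\<dots> = (norm coeff0 * B * C) * ((1 + \<bar>v\<bar>) ^ N * exp (- (pi / 2) * \<bar>v\<bar>))"
      unfolding B_def by (simp only: mult.assoc)
    also have "\<dots> \<le> (norm coeff0 * B * C + 1) * ((1 + \<bar>v\<bar>) ^ N * exp (- (pi / 2) * \<bar>v\<bar>))"
      by (intro mult_right_mono) auto
    finally show ?thesis by (simp only: mult.assoc)
  qed
  moreover have "norm coeff0 * B * C + 1 > 0"
    using C(1) by (intro add_nonneg_pos) (auto simp: B_def)
  ultimately show ?thesis using that by blast
qed

lemma far_from_real_axis:
  obtains V where "\<And>s v. s \<in> Ucl \<Longrightarrow> \<bar>v\<bar> \<ge> V \<Longrightarrow> norm (pt s v) \<ge> R \<and> (\<forall>j<num_gamma D. Im (zarg j (pt s v)) \<noteq> 0)"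
proof -
  define R' where "R' = \<bar>R\<bar> + (\<Sum>j<num_gamma D. \<bar>Im (fe_mu D j)\<bar> / fe_lambda D j) + 1"
  have nn: "\<bar>Im (fe_mu D j)\<bar> / fe_lambda D j \<ge> 0" if "j < num_gamma D" for j
    using data_valid(3)[OF that] by simp
  have j: "\<bar>Im (fe_mu D j)\<bar> / fe_lambda D j < R'" if "j < num_gamma D" for j
    using member_le_sum[of j "{..<num_gamma D}" "\<lambda>j. \<bar>Im (fe_mu D j)\<bar> / fe_lambda D j"] nn that by (simp add: R'_def)
  have R: "R \<le> R'" using sum_nonneg[of "{..<num_gamma D}" "\<lambda>j. \<bar>Im (fe_mu D j)\<bar> / fe_lambda D j"] nn by (simp add: R'_def)
  have "norm (pt s v) \<ge> R \<and> (\<forall>j<num_gamma D. Im (zarg j (pt s v)) \<noteq> 0)" if s: "s \<in> Ucl" and v: "\<bar>v\<bar> \<ge> d * (Bd + R')" for s v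
  proof -
    have "Bd + R' \<le> \<bar>v / d\<bar>"
      using v d_pos by (simp add: le_divide_eq mult.commute)
    then have im: "\<bar>Im (pt s v)\<bar> \<ge> R'"
      using UclD[OF s] unfolding Im_pt by linarith
    then have "norm (pt s v) \<ge> R"
      using abs_Im_le_cmod[of "pt s v"] R by linarith
    moreover have "Im (zarg j (pt s v)) \<noteq> 0" if "j < num_gamma D" for j
    proof
      assume "Im (zarg j (pt s v)) = 0"
      then have "fe_lambda D j * Im (pt s v) = - Im (fe_mu D j)" by (simp add: zarg_def)
      then have "\<bar>Im (pt s v)\<bar> = \<bar>Im (fe_mu D j)\<bar> / fe_lambda D j"
        using data_valid(3)[OF that] by (metis abs_minus_cancel abs_mult abs_of_pos nonzero_mult_div_cancel_left less_irrefl)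
      then show False using j[OF that] im by linarith
    qed
    ultimately show ?thesis by blast
  qed
  then show ?thesis using that by blast
qed

text \<open>The points of the line lie in the left half-plane, so the expansion applies with the
  right half-plane as excluded sector. The gain \<open>1 / norm s\<close> of the remainder is given
  up, since a larger \<open>m\<close> gains as many powers as are wanted.\<close>

lemma h_expansion:
  obtains C V where "C > 0" "\<And>s v. s \<in> Ucl \<Longrightarrow> \<bar>v\<bar> \<ge> V \<Longrightarrow>
      norm (h_fun D (pt s v) - (\<Sum>l\<le>m. c l * structural_term D l (pt s v))) \<le> C * norm (structural_term D m (pt s v))
      \<and> F (pt s v) = h_fun D (pt s v) * sine_factor (pt s v) * Fbar (pt s v)"
proof -
  obtain R C where R: "R > 0" and C: "\<And>s. norm s \<ge> R \<Longrightarrow> \<bar>Arg s\<bar> \<ge> pi / 2 \<Longrightarrow>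
        norm (h_fun D s - (\<Sum>l\<le>m. c l * structural_term D l s)) \<le> C * norm (structural_term D m s) / norm s"
    using structural unfolding structural_coeffs_def by (meson pi_half_gt_zero)
  obtain V where V: "\<And>s v. s \<in> Ucl \<Longrightarrow> \<bar>v\<bar> \<ge> V \<Longrightarrow> norm (pt s v) \<ge> max R 1 \<and> (\<forall>j<num_gamma D. Im (zarg j (pt s v)) \<noteq> 0)"
    using far_from_real_axis[of "max R 1"] by blast
  have "norm (h_fun D (pt s v) - (\<Sum>l\<le>m. c l * structural_term D l (pt s v))) \<le> (\<bar>C\<bar> + 1) * norm (structural_term D m (pt s v))
      \<and> F (pt s v) = h_fun D (pt s v) * sine_factor (pt s v) * Fbar (pt s v)" if s: "s \<in> Ucl" and v: "\<bar>v\<bar> \<ge> V" for s v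
  proof
    have n: "norm (pt s v) \<ge> R" "norm (pt s v) \<ge> 1" using V[OF s v] by auto
    have re: "Re (pt s v) \<le> -1" by (rule Re_pt_le[OF s])
    then have "\<not> \<bar>Arg (pt s v)\<bar> < pi / 2" unfolding Arg_Re_pos by auto
    then have "norm (h_fun D (pt s v) - (\<Sum>l\<le>m. c l * structural_term D l (pt s v))) \<le> C * norm (structural_term D m (pt s v)) / norm (pt s v)"
      by (intro C n) auto
    also have "\<dots> \<le> (\<bar>C\<bar> + 1) * norm (structural_term D m (pt s v)) / 1"
      using n by (intro frac_le mult_right_mono) auto
    finally show "norm (h_fun D (pt s v) - (\<Sum>l\<le>m. c l * structural_term D l (pt s v))) \<le> (\<bar>C\<bar> + 1) * norm (structural_term D m (pt s v))"
      by simp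
    show "F (pt s v) = h_fun D (pt s v) * sine_factor (pt s v) * Fbar (pt s v)"
      using V[OF s v] re by (intro F_eq_h_sine) auto
  qed
  then show ?thesis using that[of "\<bar>C\<bar> + 1" V] by simp
qed

lemma sine_bounds:
  obtains C \<delta> where "C > 0" "0 < \<delta>" "\<delta> \<le> pi / 2"
    "\<And>s v. s \<in> Ucl \<Longrightarrow> norm (sine_factor (pt s v)) \<le> C * exp (pi / 2 * \<bar>v\<bar>)"
    "\<And>s v. s \<in> Ucl \<Longrightarrow> norm (sine_main (pt s v)) \<le> C * exp (pi / 2 * v)"
    "\<And>s v. s \<in> Ucl \<Longrightarrow> norm (sine_factor (pt s v) - sine_main (pt s v)) \<le> C * exp (pi / 2 * \<bar>v\<bar> - \<delta> * v)"
proof -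
  \<comment> \<open>At most every \<open>2 pi lambda_j\<close>, as the comparison of the sines
    demands, and at most \<open>pi / 2\<close>, which is needed for negative
    \<open>v\<close>.\<close>
  define \<delta>0 where "\<delta>0 = Min (insert (pi / 2) ((\<lambda>j. 2 * pi * fe_lambda D j) ` {..<num_gamma D}))"
  have \<delta>0: "\<delta>0 > 0" "\<And>j. j < num_gamma D \<Longrightarrow> \<delta>0 \<le> 2 * pi * fe_lambda D j"
    using data_valid(3) by (auto simp: \<delta>0_def intro!: Min_le)
  have \<delta>0': "\<delta>0 \<le> pi / 2"
    unfolding \<delta>0_def by (rule Min_le) auto
  obtain C where C: "C > 0" and Cb: "\<And>p. 
      norm (sine_factor p) \<le> C * exp (pi * (d / 2) * \<bar>Im p\<bar>) \<and>
      norm (sine_main p) \<le> C * exp (pi * (d / 2) * Im p) \<and>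
      norm (sine_factor p - sine_main p) \<le> C * exp (pi * (d / 2) * \<bar>Im p\<bar> - \<delta>0 * Im p)"
    using sine_product_bounds[of "{..<num_gamma D}" "fe_lambda D" \<delta>0 "fe_mu D"] data_valid(3) \<delta>0
    unfolding sine_factor_def sine_main_def zarg_def sum_lambda by auto
  \<comment> \<open>On the line \<open>Im p\<close> varies like \<open>v / d\<close>, so rates in
    \<open>Im p\<close> are divided by \<open>d\<close>; in particular \<open>pi d / 2\<close>
    becomes \<open>pi / 2\<close>.\<close>
  define \<delta> where "\<delta> = \<delta>0 / d"
  define B where "B = exp (pi * (d / 2) * Bd + \<delta>0 * Bd)"
  have Im: "\<bar>Im (pt s v)\<bar> \<le> Bd + \<bar>v\<bar> / d" "Im (pt s v) \<le> Bd + v / d" "- Im (pt s v) \<le> Bd - v / d" if "s \<in> Ucl" for s v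
    using UclD[OF that] d_pos abs_triangle_ineq[of "Im s" "v / d"] by (auto simp: Im_pt)
  have Bge: "exp (pi * (d / 2) * Bd) \<le> B"
    using \<delta>0(1) Bd by (simp add: B_def)
  have e1: "exp (pi * (d / 2) * \<bar>Im (pt s v)\<bar>) \<le> B * exp (pi / 2 * \<bar>v\<bar>)" if "s \<in> Ucl" for s v
  proof -
    have "pi * (d / 2) * \<bar>Im (pt s v)\<bar> \<le> pi * (d / 2) * (Bd + \<bar>v\<bar> / d)"
      using Im(1)[OF that] d_pos by (intro mult_left_mono) auto
    also have "\<dots> = pi * (d / 2) * Bd + pi / 2 * \<bar>v\<bar>" using d_pos by (simp add: field_simps)
    finally have "exp (pi * (d / 2) * \<bar>Im (pt s v)\<bar>) \<le> exp (pi * (d / 2) * Bd) * exp (pi / 2 * \<bar>v\<bar>)"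
      unfolding exp_add[symmetric] by simp
    also have "\<dots> \<le> B * exp (pi / 2 * \<bar>v\<bar>)" by (intro mult_right_mono Bge) auto
    finally show ?thesis .
  qed
  have e2: "exp (pi * (d / 2) * Im (pt s v)) \<le> B * exp (pi / 2 * v)" if "s \<in> Ucl" for s v
  proof -
    have "pi * (d / 2) * Im (pt s v) \<le> pi * (d / 2) * (Bd + v / d)"
      using Im(2)[OF that] d_pos by (intro mult_left_mono) auto
    also have "\<dots> = pi * (d / 2) * Bd + pi / 2 * v" using d_pos by (simp add: field_simps)
    finally have "exp (pi * (d / 2) * Im (pt s v)) \<le> exp (pi * (d / 2) * Bd) * exp (pi / 2 * v)"
      unfolding exp_add[symmetric] by simp
    also have "\<dots> \<le> B * exp (pi / 2 * v)" by (intro mult_right_mono Bge) auto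
    finally show ?thesis .
  qed
  have e3: "exp (pi * (d / 2) * \<bar>Im (pt s v)\<bar> - \<delta>0 * Im (pt s v)) \<le> B * exp (pi / 2 * \<bar>v\<bar> - \<delta> * v)" if "s \<in> Ucl" for s v
  proof -
    have "pi * (d / 2) * \<bar>Im (pt s v)\<bar> \<le> pi * (d / 2) * (Bd + \<bar>v\<bar> / d)"
      using Im(1)[OF that] d_pos by (intro mult_left_mono) auto
    also have "\<dots> = pi * (d / 2) * Bd + pi / 2 * \<bar>v\<bar>" using d_pos by (simp add: field_simps)
    finally have i1: "pi * (d / 2) * \<bar>Im (pt s v)\<bar> \<le> pi * (d / 2) * Bd + pi / 2 * \<bar>v\<bar>" .
    have "\<delta>0 * (- Im (pt s v)) \<le> \<delta>0 * (Bd - v / d)"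
      using Im(3)[OF that] \<delta>0(1) by (intro mult_left_mono) auto
    also have "\<dots> = \<delta>0 * Bd - \<delta> * v" by (simp add: \<delta>_def algebra_simps)
    finally show ?thesis
      using i1 unfolding B_def exp_add[symmetric] by simp
  qed
  have "norm (sine_factor (pt s v)) \<le> (C * B) * exp (pi / 2 * \<bar>v\<bar>)"
    "norm (sine_main (pt s v)) \<le> (C * B) * exp (pi / 2 * v)"
    "norm (sine_factor (pt s v) - sine_main (pt s v)) \<le> (C * B) * exp (pi / 2 * \<bar>v\<bar> - \<delta> * v)" if "s \<in> Ucl" for s v
    unfolding mult.assoc[of C B] using C
    by (rule_tac order_trans[OF conjunct1[OF Cb] mult_left_mono[OF e1[OF that]]], simp,
        rule_tac order_trans[OF conjunct1[OF conjunct2[OF Cb]] mult_left_mono[OF e2[OF that]]], simp,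
        rule_tac order_trans[OF conjunct2[OF conjunct2[OF Cb]] mult_left_mono[OF e3[OF that]]], simp)
  moreover have "\<delta> > 0" using \<delta>0 d_pos by (simp add: \<delta>_def)
  moreover have "\<delta> \<le> pi / 2"
  proof -
    have "\<delta>0 / d \<le> \<delta>0 / 1" using \<delta>0(1) degree_ge_1 by (intro divide_left_mono) auto
    then show ?thesis using \<delta>0' unfolding \<delta>_def by linarith
  qed
  moreover have "C * B > 0" using C by (simp add: B_def)
  ultimately show ?thesis using that by blast
qed

end

text \<open>A single weight \<open>1 / (1 + v^2)\<close> for all \<open>n\<close> reduces the
  interchange of sum and integral to the summability of the constants.\<close>

lemma sums_integral_quadratic_decay:
  fixes f :: "nat \<Rightarrow> real \<Rightarrow> complex"
  assumes cont: "\<And>n. continuous_on UNIV (f n)"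
    and bd: "\<And>n v. norm (f n v) \<le> B n / (1 + v\<^sup>2)"
    and B: "summable B"
  shows "(\<lambda>n. LINT v|lborel. f n v) sums (LINT v|lborel. (\<Sum>n. f n v))"
    and "integrable lborel (\<lambda>v. \<Sum>n. f n v)"
proof -
  have int: "integrable lborel (f n)" for n
    using integrable_quadratic_decay[OF cont bd] .
  define I where "I = (LINT v|lborel. 1 / (1 + v\<^sup>2 :: real))"
  have "summable (\<lambda>n. norm (f n v))" for v
  proof (rule summable_comparison_test')
    show "summable (\<lambda>n. B n * (1 / (1 + v\<^sup>2)))" using B by (rule summable_mult2)
    show "norm (norm (f n v)) \<le> B n * (1 / (1 + v\<^sup>2))" for n using bd[of n v] by simp
  qed
  then have 1: "AE v in lborel. summable (\<lambda>n. norm (f n v))" by simp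
  have 2: "summable (\<lambda>n. LINT v|lborel. norm (f n v))"
  proof (rule summable_comparison_test')
    show "summable (\<lambda>n. B n * I)" using B by (rule summable_mult2)
    show "norm (LINT v|lborel. norm (f n v)) \<le> B n * I" for n
    proof -
      have "(LINT v|lborel. norm (f n v)) \<le> (LINT v|lborel. B n * (1 / (1 + v\<^sup>2)))"
        using bd[of n] by (intro integral_mono integrable_norm int integrable_mult_right integrable_inverse_quadratic) simp
      also have "\<dots> = B n * I" unfolding I_def by (rule integral_mult_right_zero)
      finally show ?thesis by simp
    qed
  qed
  show "(\<lambda>n. LINT v|lborel. f n v) sums (LINT v|lborel. (\<Sum>n. f n v))"
    by (rule sums_integral[OF int 1 2])
  show "integrable lborel (\<lambda>v. \<Sum>n. f n v)"
    by (rule integrable_suminf[OF int 1 2])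
qed

context twist_box
begin

definition L\<alpha> :: "real \<Rightarrow> complex" where "L\<alpha> \<phi> = Complex (ln (2 * pi * \<alpha>)) \<phi>"

definition FB :: real where "FB = (\<Sum>n. norm (A n) * exp (- 2 * ln_Suc n)) + 1"

lemma Fbar_bound: "s \<in> Ucl \<Longrightarrow> norm (Fbar (pt s v)) \<le> FB" and FB_pos: "FB > 0"
proof -
  have "0 \<le> (\<Sum>n. norm (A n) * exp (- 2 * ln_Suc n))"
    by (intro suminf_nonneg summable_coeffs) auto
  then show "FB > 0" by (simp add: FB_def)
  show "norm (Fbar (pt s v)) \<le> FB" if "s \<in> Ucl"
    using norm_Fbar_le[OF Re_pt_le[OF that, of v]] by (simp add: FB_def)
qed

lemma K_decomp: obtains k where "K = k + 2"
proof -
  have "real K \<ge> 2" using hK d_pos by linarith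
  then show ?thesis using that[of "K - 2"] by simp
qed

lemma Gamma_x_not_pole: "Complex x v \<notin> \<int>\<^sub>\<le>\<^sub>0"
  unfolding x_def by (rule half_int_not_nonpos_Int)

lemma norm_Gamma_x: "norm (Gamma (Complex x v)) \<le> sqrt (2 * pi) * 3 ^ K / (1 + \<bar>v\<bar>) ^ K * exp (- (pi / 2) * \<bar>v\<bar>)"
  unfolding x_def by (rule norm_Gamma_left)

lemma continuous_on_parts:
  "continuous_on (Ucl \<times> UNIV) (\<lambda>z. F (pt (fst z) (snd z)))"
  "continuous_on (Ucl \<times> UNIV) (\<lambda>z. Fbar (pt (fst z) (snd z)))"
  "continuous_on S (\<lambda>z. Gamma (Complex x (snd z)))"
  "l \<le> M \<Longrightarrow> continuous_on (Ucl \<times> UNIV) (\<lambda>z. structural_term D l (pt (fst z) (snd z)))"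
  "continuous_on S (\<lambda>z. sine_main (pt (fst z) (snd z)))"
proof -
  have pt: "continuous_on S (\<lambda>z. pt (fst z) (snd z))" for S
    using continuous_on_pt[of S] by (simp add: case_prod_beta)
  have re: "Re (pt (fst z) (snd z)) < 0" if "z \<in> Ucl \<times> UNIV" for z
    using that Re_pt_le[of "fst z" "snd z"] by auto
  then have ne: "pt (fst z) (snd z) \<noteq> 0 \<and> pt (fst z) (snd z) \<noteq> 1" if "z \<in> Ucl \<times> UNIV" for z
    using that by (metis less_irrefl zero_complex.sel(1) one_complex.sel(1) not_one_less_zero)
  show "continuous_on (Ucl \<times> UNIV) (\<lambda>z. F (pt (fst z) (snd z)))"
    by (rule continuous_on_compose2[OF continuous_on_F pt]) (use ne in force)
  show "continuous_on (Ucl \<times> UNIV) (\<lambda>z. Fbar (pt (fst z) (snd z)))"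
    by (rule continuous_on_compose2[OF holomorphic_on_imp_continuous_on[OF Fbar_holomorphic] pt]) (use ne in force)
  show "continuous_on S (\<lambda>z. Gamma (Complex x (snd z)))"
    by (intro continuous_on_Gamma_compose continuous_intros Gamma_x_not_pole)
  show "continuous_on S (\<lambda>z. sine_main (pt (fst z) (snd z)))"
    unfolding sine_main_eq by (intro continuous_intros pt)
  show "continuous_on (Ucl \<times> UNIV) (\<lambda>z. structural_term D l (pt (fst z) (snd z)))" if "l \<le> M"
    unfolding pt_def structural_term_eq
  proof (intro continuous_intros continuous_on_Gamma_compose Re_pos_not_nonpos_Int)
    show "continuous_on (Ucl \<times> UNIV) (\<lambda>z. u l (fst z))"
      unfolding u_def by (intro continuous_intros)
    show "0 < Re (u l (fst z) - Complex x (snd z))" if "z \<in> Ucl \<times> UNIV" for z :: "complex \<times> real"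
      using Re_u_bounds(1)[of "fst z" l] that \<open>l \<le> M\<close> by auto
  qed
qed

text \<open>The exponentials of \<open>h\<close> and of the sines cancel, so the full decay
  \<open>exp (- pi / 2 \<bar>v\<bar>)\<close> of Gamma is left over. It compensates
  \<open>exp (v \<phi>)\<close> for all \<open>\<bar>\<phi>\<bar> \<le> pi / 2\<close> at once,
  which permits the passage to \<open>\<phi> = pi / 2\<close>.\<close>

lemma initial_bound:
  obtains C where "C > 0"
    "\<And>s v. s \<in> Ucl \<Longrightarrow> Re s \<ge> 3 \<Longrightarrow> norm (F (pt s v) * Gamma (Complex x v)) \<le> C * exp (- (pi / 2) * \<bar>v\<bar>) / (1 + v\<^sup>2)"
proof -
  obtain k where k: "K = k + 2" by (rule K_decomp)
  \<comment> \<open>Normalised by the inverse of the expected exponential, so that the compactness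
    argument for bounds of the form \<open>C / (1 + v^2)\<close> applies.\<close>
  define f where "f s v = F (pt s v) * Gamma (Complex x v) * exp (of_real (pi / 2 * \<bar>v\<bar>))" for s v
  define S where "S = {s \<in> Ucl. Re s \<ge> 3}"
  obtain Ch V where Ch: "Ch > 0" "\<And>s v. s \<in> Ucl \<Longrightarrow> \<bar>v\<bar> \<ge> V \<Longrightarrow>
      norm (h_fun D (pt s v) - (\<Sum>l\<le>0. c l * structural_term D l (pt s v))) \<le> Ch * norm (structural_term D 0 (pt s v))
      \<and> F (pt s v) = h_fun D (pt s v) * sine_factor (pt s v) * Fbar (pt s v)"
    using h_expansion[of 0] by blast
  obtain C0 where C0: "C0 > 0" "\<And>s v. s \<in> Ucl \<Longrightarrow> Re (u 0 s) \<le> real k + 1 - real K \<Longrightarrow>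
    norm (structural_term D 0 (pt s v)) \<le> C0 * (1 + \<bar>v\<bar>) ^ k * exp (- (pi / 2) * \<bar>v\<bar>)"
    using structural_term_bound[of 0 k] by auto
  obtain Cs \<delta> where Cs: "Cs > 0" "\<And>s v. s \<in> Ucl \<Longrightarrow> norm (sine_factor (pt s v)) \<le> Cs * exp (pi / 2 * \<bar>v\<bar>)"
    using sine_bounds by metis
  define C where "C = (norm (c 0) + Ch) * C0 * Cs * FB * (sqrt (2 * pi) * 3 ^ K)"
  have far: "norm (f s v) \<le> C / (1 + v\<^sup>2)" if s: "s \<in> S" and v: "\<bar>v\<bar> \<ge> V" for s v
  proof -
    have sU: "s \<in> Ucl" and "Re s \<ge> 3" using s by (auto simp: S_def)
    define X where "X = (1 + \<bar>v\<bar>) ^ k * exp (- (pi / 2) * \<bar>v\<bar>)"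
    have T: "norm (structural_term D 0 (pt s v)) \<le> C0 * X"
      using C0(2)[OF sU] Re_u_initial[OF \<open>Re s \<ge> 3\<close>, of 0] by (simp add: k X_def mult.assoc)
    have "norm (h_fun D (pt s v)) \<le> norm (c 0 * structural_term D 0 (pt s v)) + Ch * norm (structural_term D 0 (pt s v))"
      using Ch(2)[OF sU v] norm_triangle_sub[of "h_fun D (pt s v)" "c 0 * structural_term D 0 (pt s v)"] by simp
    also have "\<dots> = (norm (c 0) + Ch) * norm (structural_term D 0 (pt s v))"
      by (simp add: norm_mult distrib_right)
    also have "\<dots> \<le> (norm (c 0) + Ch) * (C0 * X)"
      using T Ch(1) by (intro mult_left_mono) auto
    finally have h: "norm (h_fun D (pt s v)) \<le> (norm (c 0) + Ch) * (C0 * X)" .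
    have "norm (F (pt s v)) \<le> (norm (c 0) + Ch) * (C0 * X) * (Cs * exp (pi / 2 * \<bar>v\<bar>)) * FB"
      using Ch(2)[OF sU v] h Cs(2)[OF sU, of v] Fbar_bound[OF sU, of v] Ch(1) C0(1) Cs(1) FB_pos
      by (auto simp: norm_mult X_def intro!: mult_mono)
    then have "norm (f s v) \<le> ((norm (c 0) + Ch) * (C0 * X) * (Cs * exp (pi / 2 * \<bar>v\<bar>)) * FB) *
        (sqrt (2 * pi) * 3 ^ K / (1 + \<bar>v\<bar>) ^ K * exp (- (pi / 2) * \<bar>v\<bar>)) * exp (pi / 2 * \<bar>v\<bar>)"
      unfolding f_def norm_mult using norm_Gamma_x[of v] Ch(1) C0(1) Cs(1) FB_pos
      by (intro mult_mono) (auto simp: X_def intro!: mult_nonneg_nonneg)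
    also have "\<dots> = C * ((1 + \<bar>v\<bar>) ^ k / (1 + \<bar>v\<bar>) ^ K) * 
        ((exp (- (pi / 2) * \<bar>v\<bar>) * exp (pi / 2 * \<bar>v\<bar>)) * (exp (- (pi / 2) * \<bar>v\<bar>) * exp (pi / 2 * \<bar>v\<bar>)))"
      unfolding X_def C_def by (simp only: times_divide_eq_left times_divide_eq_right ac_simps)
    also have "exp (- (pi / 2) * \<bar>v\<bar>) * exp (pi / 2 * \<bar>v\<bar>) = 1"
      unfolding exp_add[symmetric] by simp
    also have "(1 + \<bar>v\<bar>) ^ k / (1 + \<bar>v\<bar>) ^ K = 1 / (1 + \<bar>v\<bar>)\<^sup>2"
      unfolding k by (simp add: power_add power2_eq_square)
    also have "C * (1 / (1 + \<bar>v\<bar>)\<^sup>2) * (1 * 1) \<le> C * (1 / (1 + v\<^sup>2)) * (1 * 1)"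
      using Ch(1) C0(1) Cs(1) FB_pos
      by (intro mult_right_mono mult_left_mono divide_left_mono) 
        (auto simp: C_def power2_sum intro!: add_pos_nonneg mult_pos_pos)
    finally show ?thesis by simp
  qed
  have "continuous_on (Ucl \<times> UNIV) (\<lambda>(s, v). f s v)"
    unfolding f_def case_prod_beta by (intro continuous_intros continuous_on_parts)
  moreover have "S \<subseteq> Ucl" by (auto simp: S_def)
  ultimately obtain C' where C': "C' > 0" "\<And>s v. s \<in> S \<Longrightarrow> norm (f s v) \<le> C' / (1 + v\<^sup>2)"
    using bounded_on_box[of f S] far by blast
  have "norm (F (pt s v) * Gamma (Complex x v)) \<le> C' * exp (- (pi / 2) * \<bar>v\<bar>) / (1 + v\<^sup>2)" if "s \<in> Ucl" "Re s \<ge> 3" for s v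
  proof -
    have "norm (F (pt s v) * Gamma (Complex x v)) = norm (f s v) * exp (- (pi / 2) * \<bar>v\<bar>)"
      by (simp add: f_def norm_mult exp_minus)
    also have "\<dots> \<le> C' / (1 + v\<^sup>2) * exp (- (pi / 2) * \<bar>v\<bar>)"
      using C'(2)[of s v] that by (intro mult_right_mono) (auto simp: S_def)
    finally show ?thesis by simp
  qed
  then show ?thesis using that C'(1) by blast
qed

definition kernel :: "complex \<Rightarrow> real \<Rightarrow> complex" where
  "kernel s v = Fbar (pt s v) * Gamma (Complex x v) * exp (- Complex x v * L\<alpha> (pi / 2))"

text \<open>The integrand on the left line at \<open>\<phi> = pi / 2\<close> minus its structural
  main terms. This difference is controlled on the whole box, each of the two parts for
  \<open>Re s \<ge> 3\<close> only.\<close>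

definition \<Theta> :: "complex \<Rightarrow> real \<Rightarrow> complex" where
  "\<Theta> s v = F (pt s v) * Gamma (Complex x v) * exp (- Complex x v * L\<alpha> (pi / 2))
     - (\<Sum>l\<le>M. c l * structural_term D l (pt s v)) * sine_main (pt s v) * kernel s v"

lemma continuous_on_\<Theta>: "continuous_on (Ucl \<times> UNIV) (\<lambda>z. \<Theta> (fst z) (snd z))"
  unfolding \<Theta>_def kernel_def by (intro continuous_intros continuous_on_parts) auto

text \<open>The error splits as \<open>h (S - E) + (h - T) E\<close>, with \<open>S\<close> and
  \<open>E\<close> the sine product and its main part and \<open>T\<close> the truncated expansion.
  The first summand, times the kernel, decays exponentially in both directions; the second has no
  exponential decay upwards and is tamed by \<open>Re (u M s) \<le> - 1\<close>.\<close>

lemma \<Theta>_bound: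
  obtains C where "C > 0" "\<And>s v. s \<in> Ucl \<Longrightarrow> norm (\<Theta> s v) \<le> C / (1 + v\<^sup>2)"
proof -
  obtain k where k: "K = k + 2" by (rule K_decomp)
  \<comment> \<open>A crude exponent that serves every \<open>l \<le> M\<close>;
    \<open>exp (- \<delta> \<bar>v\<bar>)\<close> absorbs it.\<close>
  define N where "N = K + P"
  obtain Ch V where Ch: "Ch > 0" "\<And>s v. s \<in> Ucl \<Longrightarrow> \<bar>v\<bar> \<ge> V \<Longrightarrow>
      norm (h_fun D (pt s v) - (\<Sum>l\<le>M. c l * structural_term D l (pt s v))) \<le> Ch * norm (structural_term D M (pt s v))
      \<and> F (pt s v) = h_fun D (pt s v) * sine_factor (pt s v) * Fbar (pt s v)"
    using h_expansion[of M] by blast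
  have "\<exists>C>0. \<forall>s v. s \<in> Ucl \<longrightarrow> norm (structural_term D l (pt s v)) \<le> C * (1 + \<bar>v\<bar>) ^ N * exp (- (pi / 2) * \<bar>v\<bar>)" if "l \<le> M" for l
  proof -
    have "Re (u l s) \<le> real N + 1 - real K" if "s \<in> Ucl" for s
      using Re_u_bounds(2)[OF that \<open>l \<le> M\<close>] by (simp add: N_def)
    then show ?thesis using structural_term_bound[OF that, of N] by metis
  qed
  then obtain Ct where Ct: "\<And>l. l \<le> M \<Longrightarrow> Ct l > 0"
    "\<And>l s v. l \<le> M \<Longrightarrow> s \<in> Ucl \<Longrightarrow> norm (structural_term D l (pt s v)) \<le> Ct l * (1 + \<bar>v\<bar>) ^ N * exp (- (pi / 2) * \<bar>v\<bar>)"
    by metis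
  obtain CM where CM: "CM > 0" "\<And>s v. s \<in> Ucl \<Longrightarrow>
    norm (structural_term D M (pt s v)) \<le> CM * (1 + \<bar>v\<bar>) ^ k * exp (- (pi / 2) * \<bar>v\<bar>)"
  proof -
    have "Re (u M s) \<le> real k + 1 - real K" if "s \<in> Ucl" for s
      using Re_u_M[OF that] by (simp add: k)
    then show ?thesis using structural_term_bound[of M k] that by (metis order_refl)
  qed
  obtain Cs \<delta> where Cs: "Cs > 0" "0 < \<delta>" "\<delta> \<le> pi / 2"
    "\<And>s v. s \<in> Ucl \<Longrightarrow> norm (sine_main (pt s v)) \<le> Cs * exp (pi / 2 * v)"
    "\<And>s v. s \<in> Ucl \<Longrightarrow> norm (sine_factor (pt s v) - sine_main (pt s v)) \<le> Cs * exp (pi / 2 * \<bar>v\<bar> - \<delta> * v)"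
    using sine_bounds by metis
  obtain Cd where Cd: "Cd > 0" "\<And>v::real. (1 + \<bar>v\<bar>) ^ N * exp (- \<delta> * \<bar>v\<bar>) \<le> Cd / (1 + v\<^sup>2)"
    using power_exp_decay[OF Cs(2), of N] by blast
  define Cl where "Cl = (\<Sum>l\<le>M. norm (c l) * Ct l) + Ch * Ct M"
  have Cl: "Cl \<ge> 0"
    unfolding Cl_def using Ct(1) Ch(1) by (intro add_nonneg_nonneg sum_nonneg mult_nonneg_nonneg) (auto intro: less_imp_le)
  define Ck where "Ck = FB * (sqrt (2 * pi) * 3 ^ K) * exp (- (x * ln (2 * pi * \<alpha>)))"
  have Ck: "Ck > 0" using FB_pos by (simp add: Ck_def)
  have ker: "norm (kernel s v) \<le> Ck * (1 / (1 + \<bar>v\<bar>) ^ K * exp (- (pi / 2) * \<bar>v\<bar>) * exp (v * (pi / 2)))" if s: "s \<in> Ucl" for s v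
  proof -
    have "norm (kernel s v) \<le> FB * (sqrt (2 * pi) * 3 ^ K / (1 + \<bar>v\<bar>) ^ K * exp (- (pi / 2) * \<bar>v\<bar>)) * (exp (- (x * ln (2 * pi * \<alpha>))) * exp (v * (pi / 2)))"
      unfolding kernel_def norm_mult norm_exp_line L\<alpha>_def complex.sel
      using Fbar_bound[OF s] norm_Gamma_x FB_pos by (intro mult_mono) auto
    also have "\<dots> = Ck * (1 / (1 + \<bar>v\<bar>) ^ K * exp (- (pi / 2) * \<bar>v\<bar>) * exp (v * (pi / 2)))"
      unfolding Ck_def by (simp only: times_divide_eq_left times_divide_eq_right ac_simps mult_1_left mult_1_right)
    finally show ?thesis .
  qed
  have far: "norm (\<Theta> s v) \<le> (Ck * (Cl * Cs * Cd + Ch * CM * Cs)) / (1 + v\<^sup>2)" if s: "s \<in> Ucl" and v: "\<bar>v\<bar> \<ge> V" for s v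
  proof -
    define E where "E = exp (- (pi / 2) * \<bar>v\<bar>)"
    define h T where "h = h_fun D (pt s v)" and "T = (\<Sum>l\<le>M. c l * structural_term D l (pt s v))"
    have hT: "norm (h - T) \<le> Ch * norm (structural_term D M (pt s v))"
      using Ch(2)[OF s v] by (simp add: h_def T_def)
    then have hT1: "norm (h - T) \<le> Ch * (CM * (1 + \<bar>v\<bar>) ^ k * E)"
      using CM(2)[OF s, of v] Ch(1) by (auto simp: E_def intro: order_trans[OF _ mult_left_mono])
    have hT2: "norm (h - T) \<le> Ch * (Ct M * (1 + \<bar>v\<bar>) ^ N * E)"
      using hT Ct(2)[OF order_refl s, of v] Ch(1) by (auto simp: E_def intro: order_trans[OF _ mult_left_mono])
    have "norm T \<le> (\<Sum>l\<le>M. norm (c l) * (Ct l * (1 + \<bar>v\<bar>) ^ N * E))"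
      unfolding T_def
    proof (rule order_trans[OF norm_sum], rule sum_mono)
      fix l assume "l \<in> {..M}"
      then show "norm (c l * structural_term D l (pt s v)) \<le> norm (c l) * (Ct l * (1 + \<bar>v\<bar>) ^ N * E)"
        unfolding norm_mult E_def using s by (intro mult_left_mono Ct(2)) auto
    qed
    also have "\<dots> = (\<Sum>l\<le>M. norm (c l) * Ct l) * ((1 + \<bar>v\<bar>) ^ N * E)"
      unfolding sum_distrib_right by (simp only: mult.assoc)
    finally have "norm h \<le> Cl * ((1 + \<bar>v\<bar>) ^ N * E)"
      using hT2 norm_triangle_sub[of h T] by (simp add: Cl_def algebra_simps)
    then have h1: "norm (h * (sine_factor (pt s v) - sine_main (pt s v))) \<le> (Cl * ((1 + \<bar>v\<bar>) ^ N * E)) * (Cs * exp (pi / 2 * \<bar>v\<bar> - \<delta> * v))"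
      unfolding norm_mult using Cs(5)[OF s, of v] Cl by (intro mult_mono) (auto simp: E_def)
    have h2: "norm ((h - T) * sine_main (pt s v)) \<le> (Ch * (CM * (1 + \<bar>v\<bar>) ^ k * E)) * (Cs * exp (pi / 2 * v))"
      unfolding norm_mult using hT1 Cs(4)[OF s, of v] Ch(1) CM(1) by (intro mult_mono) (auto simp: E_def)
    have eq: "\<Theta> s v = kernel s v * (h * (sine_factor (pt s v) - sine_main (pt s v)) + (h - T) * sine_main (pt s v))"
      using Ch(2)[OF s v] unfolding \<Theta>_def kernel_def h_def[symmetric] T_def[symmetric] by (simp add: algebra_simps)
    define W where "W = 1 / (1 + \<bar>v\<bar>) ^ K * E * exp (v * (pi / 2))"
    have W: "W \<ge> 0" by (simp add: W_def E_def)
    have "norm (\<Theta> s v) \<le> (Ck * W) * ((Cl * ((1 + \<bar>v\<bar>) ^ N * E)) * (Cs * exp (pi / 2 * \<bar>v\<bar> - \<delta> * v)) + (Ch * (CM * (1 + \<bar>v\<bar>) ^ k * E)) * (Cs * exp (pi / 2 * v)))"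
      unfolding eq norm_mult[of "kernel s v"]
      using ker[OF s, of v] Ck W order_trans[OF norm_triangle_ineq add_mono[OF h1 h2]]
      by (intro mult_mono) (auto simp: W_def E_def)
    also have "\<dots> = Ck * (Cl * Cs * (W * ((1 + \<bar>v\<bar>) ^ N * E) * exp (pi / 2 * \<bar>v\<bar> - \<delta> * v)) + Ch * CM * Cs * (W * ((1 + \<bar>v\<bar>) ^ k * E) * exp (pi / 2 * v)))"
      by (simp add: algebra_simps)
    also have "\<dots> \<le> Ck * (Cl * Cs * (Cd / (1 + v\<^sup>2)) + Ch * CM * Cs * (1 / (1 + v\<^sup>2)))"
    proof -
      have le1: "1 / (1 + \<bar>v\<bar>) ^ K \<le> 1" by (simp add: divide_le_eq)
      have ex: "E * exp (v * (pi / 2)) * E * exp (pi / 2 * \<bar>v\<bar> - \<delta> * v) \<le> exp (- \<delta> * \<bar>v\<bar>)"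
      proof -
        have "(pi / 2 - \<delta>) * v \<le> (pi / 2 - \<delta>) * \<bar>v\<bar>" using Cs(3) by (intro mult_left_mono) auto
        then show ?thesis unfolding E_def exp_add[symmetric] by (simp add: algebra_simps)
      qed
      have "W * ((1 + \<bar>v\<bar>) ^ N * E) * exp (pi / 2 * \<bar>v\<bar> - \<delta> * v)
         = 1 / (1 + \<bar>v\<bar>) ^ K * ((1 + \<bar>v\<bar>) ^ N * (E * exp (v * (pi / 2)) * E * exp (pi / 2 * \<bar>v\<bar> - \<delta> * v)))"
        unfolding W_def by (simp only: ac_simps)
      also have "\<dots> \<le> 1 * ((1 + \<bar>v\<bar>) ^ N * exp (- \<delta> * \<bar>v\<bar>))"
        using ex le1 by (intro mult_mono mult_left_mono) (auto simp: E_def)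
      also have "\<dots> \<le> Cd / (1 + v\<^sup>2)" using Cd(2)[of v] by simp
      finally have a: "W * ((1 + \<bar>v\<bar>) ^ N * E) * exp (pi / 2 * \<bar>v\<bar> - \<delta> * v) \<le> Cd / (1 + v\<^sup>2)" .
      have ex2: "E * exp (v * (pi / 2)) * E * exp (pi / 2 * v) \<le> 1"
        unfolding E_def exp_add[symmetric] by (simp add: algebra_simps)
      have "W * ((1 + \<bar>v\<bar>) ^ k * E) * exp (pi / 2 * v) = (1 + \<bar>v\<bar>) ^ k / (1 + \<bar>v\<bar>) ^ K * (E * exp (v * (pi / 2)) * E * exp (pi / 2 * v))"
        unfolding W_def by (simp only: times_divide_eq_left times_divide_eq_right mult_1_left ac_simps)
      also have "\<dots> \<le> (1 + \<bar>v\<bar>) ^ k / (1 + \<bar>v\<bar>) ^ K * 1"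
        using ex2 by (intro mult_left_mono) auto
      also have "\<dots> = 1 / (1 + \<bar>v\<bar>)\<^sup>2" unfolding k by (simp add: power_add power2_eq_square)
      also have "\<dots> \<le> 1 / (1 + v\<^sup>2)"
        by (intro divide_left_mono) (auto simp: power2_sum intro!: add_pos_nonneg mult_pos_pos)
      finally have b: "W * ((1 + \<bar>v\<bar>) ^ k * E) * exp (pi / 2 * v) \<le> 1 / (1 + v\<^sup>2)" .
      show ?thesis
        using a b Ck Cl Cs(1) Ch(1) CM(1) by (intro mult_left_mono add_mono) auto
    qed
    also have "\<dots> = (Ck * (Cl * Cs * Cd + Ch * CM * Cs)) / (1 + v\<^sup>2)"
      by (simp add: add_divide_distrib distrib_left)
    finally show ?thesis .
  qed
  then have "\<exists>C V. \<forall>s\<in>Ucl. \<forall>v. \<bar>v\<bar> \<ge> V \<longrightarrow> norm (\<Theta> s v) \<le> C / (1 + v\<^sup>2)" by blast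
  with bounded_on_box[of \<Theta> Ucl] continuous_on_\<Theta> that show ?thesis
    by (auto simp: case_prod_beta)
qed

end

section \<open>Shifting the Cahen--Mellin integral and removing the damping\<close>

context twist_box
begin

abbreviation rect :: "real \<Rightarrow> complex" where "rect \<equiv> rectpath (Complex x (-T0)) (Complex b T0)"

definition mellin :: "complex \<Rightarrow> real \<Rightarrow> complex \<Rightarrow> complex" where
  "mellin s \<phi> w = F (s + w / of_real d) * Gamma w * exp (- w * L\<alpha> \<phi>)"

lemma b_pos: "b > 0" using hb(2) by simp
lemma x_less_b: "x < b" using x_le d_pos b_pos by simp
lemma T0_ge_1: "T0 \<ge> 1" and T0_gt: "T0 > d * Bd"
proof -
  have "d * (Bd + 1) \<ge> 1 * 1" using degree_ge_1 Bd by (intro mult_mono) auto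
  then show "T0 \<ge> 1" using hT0 by simp
  show "T0 > d * Bd" using hT0 d_pos by (simp add: distrib_left)
qed

lemma nonpos_Int_in_box:
  assumes "x \<le> Re w" "Re w \<le> b" "w \<notin> box (Complex x (- T0)) (Complex b T0)"
  shows "w \<notin> \<int>\<^sub>\<le>\<^sub>0"
proof
  assume w: "w \<in> \<int>\<^sub>\<le>\<^sub>0"
  then have im: "Im w = 0" and re: "Re w \<le> 0" by (auto elim!: nonpos_Ints_cases)
  then have "Re w = x \<or> Re w = b"
    using assms T0_ge_1 by (auto simp: in_box_complex_iff)
  then have "w = Complex x 0" using im re b_pos by (auto simp: complex_eq_iff)
  then show False using w Gamma_x_not_pole by simp
qed

lemma pole_in_box:
  assumes "s \<in> U" "s + w / of_real d = 1"
  shows "w \<in> box (Complex x (- T0)) (Complex b T0)"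
proof -
  have w: "w = of_real d * (1 - s)" using assms(2) d_pos by (simp add: field_simps)
  have s: "\<sigma>1 < Re s" "Re s < 4" "\<bar>Im s\<bar> < Bd" using assms(1) by (auto simp: U_def)
  have "d * (-3) < d * (1 - Re s)" "d * (1 - Re s) < d * (1 - \<sigma>1)"
    using s d_pos by (intro mult_strict_left_mono; simp)+
  then have "x < d * (1 - Re s)" "d * (1 - Re s) < b" using x_le d_pos hb(1) by linarith+
  moreover have "\<bar>d * Im s\<bar> < T0"
  proof -
    have "\<bar>d * Im s\<bar> < d * Bd" using s d_pos by (simp add: abs_mult)
    then show ?thesis using T0_gt by linarith
  qed
  ultimately show ?thesis
    by (simp add: w in_box_complex_iff abs_less_iff)
qed

definition regular_set :: "complex \<Rightarrow> complex set" where "regular_set s = {w. s + w / of_real d \<noteq> 1} - \<int>\<^sub>\<le>\<^sub>0"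

lemma open_regular_set: "open (regular_set s)"
proof -
  have "{w. s + w / of_real d \<noteq> 1} = - {of_real d * (1 - s)}"
    using d_pos by (auto simp: field_simps)
  then show ?thesis
    unfolding regular_set_def by (simp add: open_Diff open_Compl)
qed

lemma outside_box_subset:
  "s \<in> U \<Longrightarrow> {w. x \<le> Re w \<and> Re w \<le> b} - box (Complex x (- T0)) (Complex b T0) \<subseteq> regular_set s"
  using nonpos_Int_in_box pole_in_box unfolding regular_set_def by blast

lemma mellin_holomorphic: "mellin s \<phi> holomorphic_on regular_set s"
proof -
  have "(F \<circ> (\<lambda>w. s + w / of_real d)) holomorphic_on regular_set s"
    by (rule holomorphic_on_compose_gen[OF _ F_holomorphic]) (use d_pos in \<open>auto simp: regular_set_def intro!: holomorphic_intros\<close>)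
  then have "(\<lambda>w. F (s + w / of_real d)) holomorphic_on regular_set s" by (simp add: o_def)
  then show ?thesis
    unfolding mellin_def by (intro holomorphic_intros) (auto simp: regular_set_def)
qed

text \<open>The height \<open>T0 \<ge> d (Bd + 1)\<close> forces
  \<open>\<bar>Im (s + w / d)\<bar> \<ge> 1\<close>, hence distance at least 1 from the pole of
  \<open>F\<close>; finite order then suffices.\<close>

lemma mellin_growth:
  assumes s: "s \<in> U" and \<phi>: "\<bar>\<phi>\<bar> \<le> pi / 2"
  obtains A B N where "\<And>w. x \<le> Re w \<Longrightarrow> Re w \<le> b \<Longrightarrow> \<bar>Im w\<bar> \<ge> T0 \<Longrightarrow> norm (mellin s \<phi> w) \<le> A * exp (B * \<bar>Im w\<bar> ^ N)"
proof -
  obtain C N where C: "C > 0" "\<And>p. norm (p - 1) \<ge> 1 \<Longrightarrow> norm p \<ge> 1 \<Longrightarrow> norm (F p) \<le> C * exp (norm p ^ N)"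
    using F_growth by blast
  obtain G where G: "G > 0" "\<And>w. x \<le> Re w \<Longrightarrow> Re w \<le> b \<Longrightarrow> \<bar>Im w\<bar> \<ge> 1 \<Longrightarrow> norm (Gamma w :: complex) \<le> G"
    using norm_Gamma_bounded_strip[of x b] x_less_b by auto
  define \<kappa> where "\<kappa> = norm s + \<bar>x\<bar> + \<bar>b\<bar> + 1"
  define R where "R = \<bar>ln (2 * pi * \<alpha>)\<bar>"
  have "norm (mellin s \<phi> w) \<le> (C * G * exp ((\<bar>x\<bar> + \<bar>b\<bar>) * R)) * exp ((\<kappa> ^ N + pi / 2) * \<bar>Im w\<bar> ^ Suc N)"
    if w: "x \<le> Re w" "Re w \<le> b" "\<bar>Im w\<bar> \<ge> T0" for w
  proof -
    define t where "t = \<bar>Im w\<bar>"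
    define p where "p = s + w / of_real d"
    have t1: "t \<ge> 1" using w(3) T0_ge_1 by (simp add: t_def)
    have "d * (Bd + 1) \<le> t" using w(3) hT0 by (simp add: t_def)
    then have "Bd + 1 \<le> \<bar>Im w / d\<bar>" using d_pos by (simp add: t_def le_divide_eq mult.commute)
    moreover have "\<bar>Im s\<bar> < Bd" using s by (simp add: U_def)
    ultimately have im: "\<bar>Im p\<bar> \<ge> 1" by (simp add: p_def)
    have "norm p \<le> norm s + norm (w / of_real d)" unfolding p_def by (rule norm_triangle_ineq)
    also have "norm (w / of_real d) \<le> norm w"
      using degree_ge_1 mult_left_mono[of 1 d "norm w"] by (simp add: norm_divide divide_le_eq)
    also have "norm w \<le> \<bar>Re w\<bar> + t" unfolding t_def by (rule cmod_le)
    also have "\<bar>Re w\<bar> \<le> \<bar>x\<bar> + \<bar>b\<bar>" using w by auto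
    finally have "norm p \<le> (norm s + \<bar>x\<bar> + \<bar>b\<bar>) * 1 + 1 * t" by simp
    also have "\<dots> \<le> (norm s + \<bar>x\<bar> + \<bar>b\<bar>) * t + 1 * t"
      using t1 by (intro add_mono mult_left_mono) auto
    also have "\<dots> = \<kappa> * t" by (simp add: \<kappa>_def algebra_simps)
    finally have "norm p ^ N \<le> \<kappa> ^ N * t ^ N"
      by (metis norm_ge_zero power_mono power_mult_distrib)
    moreover have "\<kappa> ^ N * t ^ N \<le> \<kappa> ^ N * t ^ Suc N"
      using t1 by (intro mult_left_mono power_increasing) (auto simp: \<kappa>_def)
    ultimately have pN: "norm p ^ N \<le> \<kappa> ^ N * t ^ Suc N" by linarith
    have "norm (p - 1) \<ge> 1" "norm p \<ge> 1"
      using abs_Im_le_cmod[of "p - 1"] abs_Im_le_cmod[of p] im by simp_all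
    then have f: "norm (F p) \<le> C * exp (\<kappa> ^ N * t ^ Suc N)"
      using C pN by (meson exp_le_cancel_iff less_imp_le mult_left_mono order_trans)
    have g: "norm (Gamma w) \<le> G" using w t1 by (intro G(2)) (auto simp: t_def)
    have "\<bar>\<phi>\<bar> * t \<le> pi / 2 * t ^ Suc N"
      using \<phi> t1 self_le_power[of t "Suc N"] by (intro mult_mono) auto
    then have "exp (\<bar>\<phi>\<bar> * t) \<le> exp (pi / 2 * t ^ Suc N)"
      by simp
    then have "exp ((\<bar>x\<bar> + \<bar>b\<bar>) * R) * exp (\<bar>\<phi>\<bar> * t) \<le> exp ((\<bar>x\<bar> + \<bar>b\<bar>) * R) * exp (pi / 2 * t ^ Suc N)"
      by (intro mult_left_mono) auto
    moreover have "norm (exp (- w * L\<alpha> \<phi>)) \<le> exp ((\<bar>x\<bar> + \<bar>b\<bar>) * R) * exp (\<bar>\<phi>\<bar> * t)"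
      using norm_exp_strip[of w "\<bar>x\<bar> + \<bar>b\<bar>" "L\<alpha> \<phi>"] w unfolding R_def t_def by (simp add: L\<alpha>_def)
    ultimately have e: "norm (exp (- w * L\<alpha> \<phi>)) \<le> exp ((\<bar>x\<bar> + \<bar>b\<bar>) * R) * exp (pi / 2 * t ^ Suc N)"
      by linarith
    have "norm (mellin s \<phi> w) \<le> (C * exp (\<kappa> ^ N * t ^ Suc N)) * G * (exp ((\<bar>x\<bar> + \<bar>b\<bar>) * R) * exp (pi / 2 * t ^ Suc N))"
      unfolding mellin_def norm_mult p_def[symmetric] using f g e C(1) G(1) by (intro mult_mono) auto
    also have "\<dots> = (C * G * exp ((\<bar>x\<bar> + \<bar>b\<bar>) * R)) * (exp (\<kappa> ^ N * t ^ Suc N) * exp (pi / 2 * t ^ Suc N))"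
      by (simp only: ac_simps)
    also have "exp (\<kappa> ^ N * t ^ Suc N) * exp (pi / 2 * t ^ Suc N) = exp ((\<kappa> ^ N + pi / 2) * t ^ Suc N)"
      unfolding exp_add[symmetric] by (simp only: distrib_right)
    finally show ?thesis by (simp only: t_def)
  qed
  then show ?thesis using that by blast
qed

text \<open>At \<open>\<phi> = pi / 2\<close> the last factor becomes
  \<open>cexp1 (- \<alpha> * real (Suc n) powr (1 / d))\<close>, so this is then a term of the
  standard twist.\<close>

definition damped_term :: "complex \<Rightarrow> real \<Rightarrow> nat \<Rightarrow> complex" where
  "damped_term s \<phi> n = A n * exp (- s * of_real (ln_Suc n)) * exp (- exp (L\<alpha> \<phi> + of_real (ln_Suc n / d)))"

text \<open>Absolute convergence on the right line lets sum and integral be exchanged; each term is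
  a Cahen--Mellin integral with \<open>L\<close> shifted by \<open>ln_Suc n / d\<close>.\<close>

lemma mellin_right:
  assumes s: "Re s > 1" and \<phi>: "\<bar>\<phi>\<bar> < pi / 2"
  shows "integrable lborel (\<lambda>v. mellin s \<phi> (Complex b v))"
    and "(\<lambda>n. 2 * of_real pi * damped_term s \<phi> n) sums (LINT v|lborel. mellin s \<phi> (Complex b v))"
proof -
  define f where "f n v = A n * exp (- s * of_real (ln_Suc n)) * 
     (Gamma (Complex b v) * exp (- Complex b v * (L\<alpha> \<phi> + of_real (ln_Suc n / d))))" for n v
  obtain C where C: "C > 0" 
    "\<And>v L. Im L = \<phi> \<Longrightarrow> norm (Gamma (Complex b v) * exp (- Complex b v * L)) \<le> C * exp (- (b * Re L)) / (1 + v\<^sup>2)"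
    using Mellin_bound[OF b_pos \<phi>] by blast
  define B where "B n = norm (A n) * exp (- Re s * ln_Suc n) * (C * exp (- (b * ln (2 * pi * \<alpha>))))" for n
  have B: "summable B"
    unfolding B_def by (intro summable_mult2 summable_coeffs s)
  have cont: "continuous_on UNIV (f n)" for n
    unfolding f_def using b_pos
    by (intro continuous_intros continuous_on_Gamma_compose Re_pos_not_nonpos_Int) auto
  have bd: "norm (f n v) \<le> B n / (1 + v\<^sup>2)" for n v
  proof -
    have "norm (Gamma (Complex b v) * exp (- Complex b v * (L\<alpha> \<phi> + of_real (ln_Suc n / d)))) 
       \<le> C * exp (- (b * (ln (2 * pi * \<alpha>) + ln_Suc n / d))) / (1 + v\<^sup>2)"
      using C(2)[of "L\<alpha> \<phi> + of_real (ln_Suc n / d)" v] by (simp add: L\<alpha>_def)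
    also have "\<dots> \<le> C * exp (- (b * ln (2 * pi * \<alpha>))) / (1 + v\<^sup>2)"
      using C(1) b_pos d_pos ln_Suc_nonneg[of n] by (intro divide_right_mono mult_left_mono) (auto simp: distrib_left add_nonneg_nonneg)
    finally have "norm (f n v) \<le> norm (A n) * exp (- Re s * ln_Suc n) * (C * exp (- (b * ln (2 * pi * \<alpha>))) / (1 + v\<^sup>2))"
      unfolding f_def norm_mult[of "A n * exp (- s * of_real (ln_Suc n))"]
      by (intro mult_mono) (auto simp: norm_mult norm_exp_eq_Re)
    then show ?thesis by (simp add: B_def)
  qed
  have f_sums: "(\<lambda>n. f n v) sums mellin s \<phi> (Complex b v)" for v
  proof -
    have "Re (s + Complex b v / of_real d) > 1" using s divide_pos_pos[OF b_pos d_pos] by simp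
    then have "(\<lambda>n. A n * exp (- (s + Complex b v / of_real d) * of_real (ln_Suc n)) * (Gamma (Complex b v) * exp (- Complex b v * L\<alpha> \<phi>))) 
        sums (F (s + Complex b v / of_real d) * (Gamma (Complex b v) * exp (- Complex b v * L\<alpha> \<phi>)))"
      by (intro sums_mult2 F_sums)
    moreover have "A n * exp (- (s + Complex b v / of_real d) * of_real (ln_Suc n)) * (Gamma (Complex b v) * exp (- Complex b v * L\<alpha> \<phi>)) = f n v" for n
    proof -
      have "exp (- (s + Complex b v / of_real d) * of_real (ln_Suc n)) * exp (- Complex b v * L\<alpha> \<phi>)
         = exp (- s * of_real (ln_Suc n)) * exp (- Complex b v * (L\<alpha> \<phi> + of_real (ln_Suc n / d)))"
        unfolding exp_add[symmetric] by (simp add: algebra_simps)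
      moreover have "A n * exp (- (s + Complex b v / of_real d) * of_real (ln_Suc n)) * (Gamma (Complex b v) * exp (- Complex b v * L\<alpha> \<phi>))
         = A n * (exp (- (s + Complex b v / of_real d) * of_real (ln_Suc n)) * exp (- Complex b v * L\<alpha> \<phi>)) * Gamma (Complex b v)"
        by (simp only: ac_simps)
      ultimately show ?thesis unfolding f_def by (simp only: ac_simps)
    qed
    ultimately show ?thesis by (simp add: mellin_def mult.assoc)
  qed
  have eq: "(\<lambda>v. \<Sum>n. f n v) = (\<lambda>v. mellin s \<phi> (Complex b v))"
    using f_sums by (simp add: sums_iff)
  show "integrable lborel (\<lambda>v. mellin s \<phi> (Complex b v))"
    using sums_integral_quadratic_decay(2)[OF cont bd B] unfolding eq .
  have "(LINT v|lborel. f n v) = 2 * of_real pi * damped_term s \<phi> n" for n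
  proof -
    have "(LINT v|lborel. f n v) = A n * exp (- s * of_real (ln_Suc n)) * 
        (LINT v|lborel. Gamma (Complex b v) * exp (- Complex b v * (L\<alpha> \<phi> + of_real (ln_Suc n / d))))"
      unfolding f_def by (rule integral_mult_right_zero)
    also have "(LINT v|lborel. Gamma (Complex b v) * exp (- Complex b v * (L\<alpha> \<phi> + of_real (ln_Suc n / d))))
        = 2 * of_real pi * exp (- exp (L\<alpha> \<phi> + of_real (ln_Suc n / d)))"
      using hb(2) \<phi> by (intro Cahen_Mellin) (simp_all add: L\<alpha>_def)
    finally show ?thesis by (simp add: damped_term_def)
  qed
  then show "(\<lambda>n. 2 * of_real pi * damped_term s \<phi> n) sums (LINT v|lborel. mellin s \<phi> (Complex b v))"
    using sums_integral_quadratic_decay(1)[OF cont bd B] unfolding eq by simp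
qed

lemma mellin_left_bound:
  obtains C where "\<And>s \<phi> v. s \<in> U \<Longrightarrow> Re s \<ge> 3 \<Longrightarrow> \<bar>\<phi>\<bar> \<le> pi / 2 \<Longrightarrow> norm (mellin s \<phi> (Complex x v)) \<le> C / (1 + v\<^sup>2)"
proof -
  obtain C where C: "C > 0"
    "\<And>s v. s \<in> Ucl \<Longrightarrow> Re s \<ge> 3 \<Longrightarrow> norm (F (pt s v) * Gamma (Complex x v)) \<le> C * exp (- (pi / 2) * \<bar>v\<bar>) / (1 + v\<^sup>2)"
    using initial_bound by blast
  have "norm (mellin s \<phi> (Complex x v)) \<le> (C * exp (- (x * ln (2 * pi * \<alpha>)))) / (1 + v\<^sup>2)"
    if "s \<in> U" "Re s \<ge> 3" "\<bar>\<phi>\<bar> \<le> pi / 2" for s \<phi> v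
  proof -
    have "v * \<phi> \<le> pi / 2 * \<bar>v\<bar>"
    proof -
      have "v * \<phi> \<le> \<bar>\<phi>\<bar> * \<bar>v\<bar>" by (metis abs_ge_self abs_mult mult.commute)
      also have "\<dots> \<le> pi / 2 * \<bar>v\<bar>" using that(3) by (intro mult_right_mono) auto
      finally show ?thesis .
    qed
    then have "norm (exp (- Complex x v * L\<alpha> \<phi>)) \<le> exp (- (x * ln (2 * pi * \<alpha>))) * exp (pi / 2 * \<bar>v\<bar>)"
      unfolding norm_exp_line by (simp add: L\<alpha>_def)
    then have "norm (mellin s \<phi> (Complex x v)) \<le> (C * exp (- (pi / 2) * \<bar>v\<bar>) / (1 + v\<^sup>2)) * (exp (- (x * ln (2 * pi * \<alpha>))) * exp (pi / 2 * \<bar>v\<bar>))"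
      unfolding mellin_def norm_mult[of "F _ * Gamma _"] using C(2)[of s v] that U_subset C(1)
      by (intro mult_mono) (auto simp: pt_def)
    also have "\<dots> = (C * exp (- (x * ln (2 * pi * \<alpha>)))) / (1 + v\<^sup>2) * (exp (- (pi / 2) * \<bar>v\<bar>) * exp (pi / 2 * \<bar>v\<bar>))"
      by (simp only: times_divide_eq_left times_divide_eq_right ac_simps)
    also have "exp (- (pi / 2) * \<bar>v\<bar>) * exp (pi / 2 * \<bar>v\<bar>) = 1"
      unfolding exp_add[symmetric] by simp
    finally show ?thesis by simp
  qed
  then show ?thesis using that by blast
qed

lemma continuous_on_mellin_left:
  assumes "s \<in> U"
  shows "continuous_on UNIV (\<lambda>v. mellin s \<phi> (Complex x v))"
proof (rule continuous_on_compose2[OF holomorphic_on_imp_continuous_on[OF mellin_holomorphic]])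
  show "continuous_on UNIV (Complex x)" by (intro continuous_intros)
  have "Complex x v \<in> {w. x \<le> Re w \<and> Re w \<le> b} - box (Complex x (- T0)) (Complex b T0)" for v
    using x_less_b by (auto simp: in_box_complex_iff)
  then show "range (Complex x) \<subseteq> regular_set s" using outside_box_subset[OF assms] by blast
qed

lemma damped_twist:
  assumes s: "s \<in> U" "Re s \<ge> 3" and \<phi>: "\<bar>\<phi>\<bar> < pi / 2"
  shows "2 * of_real pi * (\<Sum>n. damped_term s \<phi> n) = (LINT v|lborel. mellin s \<phi> (Complex x v)) + contour_integral rect (mellin s \<phi>) / \<i>"
proof -
  obtain C where C: "\<And>v. norm (mellin s \<phi> (Complex x v)) \<le> C / (1 + v\<^sup>2)"
    using mellin_left_bound s \<phi> by (metis less_imp_le)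
  have int_l: "integrable lborel (\<lambda>v. mellin s \<phi> (Complex x v))"
    using C by (intro integrable_quadratic_decay continuous_on_mellin_left s)
  have s1: "Re s > 1" using s by simp
  obtain A B N where gr: "\<And>w. x \<le> Re w \<Longrightarrow> Re w \<le> b \<Longrightarrow> \<bar>Im w\<bar> \<ge> T0 \<Longrightarrow> norm (mellin s \<phi> w) \<le> A * exp (B * \<bar>Im w\<bar> ^ N)"
    using mellin_growth[OF s(1), of \<phi>] \<phi> by auto
  have "\<i> * (LINT v|lborel. mellin s \<phi> (Complex b v)) - \<i> * (LINT v|lborel. mellin s \<phi> (Complex x v)) = contour_integral rect (mellin s \<phi>)"
    by (rule strip_shift[OF x_less_b _ open_regular_set outside_box_subset[OF s(1)] mellin_holomorphic gr int_l mellin_right(1)[OF s1 \<phi>]])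
       (use T0_ge_1 in auto)
  then have "contour_integral rect (mellin s \<phi>) = \<i> * ((LINT v|lborel. mellin s \<phi> (Complex b v)) - (LINT v|lborel. mellin s \<phi> (Complex x v)))"
    by (simp add: right_diff_distrib)
  then have "(LINT v|lborel. mellin s \<phi> (Complex b v)) = (LINT v|lborel. mellin s \<phi> (Complex x v)) + contour_integral rect (mellin s \<phi>) / \<i>"
    by simp
  moreover have "2 * of_real pi * (\<Sum>n. damped_term s \<phi> n) = (LINT v|lborel. mellin s \<phi> (Complex b v))"
  proof -
    have "damped_term s \<phi> sums ((LINT v|lborel. mellin s \<phi> (Complex b v)) / (2 * of_real pi))"
      using sums_divide[OF mellin_right(2)[OF s1 \<phi>], of "2 * of_real pi"] by simp
    then show ?thesis by (simp add: sums_iff)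
  qed
  ultimately show ?thesis by simp
qed

lemma path_image_rect_subset: "s \<in> U \<Longrightarrow> path_image rect \<subseteq> regular_set s"
proof -
  assume s: "s \<in> U"
  have "path_image rect \<subseteq> {w. x \<le> Re w \<and> Re w \<le> b} - box (Complex x (- T0)) (Complex b T0)"
    using x_less_b T0_ge_1 by (subst path_image_rectpath) (auto simp: in_box_complex_iff)
  then show ?thesis using outside_box_subset[OF s] by blast
qed

text \<open>The limit \<open>\<phi> \<longlonglongrightarrow> pi / 2\<close> is taken in three
  places: in the series by Tannery's theorem, since \<open>cos \<phi> \<ge> 0\<close> makes the
  damping factor at most 1 in modulus; on the left line by the bound uniform in
  \<open>\<phi>\<close>; on the rectangle by compactness.\<close>

lemma twist_initial:
  assumes s: "s \<in> U" "Re s \<ge> 3"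
  shows "2 * of_real pi * standard_twist_series a D \<alpha> s
     = (LINT v|lborel. mellin s (pi / 2) (Complex x v)) + contour_integral rect (mellin s (pi / 2)) / \<i>"
proof -
  define \<phi> where "\<phi> n = pi / 2 - inverse (real (Suc n))" for n
  have "inverse (real (Suc n)) \<le> 1" "inverse (real (Suc n)) > 0" for n by (auto simp: inverse_eq_divide)
  moreover have "\<bar>pi / 2 - t\<bar> < pi / 2" if "0 < t" "t \<le> 1" for t
    using that pi_gt3 by linarith
  ultimately have \<phi>: "\<bar>\<phi> n\<bar> < pi / 2" for n
    unfolding \<phi>_def by blast
  have \<phi>_lim: "\<phi> \<longlonglongrightarrow> pi / 2"
    unfolding \<phi>_def using tendsto_diff[OF tendsto_const LIMSEQ_inverse_real_of_nat, of "pi / 2"] by simp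
  have L_lim: "(\<lambda>k. L\<alpha> (\<phi> k)) \<longlonglongrightarrow> L\<alpha> (pi / 2)"
    unfolding L\<alpha>_def by (intro tendsto_Complex tendsto_const \<phi>_lim)
  define tm where "tm n = A n * exp (- s * of_real (ln_Suc n)) * cexp1 (- \<alpha> * real (Suc n) powr (1 / d))" for n
  have s1: "Re s > 1" using s by simp
  have exp_eq: "exp (L\<alpha> \<psi> + of_real (ln_Suc n / d)) = of_real (2 * pi * \<alpha> * real (Suc n) powr (1 / d)) * cis \<psi>" for \<psi> n
  proof -
    have "L\<alpha> \<psi> + of_real (ln_Suc n / d) = of_real (ln (2 * pi * \<alpha>) + ln_Suc n / d) + \<i> * of_real \<psi>"
      by (simp add: L\<alpha>_def complex_eq_iff)
    then have "exp (L\<alpha> \<psi> + of_real (ln_Suc n / d)) = of_real (exp (ln (2 * pi * \<alpha>) + ln_Suc n / d)) * cis \<psi>"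
      by (simp only: exp_add[of "of_real _" "\<i> * of_real \<psi>"] cis_conv_exp exp_of_real)
    then have "exp (L\<alpha> \<psi> + of_real (ln_Suc n / d)) = of_real (exp (ln (2 * pi * \<alpha>)) * exp (ln_Suc n / d)) * cis \<psi>"
      by (simp only: exp_add)
    moreover have "exp (ln (2 * pi * \<alpha>)) = 2 * pi * \<alpha>" using \<alpha>_pos by simp
    moreover have "exp (ln_Suc n / d) = real (Suc n) powr (1 / d)"
      by (simp add: ln_Suc_def powr_def)
    ultimately show ?thesis by simp
  qed
  have lim_tm: "(\<lambda>k. damped_term s (\<phi> k) n) \<longlonglongrightarrow> tm n" for n
  proof -
    have "(\<lambda>k. damped_term s (\<phi> k) n) \<longlonglongrightarrow> damped_term s (pi / 2) n"
      unfolding damped_term_def by (intro tendsto_intros L_lim)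
    moreover have "damped_term s (pi / 2) n = tm n"
      unfolding damped_term_def exp_eq tm_def cexp1_def by (simp add: mult_ac)
    ultimately show ?thesis by simp
  qed
  have bd: "norm (damped_term s (\<phi> k) n) \<le> norm (A n) * exp (- Re s * ln_Suc n)" for k n
  proof -
    have "cos (\<phi> k) \<ge> 0" using \<phi>[of k] by (intro cos_ge_zero) auto
    then have "norm (exp (- exp (L\<alpha> (\<phi> k) + of_real (ln_Suc n / d)))) \<le> 1"
      unfolding exp_eq using \<alpha>_pos by (simp add: norm_exp_eq_Re)
    then have "norm (A n * exp (- s * of_real (ln_Suc n))) * norm (exp (- exp (L\<alpha> (\<phi> k) + of_real (ln_Suc n / d)))) 
        \<le> norm (A n * exp (- s * of_real (ln_Suc n))) * 1"
      by (intro mult_left_mono) auto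
    then show ?thesis
      unfolding damped_term_def norm_mult[of "A n * exp _"] by (simp add: norm_mult norm_exp_eq_Re)
  qed
  have "(\<forall>\<^sub>F k in sequentially. summable (\<lambda>n. norm (damped_term s (\<phi> k) n))) \<and> summable (\<lambda>n. norm (tm n)) \<and>
      (\<lambda>k. \<Sum>n. damped_term s (\<phi> k) n) \<longlonglongrightarrow> (\<Sum>n. tm n)"
  proof (rule tannerys_theorem[OF lim_tm _ summable_coeffs[OF s1]])
    show "\<forall>\<^sub>F (n, k) in sequentially \<times>\<^sub>F sequentially. norm (damped_term s (\<phi> k) n) \<le> norm (A n) * exp (- Re s * ln_Suc n)"
      by (rule always_eventually) (use bd in auto)
  qed simp
  then have "(\<lambda>k. \<Sum>n. damped_term s (\<phi> k) n) \<longlonglongrightarrow> (\<Sum>n. tm n)" by blast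
  then have lhs: "(\<lambda>k. 2 * of_real pi * (\<Sum>n. damped_term s (\<phi> k) n)) \<longlonglongrightarrow> 2 * of_real pi * (\<Sum>n. tm n)"
    by (intro tendsto_mult tendsto_const)
  obtain C where C0: "\<And>s \<phi> v. s \<in> U \<Longrightarrow> Re s \<ge> 3 \<Longrightarrow> \<bar>\<phi>\<bar> \<le> pi / 2 \<Longrightarrow> norm (mellin s \<phi> (Complex x v)) \<le> C / (1 + v\<^sup>2)"
    using mellin_left_bound by blast
  have C: "norm (mellin s (\<phi> k) (Complex x v)) \<le> C / (1 + v\<^sup>2)" for k v
    using less_imp_le[OF \<phi>[of k]] by (intro C0 s)
  have lim_m: "(\<lambda>k. mellin s (\<phi> k) w) \<longlonglongrightarrow> mellin s (pi / 2) w" for w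
    unfolding mellin_def by (intro tendsto_intros L_lim)
  have l: "(\<lambda>k. LINT v|lborel. mellin s (\<phi> k) (Complex x v)) \<longlonglongrightarrow> (LINT v|lborel. mellin s (pi / 2) (Complex x v))"
  proof (rule integral_dominated_convergence)
    show "integrable lborel (\<lambda>v::real. C * (1 / (1 + v\<^sup>2)))"
      by (intro integrable_mult_right integrable_inverse_quadratic)
    show "AE v in lborel. norm (mellin s (\<phi> k) (Complex x v)) \<le> C * (1 / (1 + v\<^sup>2))" for k
      using C[of k] by simp
  qed (use lim_m continuous_on_mellin_left[OF s(1)] in \<open>auto simp: borel_measurable_continuous_onI\<close>)
  have r: "(\<lambda>k. contour_integral rect (mellin s (\<phi> k))) \<longlonglongrightarrow> contour_integral rect (mellin s (pi / 2))"
  proof -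
    have cont: "continuous_on (path_image rect) (mellin s \<psi>)" for \<psi>
      using continuous_on_subset[OF holomorphic_on_imp_continuous_on[OF mellin_holomorphic] path_image_rect_subset[OF s(1)]] .
    have comp: "compact (path_image rect)" by (intro compact_path_image path_rectpath)
    \<comment> \<open>Compactness is used once, at angle 0; the other angles differ by the factor
      \<open>exp (- \<i> \<phi> w)\<close>, which is bounded on the rectangle uniformly in
      \<open>\<phi>\<close>.\<close>
    have "compact (mellin s 0 ` path_image rect)"
      by (rule compact_continuous_image[OF cont comp])
    then obtain B0 where B0: "\<And>w. w \<in> path_image rect \<Longrightarrow> norm (mellin s 0 w) \<le> B0"
      using compact_imp_bounded bounded_iff by (metis imageI)
    have "norm (mellin s (\<phi> k) w) \<le> B0 * exp (T0 * (pi / 2))" if w: "w \<in> path_image rect" for k w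
    proof -
      have im: "\<bar>Im w\<bar> \<le> T0"
        using w x_less_b T0_ge_1 by (subst (asm) path_image_rectpath) auto
      have "Im w * \<phi> k \<le> \<bar>Im w\<bar> * \<bar>\<phi> k\<bar>" by (metis abs_ge_self abs_mult)
      also have "\<dots> \<le> T0 * (pi / 2)" using im \<phi>[of k] T0_ge_1 by (intro mult_mono) auto
      finally have e: "exp (Im w * \<phi> k) \<le> exp (T0 * (pi / 2))" by simp
      have "L\<alpha> (\<phi> k) = L\<alpha> 0 + \<i> * of_real (\<phi> k)" by (simp add: L\<alpha>_def complex_eq_iff)
      then have "mellin s (\<phi> k) w = mellin s 0 w * exp (- w * (\<i> * of_real (\<phi> k)))"
      proof -
        assume "L\<alpha> (\<phi> k) = L\<alpha> 0 + \<i> * of_real (\<phi> k)"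
        then have "exp (- w * L\<alpha> (\<phi> k)) = exp (- w * L\<alpha> 0) * exp (- w * (\<i> * of_real (\<phi> k)))"
          unfolding exp_add[symmetric] by (simp add: algebra_simps)
        then show ?thesis unfolding mellin_def by (simp only: mult.assoc)
      qed
      then have "norm (mellin s (\<phi> k) w) = norm (mellin s 0 w) * exp (Im w * \<phi> k)"
        by (simp add: norm_mult norm_exp_eq_Re)
      also have "\<dots> \<le> B0 * exp (T0 * (pi / 2))"
        using B0[OF w] order_trans[OF norm_ge_zero B0[OF w]] by (intro mult_mono e) auto
      finally show ?thesis .
    qed
    then show ?thesis
      by (intro contour_integral_rectpath_dominated_limit[where h = "\<lambda>_. B0 * exp (T0 * (pi / 2))"] cont lim_m continuous_on_const) auto
  qed
  have "(\<lambda>k. 2 * of_real pi * (\<Sum>n. damped_term s (\<phi> k) n)) \<longlonglongrightarrow> 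
      (LINT v|lborel. mellin s (pi / 2) (Complex x v)) + contour_integral rect (mellin s (pi / 2)) / \<i>"
    unfolding damped_twist[OF s \<phi>] by (intro tendsto_add tendsto_divide l r tendsto_const) simp
  then have eq: "2 * of_real pi * (\<Sum>n. tm n) = (LINT v|lborel. mellin s (pi / 2) (Complex x v)) + contour_integral rect (mellin s (pi / 2)) / \<i>"
    using lhs LIMSEQ_unique by blast
  have "A n * cexp1 (- \<alpha> * real (Suc n) powr (1 / d)) * exp (- s * of_real (ln_Suc n)) = tm n" for n
    unfolding tm_def by (simp only: ac_simps)
  then have "standard_twist_series a D \<alpha> s = (\<Sum>n. tm n)"
    using twist_series_sums[OF s1] by (simp only: sums_iff)
  with eq show ?thesis by simp
qed

end

lemma contour_integral_linepath_holomorphic: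
  fixes F g :: "complex \<Rightarrow> complex"
  assumes F: "F holomorphic_on S" "open S" and U: "convex U" "open U"
    and g: "continuous_on (closed_segment p q) g"
    and sub: "\<And>s w. s \<in> U \<Longrightarrow> w \<in> closed_segment p q \<Longrightarrow> s + w / k \<in> S"
  shows "(\<lambda>s. contour_integral (linepath p q) (\<lambda>w. F (s + w / k) * g w)) holomorphic_on U"
proof -
  have lp: "linepath p q t \<in> closed_segment p q" if "t \<in> {0..1}" for t
    using that linepath_in_path by blast
  let ?f = "\<lambda>s t. F (s + linepath p q t / k) * g (linepath p q t) * (q - p)"
  let ?f' = "\<lambda>s t. deriv F (s + linepath p q t / k) * g (linepath p q t) * (q - p)"
  have shift: "continuous_on (U \<times> {0..1}) (\<lambda>z. fst z + linepath p q (snd z) / k)"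
    unfolding divide_inverse linepath_def by (intro continuous_intros)
  have shift_in: "fst z + linepath p q (snd z) / k \<in> S" if "z \<in> U \<times> {0..1}" for z
    using that lp by (auto intro!: sub)
  have gl: "continuous_on {0..1} (\<lambda>t. g (linepath p q t))"
    by (rule continuous_on_compose2[OF g]) (use lp in \<open>auto intro!: continuous_intros\<close>)
  have "(\<lambda>s. integral (cbox 0 1) (?f s)) holomorphic_on U"
  proof (rule leibniz_rule_holomorphic[where fx = ?f'])
    fix s :: complex and t :: real assume s: "s \<in> U" and t: "t \<in> cbox 0 1"
    have "(F has_field_derivative deriv F (s + linepath p q t / k)) (at (s + linepath p q t / k))"
      using F s t lp by (intro holomorphic_derivI[of F S] sub) auto
    then have "((\<lambda>s. F (s + linepath p q t / k)) has_field_derivative deriv F (s + linepath p q t / k)) (at s within U)"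
      by (rule has_field_derivative_at_within[OF DERIV_shift[THEN iffD1]])
    then show "((\<lambda>s. ?f s t) has_field_derivative ?f' s t) (at s within U)"
      by (intro DERIV_cmult_right)
  next
    fix s assume s: "s \<in> U"
    have "continuous_on {0..1} (\<lambda>t. F (s + linepath p q t / k))"
    proof (rule continuous_on_compose2[OF holomorphic_on_imp_continuous_on[OF F(1)]])
      show "continuous_on {0..1} (\<lambda>t. s + linepath p q t / k)"
        unfolding divide_inverse linepath_def by (intro continuous_intros)
    qed (use s lp sub in auto)
    then show "?f s integrable_on cbox 0 1"
      unfolding cbox_interval by (intro integrable_continuous_real continuous_intros gl)
  next
    have c1: "continuous_on (U \<times> {0..1}) (\<lambda>z. deriv F (fst z + linepath p q (snd z) / k))"
      by (rule continuous_on_compose2[OF holomorphic_on_imp_continuous_on[OF holomorphic_deriv[OF F]] shift])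
         (use shift_in in blast)
    have c2: "continuous_on (U \<times> {0..1}) (\<lambda>z. g (linepath p q (snd z)))"
      by (rule continuous_on_compose2[OF gl]) (auto intro: continuous_intros)
    show "continuous_on (U \<times> cbox 0 1) (\<lambda>(s, t). ?f' s t)"
      unfolding case_prod_beta cbox_interval by (intro continuous_intros c1 c2)
  qed (rule U(1))
  then show ?thesis
    by (simp add: contour_integral_integral)
qed

section \<open>Mellin--Barnes form of the structural terms\<close>

context twist_box
begin

text \<open>This is \<open>(n_alpha D \<alpha> / (n + 1)) powr (1 / d)\<close>: the index
  \<open>n\<close> stands for the integer \<open>n + 1\<close>. The logarithmic form merges with the
  other exponentials in \<open>w\<close>.\<close>

definition r :: "nat \<Rightarrow> real" where "r n = exp (ln base + ln (2 * pi * \<alpha>) - ln_Suc n / d)"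

lemma r_pos: "r n > 0" by (simp add: r_def)

text \<open>What a structural term and \<open>sine_main\<close> contribute outside the integral: the
  part independent of \<open>w\<close>, of \<open>n\<close>, and even of \<open>l\<close>.\<close>

definition \<kappa> :: "complex \<Rightarrow> complex" where
  "\<kappa> s = coeff0 * exp ((of_real (d / 2) - of_real d * s) * of_real (ln base)) *
     (\<i> ^ num_gamma D * exp (- \<i> * of_real pi * (of_real (d / 2) * s + sum_mu)))"

definition dual_term :: "nat \<Rightarrow> complex \<Rightarrow> complex" where
  "dual_term n s = cnj (A n) * exp (- (1 - s) * of_real (ln_Suc n))"

text \<open>Two quarter turns meet here: \<open>\<i> pi / 2\<close> from \<open>sine_main\<close>
  and \<open>\<i> pi / 2\<close> from \<open>L\<alpha> (pi / 2)\<close> add up to the argument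
  \<open>pi\<close> in \<open>MB_integrand\<close>.\<close>

lemma main_term_sums:
  assumes s: "s \<in> Ucl"
  shows "(\<lambda>n. \<kappa> s * (dual_term n s * MB_integrand K (u l s) (r n) v)) sums
    (structural_term D l (pt s v) * sine_main (pt s v) * kernel s v)"
proof -
  define w where "w = Complex x v"
  have d: "complex_of_real d \<noteq> 0" using d_pos by simp
  have pt: "pt s v = s + w / of_real d" by (simp add: pt_def w_def)
  define Q where "Q = structural_term D l (pt s v) * sine_main (pt s v) * (Gamma w * exp (- w * L\<alpha> (pi / 2)))"
  have "Re (pt s v) < 0" using Re_pt_le[OF s, of v] by simp
  then have "(\<lambda>n. Q * (cnj (A n) * exp (- (1 - pt s v) * of_real (ln_Suc n)))) sums (Q * Fbar (pt s v))"
    by (intro sums_mult Fbar_sums)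
  moreover have "Q * Fbar (pt s v) = structural_term D l (pt s v) * sine_main (pt s v) * kernel s v"
    unfolding Q_def kernel_def w_def by (simp only: ac_simps)
  moreover have "Q * (cnj (A n) * exp (- (1 - pt s v) * of_real (ln_Suc n))) = \<kappa> s * (dual_term n s * MB_integrand K (u l s) (r n) v)" for n
  proof -
    have e1: "exp (- \<i> * of_real pi * (of_real (d / 2) * pt s v + sum_mu)) 
      = exp (- \<i> * of_real pi * (of_real (d / 2) * s + sum_mu)) * exp (- w * (\<i> * of_real (pi / 2)))"
    proof -
      have "of_real (d / 2) * (s + w / of_real d) = of_real (d / 2) * s + w / 2"
        using d by (simp add: field_simps)
      moreover have "- \<i> * of_real pi * (y + w / 2 + sum_mu) = - \<i> * of_real pi * (y + sum_mu) + - w * (\<i> * of_real (pi / 2))" for y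
        by (simp add: field_simps)
      ultimately show ?thesis unfolding exp_add[symmetric] pt by (simp only:)
    qed
    have e2: "exp (- (1 - pt s v) * of_real (ln_Suc n)) = exp (- (1 - s) * of_real (ln_Suc n)) * exp (- w * of_real (- (ln_Suc n / d)))"
    proof -
      have "- (1 - (s + w / of_real d)) * of_real (ln_Suc n) = - (1 - s) * of_real (ln_Suc n) + - w * of_real (- (ln_Suc n / d))"
        by (simp add: algebra_simps)
      then show ?thesis unfolding exp_add[symmetric] pt by (simp only:)
    qed
    have "exp (- w * of_real (ln base)) * exp (- w * (\<i> * of_real (pi / 2))) * exp (- w * of_real (- (ln_Suc n / d))) * exp (- w * L\<alpha> (pi / 2))
      = exp (- w * (of_real (ln base) + \<i> * of_real (pi / 2) + of_real (- (ln_Suc n / d)) + L\<alpha> (pi / 2)))"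
      unfolding exp_add[symmetric] distrib_left by simp
    also have "of_real (ln base) + \<i> * of_real (pi / 2) + of_real (- (ln_Suc n / d)) + L\<alpha> (pi / 2) = Complex (ln (r n)) pi"
      by (simp add: L\<alpha>_def r_def complex_eq_iff)
    finally have e3: "exp (- w * Complex (ln (r n)) pi) = 
      exp (- w * of_real (ln base)) * exp (- w * (\<i> * of_real (pi / 2))) * exp (- w * of_real (- (ln_Suc n / d))) * exp (- w * L\<alpha> (pi / 2))" by simp
    have MBi: "MB_integrand K (u l s) (r n) v = Gamma (u l s - w) * Gamma w * exp (- w * Complex (ln (r n)) pi)"
      by (simp add: MB_integrand_def w_def x_def)
    have T: "structural_term D l (pt s v) = coeff0 * exp ((of_real (d / 2) - of_real d * s) * of_real (ln base)) * exp (- w * of_real (ln base)) * Gamma (u l s - w)"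
      unfolding pt by (rule structural_term_eq)
    show ?thesis
      unfolding Q_def T sine_main_eq e1 e2 MBi e3 \<kappa>_def dual_term_def by (simp only: ac_simps)
  qed
  ultimately show ?thesis by (simp only:)
qed

lemma r_powr: "r n powr (real K - 1 / 2) = exp (- (x * (ln base + ln (2 * pi * \<alpha>)))) * exp (x / d * ln_Suc n)"
proof -
  have "ln (r n) = (ln base + ln (2 * pi * \<alpha>)) - ln_Suc n / d" "real K - 1 / 2 = - x"
    by (simp_all add: x_def r_def)
  moreover have "- x * (y - ln_Suc n / d) = - (x * y) + x / d * ln_Suc n" for y
    by (simp add: right_diff_distrib)
  ultimately have "(real K - 1 / 2) * ln (r n) = - (x * (ln base + ln (2 * pi * \<alpha>))) + x / d * ln_Suc n"
    by (simp only:)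
  then show ?thesis
    using r_pos[of n] unfolding exp_add[symmetric] powr_def by simp
qed

definition Cr :: real where "Cr = exp (- (x * (ln base + ln (2 * pi * \<alpha>))))"

text \<open>Apart from the coefficient and a constant, the product is \<open>n + 1\<close> to the
  power \<open>Re (pt s v) - 1\<close>, and \<open>Re (pt s v) \<le> - 1\<close> on the left
  line.\<close>

lemma dual_term_bound:
  assumes s: "s \<in> Ucl"
  shows "norm (dual_term n s) * r n powr (real K - 1 / 2) \<le> Cr * (norm (A n) * exp (- 2 * ln_Suc n))"
proof -
  have "norm (dual_term n s) * r n powr (real K - 1 / 2) = norm (A n) * Cr * (exp (- (1 - Re s) * ln_Suc n) * exp (x / d * ln_Suc n))"
    unfolding r_powr dual_term_def Cr_def by (simp add: norm_mult norm_exp_eq_Re)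
  also have "exp (- (1 - Re s) * ln_Suc n) * exp (x / d * ln_Suc n) = exp (- (1 - Re (pt s 0)) * ln_Suc n)"
    unfolding exp_add[symmetric] by (simp add: Re_pt algebra_simps)
  finally have eq: "norm (dual_term n s) * r n powr (real K - 1 / 2) = norm (A n) * Cr * exp (- (1 - Re (pt s 0)) * ln_Suc n)" .
  have "2 * ln_Suc n \<le> (1 - Re (pt s 0)) * ln_Suc n"
    using Re_pt_le[OF s, of 0] by (intro mult_right_mono ln_Suc_nonneg) auto
  then have "exp (- (1 - Re (pt s 0)) * ln_Suc n) \<le> exp (- 2 * ln_Suc n)"
    by (simp only: exp_le_cancel_iff mult_minus_left neg_le_iff_le)
  then have "norm (A n) * Cr * exp (- (1 - Re (pt s 0)) * ln_Suc n) \<le> norm (A n) * Cr * exp (- 2 * ln_Suc n)"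
    by (intro mult_left_mono) (auto simp: Cr_def)
  then show ?thesis unfolding eq by (simp only: ac_simps)
qed

lemma K_ge_2: "K \<ge> 2" using K_decomp by (metis le_add2)

lemma MB_range:
  assumes "s \<in> Ucl" "l \<le> M"
  shows "1 / 2 - real K < Re (u l s)" "1 / 2 + 1 / 2 - real K + real P < Re (u l s)" "Re (u l s) < real P - 1" "\<bar>Im (u l s)\<bar> < Bu + 1"
proof -
  have "d * \<sigma>1 \<le> d * Re s" using UclD[OF assms(1)] d_pos by (intro mult_left_mono) auto
  moreover have "real l \<ge> 0" by simp
  ultimately show "Re (u l s) < real P - 1" using hP unfolding Re_u by linarith
  show "1 / 2 - real K < Re (u l s)" "1 / 2 + 1 / 2 - real K + real P < Re (u l s)"
    using Re_u_bounds(1)[OF assms] by (simp_all add: x_def)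
  show "\<bar>Im (u l s)\<bar> < Bu + 1" using Im_u_le[OF assms(1), of l] by simp
qed

lemma main_integral:
  assumes s: "s \<in> U" "Re s \<ge> 3" and l: "l \<le> M"
  shows "integrable lborel (\<lambda>v. structural_term D l (pt s v) * sine_main (pt s v) * kernel s v)"
    and "(\<lambda>n. 2 * of_real pi * \<kappa> s * (dual_term n s * MB K (u l s) (r n))) sums
      (LINT v|lborel. structural_term D l (pt s v) * sine_main (pt s v) * kernel s v)"
proof -
  have sU: "s \<in> Ucl" using s(1) U_subset by blast
  obtain k where k: "K = k + 2" by (rule K_decomp)
  obtain C where C: "C > 0"
    "\<And>u r v. 1 / 2 + 1 / 2 - real K \<le> Re u \<Longrightarrow> Re u \<le> - 1 \<Longrightarrow> \<bar>Im u\<bar> \<le> Bu + 1 \<Longrightarrow> r > 0 \<Longrightarrow>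
       norm (MB_integrand K u r v) \<le> C * r powr (real K - 1 / 2) / (1 + v\<^sup>2)"
    using norm_MB_integrand[of "1 / 2" "Bu + 1" k] Bu_nonneg unfolding k[symmetric] by auto
  define f where "f n v = \<kappa> s * (dual_term n s * MB_integrand K (u l s) (r n) v)" for n v
  define B where "B n = norm (\<kappa> s) * C * Cr * (norm (A n) * exp (- 2 * ln_Suc n))" for n
  note range = MB_range[OF sU l]
  have Re1: "Re (u l s) \<le> - 2" by (rule Re_u_initial[OF s(2)])
  have cont: "continuous_on UNIV (f n)" for n
    unfolding f_def by (intro continuous_intros continuous_on_MB_integrand range(1))
  have bd: "norm (f n v) \<le> B n / (1 + v\<^sup>2)" for n v
  proof -
    have "norm (MB_integrand K (u l s) (r n) v) \<le> C * r n powr (real K - 1 / 2) / (1 + v\<^sup>2)"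
      using range Re1 r_pos[of n] by (intro C(2)) auto
    then have "norm (f n v) \<le> norm (\<kappa> s) * (norm (dual_term n s) * (C * r n powr (real K - 1 / 2) / (1 + v\<^sup>2)))"
      unfolding f_def norm_mult by (intro mult_left_mono) auto
    also have "\<dots> = norm (\<kappa> s) * C * (norm (dual_term n s) * r n powr (real K - 1 / 2)) / (1 + v\<^sup>2)"
      by (simp only: times_divide_eq_left times_divide_eq_right ac_simps)
    also have "\<dots> \<le> norm (\<kappa> s) * C * (Cr * (norm (A n) * exp (- 2 * ln_Suc n))) / (1 + v\<^sup>2)"
      using C(1) by (intro divide_right_mono mult_left_mono dual_term_bound sU) (auto simp: add_nonneg_nonneg)
    finally show ?thesis by (simp only: B_def mult.assoc)
  qed
  have B: "summable B"
    unfolding B_def by (intro summable_mult summable_coeffs) simp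
  have eq: "(\<lambda>v. \<Sum>n. f n v) = (\<lambda>v. structural_term D l (pt s v) * sine_main (pt s v) * kernel s v)"
    using main_term_sums[OF sU] unfolding f_def by (simp add: sums_iff)
  show "integrable lborel (\<lambda>v. structural_term D l (pt s v) * sine_main (pt s v) * kernel s v)"
    using sums_integral_quadratic_decay(2)[OF cont bd B] unfolding eq .
  have "(LINT v|lborel. f n v) = 2 * of_real pi * \<kappa> s * (dual_term n s * MB K (u l s) (r n))" for n
  proof -
    have "(LINT v|lborel. f n v) = \<kappa> s * (dual_term n s * (LINT v|lborel. MB_integrand K (u l s) (r n) v))"
      unfolding f_def by simp
    then show ?thesis by (simp add: MB_def)
  qed
  then show "(\<lambda>n. 2 * of_real pi * \<kappa> s * (dual_term n s * MB K (u l s) (r n))) sums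
      (LINT v|lborel. structural_term D l (pt s v) * sine_main (pt s v) * kernel s v)"
    using sums_integral_quadratic_decay(1)[OF cont bd B] unfolding eq by simp
qed

lemma mellin_eq: "mellin s (pi / 2) (Complex x v) = \<Theta> s v + (\<Sum>l\<le>M. c l * (structural_term D l (pt s v) * sine_main (pt s v) * kernel s v))"
  unfolding mellin_def \<Theta>_def pt_def[symmetric] by (simp add: sum_distrib_right mult.assoc)

lemma integrable_\<Theta>:
  assumes "s \<in> U"
  shows "integrable lborel (\<Theta> s)"
proof -
  have s: "s \<in> Ucl" using assms U_subset by blast
  obtain C where C: "C > 0" "\<And>s v. s \<in> Ucl \<Longrightarrow> norm (\<Theta> s v) \<le> C / (1 + v\<^sup>2)" using \<Theta>_bound by blast
  have "continuous_on UNIV (\<lambda>v. \<Theta> (fst (s, v)) (snd (s, v)))"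
    by (rule continuous_on_compose2[OF continuous_on_\<Theta>]) (use s in \<open>auto intro!: continuous_intros\<close>)
  then show ?thesis
    using C(2)[OF s] by (intro integrable_quadratic_decay[of "\<Theta> s" C]) auto
qed

lemma twist_initial_MB:
  assumes s: "s \<in> U" "Re s \<ge> 3"
  shows "standard_twist_series a D \<alpha> s =
    ((LINT v|lborel. \<Theta> s v) + contour_integral rect (mellin s (pi / 2)) / \<i>) / (2 * of_real pi)
    + \<kappa> s * (\<Sum>l\<le>M. c l * (\<Sum>n. dual_term n s * MB K (u l s) (r n)))"
proof -
  let ?T = "\<lambda>l v. structural_term D l (pt s v) * sine_main (pt s v) * kernel s v"
  \<comment> \<open>Convergence is known for the series multiplied by \<open>\<kappa> s\<close>; if
    that factor is 0, both sides of \<open>T\<close> below vanish.\<close>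
  have sm: "summable (\<lambda>n. dual_term n s * MB K (u l s) (r n)) \<or> \<kappa> s = 0" if "l \<le> M" for l
    using main_integral(2)[OF s that] by (auto simp: sums_iff summable_cmult_iff)
  have T: "(LINT v|lborel. ?T l v) = 2 * of_real pi * (\<kappa> s * (\<Sum>n. dual_term n s * MB K (u l s) (r n)))" if "l \<le> M" for l
    using main_integral(2)[OF s that] sm[OF that] by (auto simp: sums_iff suminf_mult mult.assoc)
  have "(LINT v|lborel. mellin s (pi / 2) (Complex x v)) = (LINT v|lborel. \<Theta> s v) + (\<Sum>l\<le>M. c l * (LINT v|lborel. ?T l v))"
    unfolding mellin_eq using integrable_\<Theta>[OF s(1)] main_integral(1)[OF s]
    by (subst Bochner_Integration.integral_add) (auto simp: Bochner_Integration.integral_sum)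
  also have "(\<Sum>l\<le>M. c l * (LINT v|lborel. ?T l v)) = 2 * of_real pi * (\<kappa> s * (\<Sum>l\<le>M. c l * (\<Sum>n. dual_term n s * MB K (u l s) (r n))))"
    unfolding sum_distrib_left by (intro sum.cong refl) (simp add: T)
  finally have eq: "(LINT v|lborel. mellin s (pi / 2) (Complex x v)) = (LINT v|lborel. \<Theta> s v) + 
      2 * of_real pi * (\<kappa> s * (\<Sum>l\<le>M. c l * (\<Sum>n. dual_term n s * MB K (u l s) (r n))))" .
  have "2 * of_real pi * standard_twist_series a D \<alpha> s / (2 * of_real pi) =
    ((LINT v|lborel. \<Theta> s v) + contour_integral rect (mellin s (pi / 2)) / \<i> + 
      2 * of_real pi * (\<kappa> s * (\<Sum>l\<le>M. c l * (\<Sum>n. dual_term n s * MB K (u l s) (r n))))) / (2 * of_real pi)"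
    unfolding twist_initial[OF s] eq by (simp only: ac_simps)
  then show ?thesis by (simp add: add_divide_distrib)
qed

lemma rect_holomorphic: "(\<lambda>s. contour_integral rect (mellin s (pi / 2))) holomorphic_on U"
proof -
  define g where "g w = Gamma w * exp (- w * L\<alpha> (pi / 2))" for w
  have mel: "mellin s (pi / 2) = (\<lambda>w. F (s + w / of_real d) * g w)" for s
    by (intro ext) (simp only: mellin_def g_def mult.assoc)
  have im: "path_image rect = closed_segment (Complex x (-T0)) (Complex b (-T0)) \<union> closed_segment (Complex b (-T0)) (Complex b T0)
      \<union> closed_segment (Complex b T0) (Complex x T0) \<union> closed_segment (Complex x T0) (Complex x (-T0))"
    by (simp add: rectpath_def Let_def path_image_join Un_assoc)
  have ne: "s + w / of_real d \<noteq> 1" "w \<notin> \<int>\<^sub>\<le>\<^sub>0" if "s \<in> U" "w \<in> path_image rect" for s w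
    using path_image_rect_subset[OF that(1)] that(2) by (auto simp: regular_set_def)
  have seg: "(\<lambda>s. contour_integral (linepath p q) (\<lambda>w. F (s + w / of_real d) * g w)) holomorphic_on U"
    if "closed_segment p q \<subseteq> path_image rect" for p q
  proof (cases "U = {}")
    case False
    then obtain s0 where s0: "s0 \<in> U" by blast
    show ?thesis
    proof (rule contour_integral_linepath_holomorphic[OF F_holomorphic _ convex_U open_U])
      show "continuous_on (closed_segment p q) g"
        unfolding g_def using that ne(2)[OF s0] by (intro continuous_intros continuous_on_Gamma_compose) auto
    qed (use that ne in \<open>auto simp: open_Compl\<close>)
  qed (simp add: holomorphic_on_def)
  have "(\<lambda>s. contour_integral (linepath (Complex x (-T0)) (Complex b (-T0))) (mellin s (pi / 2)) +
    contour_integral (linepath (Complex b (-T0)) (Complex b T0)) (mellin s (pi / 2)) +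
    contour_integral (linepath (Complex b T0) (Complex x T0)) (mellin s (pi / 2)) +
    contour_integral (linepath (Complex x T0) (Complex x (-T0))) (mellin s (pi / 2))) holomorphic_on U"
    unfolding mel by (intro holomorphic_intros seg) (auto simp: im)
  then show ?thesis
  proof (rule holomorphic_transform)
    fix s assume s: "s \<in> U"
    have "continuous_on (path_image rect) (mellin s (pi / 2))"
      using continuous_on_subset[OF holomorphic_on_imp_continuous_on[OF mellin_holomorphic] path_image_rect_subset[OF s]] .
    then show "contour_integral (linepath (Complex x (-T0)) (Complex b (-T0))) (mellin s (pi / 2)) +
      contour_integral (linepath (Complex b (-T0)) (Complex b T0)) (mellin s (pi / 2)) +
      contour_integral (linepath (Complex b T0) (Complex x T0)) (mellin s (pi / 2)) +
      contour_integral (linepath (Complex x T0) (Complex x (-T0))) (mellin s (pi / 2)) = contour_integral rect (mellin s (pi / 2))"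
      by (subst contour_integral_rectpath) simp_all
  qed
qed

lemma u_holomorphic [holomorphic_intros]: "(\<lambda>s. u l s) holomorphic_on S"
  unfolding u_def by (intro holomorphic_intros)

lemma \<kappa>_holomorphic: "\<kappa> holomorphic_on S"
  unfolding \<kappa>_def[abs_def] by (intro holomorphic_intros)

lemma dual_term_holomorphic: "dual_term n holomorphic_on S"
  unfolding dual_term_def[abs_def] by (intro holomorphic_intros)

lemma \<Theta>_integral_holomorphic: "(\<lambda>s. LINT v|lborel. \<Theta> s v) holomorphic_on U"
proof -
  obtain C where C: "C > 0" "\<And>s v. s \<in> Ucl \<Longrightarrow> norm (\<Theta> s v) \<le> C / (1 + v\<^sup>2)" using \<Theta>_bound by blast
  show ?thesis
  proof (rule holomorphic_integral_parameter[OF open_U])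
    show "integrable lborel (\<lambda>v::real. C * (1 / (1 + v\<^sup>2)))"
      by (intro integrable_mult_right integrable_inverse_quadratic)
    show "norm (\<Theta> s v) \<le> C * (1 / (1 + v\<^sup>2))" if "s \<in> U" for s v
      using C(2)[of s v] that U_subset by auto
    show "\<Theta> s \<in> borel_measurable lborel" if "s \<in> U" for s
      using integrable_\<Theta>[OF that] by (rule borel_measurable_integrable)
    show "(\<lambda>s. \<Theta> s v) holomorphic_on U" for v
    proof -
      have re: "Re (pt s v) \<le> - 1" if "s \<in> U" for s using Re_pt_le[of s v] that U_subset by blast
      have pt: "(\<lambda>s. pt s v) holomorphic_on U" unfolding pt_def by (intro holomorphic_intros)
      have "(F \<circ> (\<lambda>s. pt s v)) holomorphic_on U"
        by (rule holomorphic_on_compose_gen[OF pt F_holomorphic]) (use re in force)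
      then have 1: "(\<lambda>s. F (pt s v)) holomorphic_on U" by (simp add: o_def)
      have "(Fbar \<circ> (\<lambda>s. pt s v)) holomorphic_on U"
        by (rule holomorphic_on_compose_gen[OF pt Fbar_holomorphic]) (use re in force)
      then have 2: "(\<lambda>s. Fbar (pt s v)) holomorphic_on U" by (simp add: o_def)
      have 3: "(\<lambda>s. structural_term D l (pt s v)) holomorphic_on U" if "l \<le> M" for l
        unfolding pt_def structural_term_eq
      proof (intro holomorphic_intros Re_pos_not_nonpos_Int)
        show "0 < Re (u l s - Complex x v)" if "s \<in> U" for s
          using Re_u_bounds(1)[of s l] that U_subset \<open>l \<le> M\<close> by auto
      qed
      have 4: "(\<lambda>s. sine_main (pt s v)) holomorphic_on U"
        unfolding sine_main_eq by (intro holomorphic_intros pt)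
      show ?thesis
        unfolding \<Theta>_def kernel_def by (intro holomorphic_intros 1 2 3 4) auto
    qed
  qed
qed

section \<open>Separating the resonant index from all others\<close>

lemma r_strict_antimono: "m < n \<Longrightarrow> r n < r m"
  using d_pos by (simp add: r_def ln_Suc_def divide_strict_right_mono)

lemma r_separated:
  assumes n0: "r n0 = 1"
  obtains \<delta> where "\<delta> > 0" "\<And>n. n \<noteq> n0 \<Longrightarrow> \<delta> \<le> \<bar>1 - r n\<bar>"
proof -
  \<comment> \<open>By monotonicity the neighbours of \<open>n0\<close> come closest to 1; for
    \<open>n0 = 0\<close> there is only one neighbour, and the value 1 is a harmless
    default.\<close>
  define \<delta> where "\<delta> = min (1 - r (Suc n0)) (if n0 = 0 then 1 else r (n0 - 1) - 1)"
  have anti: "r n \<le> r m" if "m \<le> n" for m n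
    using r_strict_antimono[of m n] that by (cases "m = n") auto
  have "\<delta> > 0"
    using r_strict_antimono[of n0 "Suc n0"] r_strict_antimono[of "n0 - 1" n0] n0 by (auto simp: \<delta>_def)
  moreover have "\<delta> \<le> \<bar>1 - r n\<bar>" if "n \<noteq> n0" for n
  proof (cases "n < n0")
    case True
    then have "r (n0 - 1) \<le> r n" by (intro anti) auto
    then show ?thesis using True by (auto simp: \<delta>_def min_def)
  next
    case False
    then have "r n \<le> r (Suc n0)" using that by (intro anti) auto
    then show ?thesis by (auto simp: \<delta>_def min_def)
  qed
  ultimately show ?thesis using that by blast
qed

definition off_term :: "nat \<Rightarrow> nat \<Rightarrow> nat \<Rightarrow> complex \<Rightarrow> complex" where
  "off_term n0 l n s = (if n = n0 then 0 else dual_term n s * MB_cont K (r n) P (u l s))"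

text \<open>Away from \<open>n0\<close> the numbers \<open>r n\<close> keep the distance
  \<open>\<delta>\<close> from 1 and stay below \<open>r 0\<close>, so the continued integrals obey
  one bound for all \<open>n\<close> and the Weierstrass test applies on the whole box.\<close>

lemma off_term_series:
  assumes n0: "r n0 = 1" and l: "l \<le> M"
  obtains E where "E holomorphic_on U" "\<And>s. s \<in> U \<Longrightarrow> (\<lambda>n. off_term n0 l n s) sums E s"
proof -
  obtain \<delta> where \<delta>: "\<delta> > 0" "\<And>n. n \<noteq> n0 \<Longrightarrow> \<delta> \<le> \<bar>1 - r n\<bar>"
    using r_separated[OF n0] by blast
  obtain C where C: "C > 0" "\<And>u t. 1 / 2 + 1 / 2 - real K + real P < Re u \<Longrightarrow> Re u < real P - 1 \<Longrightarrow> \<bar>Im u\<bar> < Bu + 1 \<Longrightarrow>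
     0 < t \<Longrightarrow> t \<le> r 0 \<Longrightarrow> \<delta> \<le> \<bar>1 - t\<bar> \<Longrightarrow> norm (MB_cont K t P u) \<le> C * t powr (real K - 1 / 2)"
    using MB_cont_bounded[OF K_ge_2, of "1 / 2" "Bu + 1" \<delta> P "r 0"] \<delta>(1) Bu_nonneg by auto
  have r0: "r n \<le> r 0" for n using r_strict_antimono[of 0 n] by (cases "n = 0") auto
  have sU: "s \<in> Ucl" if "s \<in> U" for s using that U_subset by blast
  have hol: "off_term n0 l n holomorphic_on U" for n
  proof (cases "n = n0")
    case False
    have "MB_cont K (r n) P holomorphic_on {u. 1 / 2 + 1 / 2 - real K + real P < Re u \<and> Re u < real P - 1 \<and> \<bar>Im u\<bar> < Bu + 1}"
      using Bu_nonneg by (intro MB_cont_holomorphic K_ge_2 r_pos) auto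
    then have "(MB_cont K (r n) P \<circ> u l) holomorphic_on U"
      by (rule holomorphic_on_compose_gen[OF u_holomorphic]) (use MB_range[OF sU l] in blast)
    then show ?thesis
      using False unfolding off_term_def[abs_def] by (simp add: o_def holomorphic_on_mult dual_term_holomorphic)
  qed (simp add: off_term_def[abs_def])
  define h where "h n = C * Cr * (norm (A n) * exp (- 2 * ln_Suc n))" for n
  have bd: "norm (off_term n0 l n s) \<le> h n" if "s \<in> U" for n s
  proof (cases "n = n0")
    case True
    then show ?thesis using C(1) by (simp add: off_term_def h_def Cr_def)
  next
    case False
    have "norm (off_term n0 l n s) \<le> norm (dual_term n s) * (C * r n powr (real K - 1 / 2))"
      using MB_range[OF sU[OF that] l] \<delta>(2)[OF False] r0 r_pos False
      by (auto simp: off_term_def norm_mult intro!: mult_left_mono C(2))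
    also have "\<dots> = C * (norm (dual_term n s) * r n powr (real K - 1 / 2))" by simp
    also have "\<dots> \<le> C * (Cr * (norm (A n) * exp (- 2 * ln_Suc n)))"
      using C(1) by (intro mult_left_mono dual_term_bound sU that) auto
    finally show ?thesis by (simp add: h_def mult.assoc)
  qed
  have h: "summable h" unfolding h_def by (intro summable_mult summable_coeffs) simp
  show ?thesis
    using holomorphic_series[OF open_U hol bd h] that by blast
qed

text \<open>Only \<open>n0\<close> yields poles. There the integral is known in closed form,
  \<open>- Gamma (u + K) / (u * fact (K - 1))\<close>, and \<open>u = - d (s - s_star D l)\<close>
  displays the pole. All other contributions are collected in \<open>H\<close>.\<close>

lemma twist_formula:
  assumes n0: "r n0 = 1"
  obtains H where "H holomorphic_on U"
    "\<And>s. s \<in> U \<Longrightarrow> Re s \<ge> 3 \<Longrightarrow> standard_twist_series a D \<alpha> s =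
       H s + (\<Sum>l\<le>M. c l * (\<kappa> s * dual_term n0 s * (Gamma (u l s + of_nat K) / (of_real d * fact (K - 1)))) / (s - s_star D l))"
proof -
  have "\<forall>l\<in>{..M}. \<exists>E. E holomorphic_on U \<and> (\<forall>s\<in>U. (\<lambda>n. off_term n0 l n s) sums E s)"
    using off_term_series[OF n0] by (metis atMost_iff)
  then obtain E where E: "\<And>l. l \<le> M \<Longrightarrow> E l holomorphic_on U" "\<And>l s. l \<le> M \<Longrightarrow> s \<in> U \<Longrightarrow> (\<lambda>n. off_term n0 l n s) sums E l s"
    by (metis atMost_iff)
  define H where "H s = ((LINT v|lborel. \<Theta> s v) + contour_integral rect (mellin s (pi / 2)) / \<i>) / (2 * of_real pi)
    + \<kappa> s * (\<Sum>l\<le>M. c l * E l s)" for s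
  have "H holomorphic_on U"
    unfolding H_def[abs_def] by (intro holomorphic_intros \<Theta>_integral_holomorphic rect_holomorphic \<kappa>_holomorphic E(1)) auto
  moreover have "standard_twist_series a D \<alpha> s =
       H s + (\<Sum>l\<le>M. c l * (\<kappa> s * dual_term n0 s * (Gamma (u l s + of_nat K) / (of_real d * fact (K - 1)))) / (s - s_star D l))"
    if s: "s \<in> U" "Re s \<ge> 3" for s
  proof -
    have sU: "s \<in> Ucl" using s(1) U_subset by blast
    have sum: "(\<Sum>n. dual_term n s * MB K (u l s) (r n)) = E l s + dual_term n0 s * (Gamma (u l s + of_nat K) / (of_real d * fact (K - 1))) / (s - s_star D l)"
      if l: "l \<le> M" for l
    proof -
      have Re: "Re (u l s) \<le> -2" by (rule Re_u_initial[OF s(2)])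
      have "(\<lambda>n. if n = n0 then dual_term n0 s * MB K (u l s) 1 else 0) sums (dual_term n0 s * MB K (u l s) 1)"
        by (rule sums_single)
      then have "(\<lambda>n. off_term n0 l n s + (if n = n0 then dual_term n0 s * MB K (u l s) 1 else 0)) sums (E l s + dual_term n0 s * MB K (u l s) 1)"
        by (intro sums_add E(2) l s)
      moreover have "off_term n0 l n s + (if n = n0 then dual_term n0 s * MB K (u l s) 1 else 0) = dual_term n s * MB K (u l s) (r n)" for n
      proof (cases "n = n0")
        case False
        then have "r n \<noteq> 1" using r_strict_antimono[of n n0] r_strict_antimono[of n0 n] n0 by (cases "n < n0") auto
        then have "MB_cont K (r n) P (u l s) = MB K (u l s) (r n)"
          using MB_range[OF sU l] Re by (intro MB_cont_eq_MB K_ge_2 r_pos) auto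
        then show ?thesis using False by (simp add: off_term_def)
      qed (simp add: off_term_def n0)
      ultimately have 1: "(\<Sum>n. dual_term n s * MB K (u l s) (r n)) = E l s + dual_term n0 s * MB K (u l s) 1"
        by (simp add: sums_iff)
      have "MB K (u l s) 1 = - Gamma (u l s + of_nat K) / (u l s * fact (K - 1))"
        using MB_range[OF sU l] Re by (intro MB_at_1 K_ge_2) auto
      also have "\<dots> = (Gamma (u l s + of_nat K) / (of_real d * fact (K - 1))) / (s - s_star D l)"
      proof -
        have "u l s = - (of_real d * (s - s_star D l))" by (simp add: u_def algebra_simps)
        then show ?thesis by (simp add: mult_ac)
      qed
      finally show ?thesis unfolding 1 by simp
    qed
    have "(\<Sum>l\<le>M. c l * (\<Sum>n. dual_term n s * MB K (u l s) (r n))) = (\<Sum>l\<le>M. c l * E l s) + 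
       (\<Sum>l\<le>M. c l * (dual_term n0 s * (Gamma (u l s + of_nat K) / (of_real d * fact (K - 1))) / (s - s_star D l)))"
      unfolding sum.distrib[symmetric] by (intro sum.cong refl) (simp add: sum distrib_left)
    then show ?thesis
      unfolding twist_initial_MB[OF s] H_def by (simp add: distrib_left sum_distrib_left mult_ac)
  qed
  ultimately show ?thesis using that by blast
qed

end

subsection \<open>Poles and residues\<close>

text \<open>The conclusion concerns a punctured neighbourhood because a meromorphic function may
  take arbitrary values on a discrete set. Removing the singularities of the difference makes the
  identity theorem applicable across poles.\<close>

lemma meromorphic_identity:
  assumes G: "G meromorphic_on U" and f: "f meromorphic_on U" and U: "open U" "connected U"
    and V: "open V" "z1 \<in> V" "V \<subseteq> U" and eq: "\<And>z. z \<in> V \<Longrightarrow> G z = f z"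
    and z0: "z0 \<in> U"
  shows "eventually (\<lambda>z. G z = f z) (at z0)"
proof -
  define g where "g z = G z - f z" for z
  have g: "g meromorphic_on U"
    unfolding g_def[abs_def] by (intro meromorphic_intros G f)
  have iso: "isolated_singularity_at g z" if "z \<in> U" for z
    using g that by (meson meromorphic_on_isolated_singularity meromorphic_on_subset empty_subsetI insert_subset)
  have z1: "z1 \<in> U" using V by blast
  have "eventually (\<lambda>z. z \<in> V) (at z1)"
    using V by (simp add: eventually_at_in_open')
  then have "eventually (\<lambda>z. remove_sings g z = 0) (at z1)"
    using eventually_remove_sings_eq_at[OF iso[OF z1]] by eventually_elim (simp add: g_def eq)
  then have "frequently (\<lambda>z. remove_sings g z = 0) (at z1)"
    by (rule eventually_frequently[rotated]) simp
  then have zero: "remove_sings g z = 0" if "z \<in> U" for z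
    using frequently_eq_meromorphic_imp_constant[OF _ remove_sings_nicely_meromorphic[OF g] U z1 that] by blast
  have "eventually (\<lambda>z. z \<in> U) (at z0)"
    using U z0 by (simp add: eventually_at_in_open')
  then show ?thesis
    using eventually_remove_sings_eq_at[OF iso[OF z0]] by eventually_elim (simp add: zero g_def)
qed

context twist_box
begin

definition polar_coeff :: "nat \<Rightarrow> nat \<Rightarrow> complex \<Rightarrow> complex" where
  "polar_coeff n0 l s = \<kappa> s * dual_term n0 s * (Gamma (u l s + of_nat K) / (of_real d * fact (K - 1)))"

lemma polar_coeff_holomorphic: "l \<le> M \<Longrightarrow> polar_coeff n0 l holomorphic_on U"
  unfolding polar_coeff_def[abs_def] using d_pos MB_range(1)[of _ l] U_subset
  by (intro holomorphic_intros \<kappa>_holomorphic dual_term_holomorphic Re_pos_not_nonpos_Int) force+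

text \<open>At the pole \<open>u = 0\<close>, so \<open>Gamma K\<close> cancels
  \<open>fact (K - 1)\<close> and the auxiliary \<open>K\<close> disappears from the
  residue.\<close>

lemma polar_coeff_at_pole:
  "polar_coeff n0 l (s_star D l) = \<kappa> (s_star D l) * dual_term n0 (s_star D l) / of_real d"
proof -
  have "Gamma (of_nat K :: complex) = fact (K - 1)"
    using K_ge_2 Gamma_fact[of "K - 1", where 'a = complex] by (simp add: of_nat_diff)
  then show ?thesis
    by (simp add: polar_coeff_def u_def)
qed

text \<open>Truncation at \<open>M\<close> loses no pole: on the closed box
  \<open>Re (u l s) \<le> - 1\<close> for all \<open>l \<ge> M\<close>, while \<open>u l\<close>
  vanishes at \<open>s_star D l\<close>.\<close>

lemma s_star_not_in_U: "l \<ge> M \<Longrightarrow> s_star D l \<notin> U"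
proof
  assume l: "l \<ge> M" and s: "s_star D l \<in> U"
  have "Re (u M (s_star D l)) \<le> -1" using s U_subset by (intro Re_u_M) blast
  moreover have "Re (u l (s_star D l)) = 0" by (simp add: u_def)
  ultimately show False using l unfolding Re_u by simp
qed

end

context standard_twist
begin

definition residue_value :: "complex \<Rightarrow> nat \<Rightarrow> complex" where
  "residue_value an l = root_number D / of_real (sqrt (2 * pi)) / of_real d *
      exp (- \<i> * of_real (pi / 2) * (sel_xi D + of_real d * s_star D l)) *
      conductor_base D powr (of_real (d / 2) - of_real d * s_star D l) *
      (cnj an / of_real (n_alpha D \<alpha>) powr (1 - s_star D l))"

lemma series_holomorphic: "standard_twist_series a D \<alpha> holomorphic_on {s. Re s > 2}"
proof -
  define f where "f n s = A n * cexp1 (- \<alpha> * real (Suc n) powr (1 / d)) * exp (- s * of_real (ln_Suc n))" for n s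
  have bd: "norm (f n s) \<le> norm (A n) * exp (- 2 * ln_Suc n)" if "s \<in> {s. Re s > 2}" for n s
    using that ln_Suc_nonneg[of n]
    by (auto simp: f_def norm_mult norm_cexp1 norm_exp_eq_Re intro!: mult_left_mono mult_right_mono)
  have hol: "f n holomorphic_on {s. Re s > 2}" for n
    unfolding f_def[abs_def] by (intro holomorphic_intros)
  have h: "summable (\<lambda>n. norm (A n) * exp (- 2 * ln_Suc n))"
    by (intro summable_coeffs) simp
  obtain g where g: "g holomorphic_on {s. Re s > 2}" "\<And>s. s \<in> {s. Re s > 2} \<Longrightarrow> (\<lambda>n. f n s) sums g s"
    using holomorphic_series[OF open_halfspace_Re_gt hol bd h] by blast
  show ?thesis
  proof (rule holomorphic_transform[OF g(1)])
    fix s assume s: "s \<in> {s. Re s > 2}"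
    then have "(\<lambda>n. f n s) sums standard_twist_series a D \<alpha> s"
      unfolding f_def by (intro twist_series_sums) simp
    then show "g s = standard_twist_series a D \<alpha> s"
      using g(2)[OF s] sums_unique2 by blast
  qed
qed

text \<open>Every \<open>s0\<close> gets a box of its own, and the conclusion hides all its
  parameters except the truncation \<open>M\<close>. The point with real part \<open>7 / 2\<close>
  lies where the series formula is known and anchors the identity theorem.\<close>

lemma local_form:
  assumes n0: "n_alpha D \<alpha> = real (Suc n0)" and s0: "Re s0 < 4"
  obtains U H M A' where "open U" "connected U" "s0 \<in> U" "H holomorphic_on U"
    "\<And>l. l \<le> M \<Longrightarrow> A' l holomorphic_on U" "\<And>l. l > M \<Longrightarrow> s_star D l \<notin> U"
    "\<And>l. A' l (s_star D l) = residue_value (A n0) l"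
    "of_real (7 / 2) + \<i> * of_real (Im s0) \<in> U"
    "\<And>s. s \<in> U \<Longrightarrow> Re s \<ge> 3 \<Longrightarrow> standard_twist_series a D \<alpha> s = H s + (\<Sum>l\<le>(M::nat). c l * A' l s / (s - s_star D l))"
proof -
  \<comment> \<open>Below \<open>Re s0\<close> and at most 1, so that the box contains
    \<open>s0\<close> and reaches into \<open>Re s > 3\<close>.\<close>
  define \<sigma>1 where "\<sigma>1 = min (Re s0) 2 - 1"
  define Bd where "Bd = \<bar>Im s0\<bar> + 1"
  define M where "M = nat \<lceil>(d + 1) / 2 - d * \<sigma>1 + 1\<rceil>"
  define P where "P = nat \<lceil>(d + 1) / 2 - d * \<sigma>1 + 2\<rceil>"
  define K where "K = nat \<lceil>real M + 5 * d + real P + 3\<rceil>"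
  define b where "b = \<bar>d * (1 - \<sigma>1)\<bar> + 1"
  define T0 where "T0 = d * (Bd + 1)"
  have "twist_box a D F \<alpha> c \<sigma>1 Bd b T0 M P K"
  proof unfold_locales
    show "(d + 1) / 2 - real M - d * \<sigma>1 \<le> - 1" unfolding M_def by linarith
    have "(d + 1) / 2 - d * \<sigma>1 + 2 \<le> real P" unfolding P_def by linarith
    then show "(d + 1) / 2 - d * \<sigma>1 < real P - 1" by linarith
    show "real K \<ge> real M + 5 * d + real P + 3" unfolding K_def by linarith
  qed (auto simp: \<sigma>1_def Bd_def b_def T0_def)
  then interpret twist_box a D F \<alpha> c \<sigma>1 Bd b T0 M P K .
  have q: "sel_conductor D > 0" by (rule conductor_pos)
  have ln_n: "ln_Suc n0 = ln (sel_conductor D) - d * ln d + d * ln \<alpha>"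
  proof -
    have "ln_Suc n0 = ln (n_alpha D \<alpha>)" unfolding n0 ln_Suc_def ..
    also have "\<dots> = ln (sel_conductor D) + ln (d powr (- d)) + ln (\<alpha> powr d)"
      using q d_pos \<alpha>_pos by (simp add: n_alpha_def ln_mult)
    finally show ?thesis using d_pos \<alpha>_pos by (simp add: ln_powr)
  qed
  have ln_base: "ln base = ln (sel_conductor D) / d - ln (2 * pi) - ln d"
    using q d_pos by (simp add: base_def ln_div ln_mult ln_powr)
  \<comment> \<open>In logarithms:
    \<open>2 pi \<alpha> base = q powr (1 / d) * \<alpha> / d\<close>, with \<open>q\<close> the
    conductor, is the \<open>d\<close>-th root of \<open>n_alpha D \<alpha>\<close>.\<close>
  have "ln base + ln (2 * pi * \<alpha>) - ln_Suc n0 / d = 0"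
  proof -
    have "ln (2 * pi * \<alpha>) = ln (2 * pi) + ln \<alpha>" using \<alpha>_pos by (simp add: ln_mult)
    moreover have "ln_Suc n0 / d = ln (sel_conductor D) / d - ln d + ln \<alpha>"
      unfolding ln_n using d_pos by (simp add: add_divide_distrib diff_divide_distrib)
    ultimately show ?thesis unfolding ln_base by simp
  qed
  then have r1: "r n0 = 1" by (simp add: r_def)
  obtain H where H: "H holomorphic_on U"
    "\<And>s. s \<in> U \<Longrightarrow> Re s \<ge> 3 \<Longrightarrow> standard_twist_series a D \<alpha> s =
       H s + (\<Sum>l\<le>M. c l * (\<kappa> s * dual_term n0 s * (Gamma (u l s + of_nat K) / (of_real d * fact (K - 1)))) / (s - s_star D l))"
    using twist_formula[OF r1] by blast
  have val: "polar_coeff n0 l (s_star D l) = residue_value (A n0) l" for l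
  proof -
    \<comment> \<open>The powers of \<open>\<i>\<close> left by the sines account for the
      \<open>- 1 / 2\<close> in the definition of \<open>sel_xi\<close>, one quarter turn for each
      Gamma factor.\<close>
    have ipow: "\<i> ^ num_gamma D = exp (\<i> * of_real (pi / 2) * of_nat (num_gamma D))"
    proof -
      have "exp (\<i> * of_real (pi / 2)) = \<i>" by (metis cis_conv_exp cis_pi_half)
      then show ?thesis by (simp only: exp_of_nat2_mult)
    qed
    have xi: "sel_xi D = 2 * sum_mu - of_nat (num_gamma D)"
      by (simp add: sel_xi_def sum_mu_def sum_subtractf right_diff_distrib)
    have "\<i> * of_real (pi / 2) * of_nat (num_gamma D) + - \<i> * of_real pi * (of_real (d / 2) * s_star D l + sum_mu)
        = - \<i> * of_real (pi / 2) * (sel_xi D + of_real d * s_star D l)"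
      unfolding xi by (simp add: field_simps)
    then have 1: "\<i> ^ num_gamma D * exp (- \<i> * of_real pi * (of_real (d / 2) * s_star D l + sum_mu))
        = exp (- \<i> * of_real (pi / 2) * (sel_xi D + of_real d * s_star D l))"
      unfolding ipow exp_add[symmetric] by simp
    have "conductor_base D = of_real base" by (simp only: conductor_base_def base_def)
    then have 2: "conductor_base D powr (of_real (d / 2) - of_real d * s_star D l) = exp ((of_real (d / 2) - of_real d * s_star D l) * of_real (ln base))"
      using base_pos by (simp add: powr_def Ln_of_real)
    have "of_real (n_alpha D \<alpha>) powr (1 - s_star D l) = exp ((1 - s_star D l) * of_real (ln_Suc n0))"
      unfolding n0 ln_Suc_def by (simp add: powr_def Ln_of_real del: of_nat_Suc)
    then have 3: "cnj (A n0) / of_real (n_alpha D \<alpha>) powr (1 - s_star D l) = dual_term n0 (s_star D l)"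
      by (simp only: dual_term_def mult_minus_left exp_minus divide_inverse)
    show ?thesis
      unfolding polar_coeff_at_pole residue_value_def 2 3 1[symmetric] \<kappa>_def coeff0_def by simp
  qed
  show ?thesis
  proof (rule that[of U H M "polar_coeff n0"])
    show "s0 \<in> U" unfolding U_def using s0 by (auto simp: \<sigma>1_def Bd_def)
    show "of_real (7 / 2) + \<i> * of_real (Im s0) \<in> U" unfolding U_def by (auto simp: \<sigma>1_def Bd_def)
    show "connected U" using convex_U by (rule convex_connected)
  qed (use open_U H polar_coeff_holomorphic s_star_not_in_U val in \<open>auto simp: polar_coeff_def\<close>)
qed

lemma s_star_inj: "s_star D k = s_star D l \<Longrightarrow> k = l"
proof -
  assume "s_star D k = s_star D l"
  then have "Re (s_star D k) = Re (s_star D l)" by simp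
  then show "k = l" using d_pos by (simp add: s_star_def)
qed

lemma Re_s_star_le: "Re (s_star D l) \<le> 1"
proof -
  have "(d + 1) / (2 * d) \<le> 1" using degree_ge_1 by (simp add: divide_le_eq)
  moreover have "real l / d \<ge> 0" using d_pos by simp
  ultimately show ?thesis by (simp add: s_star_def)
qed

lemma residue_value_nonzero: "an \<noteq> 0 \<Longrightarrow> residue_value an l \<noteq> 0"
proof -
  assume an: "an \<noteq> 0"
  have "fe_omega D \<noteq> 0" using data_valid(2) by auto
  then have rn: "root_number D \<noteq> 0"
    using data_valid(3) unfolding root_number_def by (auto simp: less_imp_neq[symmetric])
  have "conductor_base D = of_real base" by (simp only: conductor_base_def base_def)
  moreover have "n_alpha D \<alpha> > 0" using conductor_pos d_pos \<alpha>_pos by (simp add: n_alpha_def)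
  ultimately show ?thesis
    using an rn base_pos d_pos by (simp add: residue_value_def)
qed

text \<open>Residue and pole are both read off a local form \<open>N / (s - s0)\<close> with
  \<open>N\<close> holomorphic. For \<open>c l = 0\<close> this form does not display regularity, so
  a holomorphic function agreeing with \<open>G\<close> near the point is recorded as well.\<close>

lemma residue_and_poles:
  assumes n0: "n_alpha D \<alpha> = real (Suc n0)" and A0: "A n0 \<noteq> 0"
    and G: "is_standard_twist a D \<alpha> G"
  shows "residue G (s_star D l) = c l * residue_value (A n0) l"
    and "is_pole G s \<longleftrightarrow> (\<exists>l. s = s_star D l \<and> c l \<noteq> 0)"
proof -
  have mero: "G meromorphic_on UNIV" and series: "\<And>s. Re s > 1 \<Longrightarrow> G s = standard_twist_series a D \<alpha> s"
    using G by (auto simp: is_standard_twist_def)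
  have local: "\<exists>V N. open V \<and> s0 \<in> V \<and> N holomorphic_on V \<and>
      ((\<exists>l. s0 = s_star D l \<and> N s0 = c l * residue_value (A n0) l \<and> (c l = 0 \<longrightarrow> (\<exists>H. H holomorphic_on V \<and> eventually (\<lambda>s. G s = H s) (at s0))) \<and> eventually (\<lambda>s. G s = N s / (s - s0)) (at s0))
       \<or> (\<nexists>l. s0 = s_star D l) \<and> eventually (\<lambda>s. G s = N s) (at s0))" if s0: "Re s0 < 4" for s0
  proof -
    obtain U H M A' where U: "open U" "connected U" "s0 \<in> U" and H: "H holomorphic_on U"
      and A': "\<And>l. l \<le> M \<Longrightarrow> A' l holomorphic_on U" and M: "\<And>l. l > M \<Longrightarrow> s_star D l \<notin> U"
      and val: "\<And>l. A' l (s_star D l) = residue_value (A n0) l"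
      and z1: "of_real (7 / 2) + \<i> * of_real (Im s0) \<in> U"
      and eq: "\<And>s. s \<in> U \<Longrightarrow> Re s \<ge> 3 \<Longrightarrow> standard_twist_series a D \<alpha> s = H s + (\<Sum>l\<le>(M::nat). c l * A' l s / (s - s_star D l))"
      using local_form[OF n0 s0] by blast
    define f where "f s = H s + (\<Sum>l\<le>M. c l * A' l s / (s - s_star D l))" for s
    have hol_mero: "g meromorphic_on U" if "g holomorphic_on U" for g
      using that U(1) by (simp add: analytic_on_imp_meromorphic_on analytic_on_open)
    have f: "f meromorphic_on U"
      unfolding f_def[abs_def] by (intro meromorphic_intros hol_mero H A' holomorphic_on_const holomorphic_on_ident) auto
    have Gf: "eventually (\<lambda>s. G s = f s) (at s0)"
    proof (rule meromorphic_identity[OF meromorphic_on_subset[OF mero] f U(1,2) _ _ _ _ U(3)])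
      show "open (U \<inter> {s. Re s > 3})" using U(1) by (intro open_Int open_halfspace_Re_gt)
      show "of_real (7 / 2) + \<i> * of_real (Im s0) \<in> U \<inter> {s. Re s > 3}" using z1 by simp
      show "G s = f s" if "s \<in> U \<inter> {s. Re s > 3}" for s
        using that eq[of s] series[of s] by (simp add: f_def)
    qed auto
    \<comment> \<open>The finitely many other candidate poles are cut out, leaving \<open>s0\<close>
      as the only possible singularity.\<close>
    define Z where "Z = s_star D ` {..M} - {s0}"
    define V where "V = U - Z"
    have V: "open V" "s0 \<in> V" "V \<subseteq> U" using U by (auto simp: V_def Z_def intro!: open_Diff finite_imp_closed)
    have part: "(\<lambda>s. c k * A' k s / (s - s_star D k)) holomorphic_on V" if "k \<le> M" "s_star D k \<noteq> s0" for k
    proof (intro holomorphic_intros holomorphic_on_subset[OF A'[OF that(1)] V(3)])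
      show "s - s_star D k \<noteq> 0" if "s \<in> V" for s
        using that \<open>k \<le> M\<close> \<open>s_star D k \<noteq> s0\<close> by (auto simp: V_def Z_def)
    qed
    show ?thesis
    proof (cases "\<exists>l. s0 = s_star D l")
      case True
      then obtain l where l: "s0 = s_star D l" by blast
      then have lM: "l \<le> M" using M[of l] U(3) by (meson not_le)
      define H' where "H' s = H s + (\<Sum>k\<in>{..M} - {l}. c k * A' k s / (s - s_star D k))" for s
      have H': "H' holomorphic_on V"
        unfolding H'_def[abs_def] 
        by (intro holomorphic_intros holomorphic_on_subset[OF H V(3)] part) (use l s_star_inj in auto)
      have f_split: "f s = H' s + c l * A' l s / (s - s0)" for s
        unfolding f_def H'_def using lM by (simp add: sum.remove[of "{..M}" l] l)
      define N where "N s = H' s * (s - s0) + c l * A' l s" for s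
      have N: "N holomorphic_on V"
        unfolding N_def[abs_def] by (intro holomorphic_intros H' holomorphic_on_subset[OF A'[OF lM] V(3)])
      have "eventually (\<lambda>s. s \<noteq> s0) (at s0)" by (simp add: eventually_at_filter)
      with Gf have "eventually (\<lambda>s. G s = N s / (s - s0)) (at s0)"
        by eventually_elim (simp add: f_split N_def field_simps)
      moreover have "N s0 = c l * residue_value (A n0) l" by (simp add: N_def val l)
      moreover have "\<exists>H. H holomorphic_on V \<and> eventually (\<lambda>s. G s = H s) (at s0)" if "c l = 0"
        using H' Gf that by (intro exI[of _ H']) (simp add: f_split)
      ultimately show ?thesis using V N l by blast
    next
      case False
      have "f holomorphic_on V"
        unfolding f_def[abs_def] by (intro holomorphic_intros holomorphic_on_subset[OF H V(3)] part) (use False in auto)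
      then show ?thesis using V Gf False by blast
    qed
  qed
  show "residue G (s_star D l) = c l * residue_value (A n0) l"
  proof -
    have "Re (s_star D l) < 4" using Re_s_star_le[of l] by simp
    from local[OF this] obtain V N where V: "open V" "s_star D l \<in> V" "N holomorphic_on V"
      and N: "N (s_star D l) = c l * residue_value (A n0) l" "eventually (\<lambda>s. G s = N s / (s - s_star D l)) (at (s_star D l))"
      using s_star_inj by metis
    have "residue G (s_star D l) = residue (\<lambda>s. N s / (s - s_star D l)) (s_star D l)"
      by (rule residue_cong[OF N(2) refl])
    also have "\<dots> = N (s_star D l)" by (rule residue_simple[OF V])
    finally show ?thesis using N(1) by simp
  qed
  show "is_pole G s \<longleftrightarrow> (\<exists>l. s = s_star D l \<and> c l \<noteq> 0)"
  proof (cases "Re s < 4")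
    case True
    have hol: "\<not> is_pole G s" if "open V" "s \<in> V" "H holomorphic_on V" "eventually (\<lambda>z. G z = H z) (at s)" for V H
      using not_is_pole_holomorphic[OF that(1-3)] is_pole_cong[OF that(4) refl] by blast
    obtain V N where V: "open V" "s \<in> V" "N holomorphic_on V"
      and cases: "(\<exists>l. s = s_star D l \<and> N s = c l * residue_value (A n0) l \<and> (c l = 0 \<longrightarrow> (\<exists>H. H holomorphic_on V \<and> eventually (\<lambda>z. G z = H z) (at s))) \<and> eventually (\<lambda>z. G z = N z / (z - s)) (at s))
       \<or> (\<nexists>l. s = s_star D l) \<and> eventually (\<lambda>z. G z = N z) (at s)"
      using local[OF True] by blast
    from cases show ?thesis
    proof
      assume "(\<nexists>l. s = s_star D l) \<and> eventually (\<lambda>z. G z = N z) (at s)"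
      then show ?thesis using hol[OF V] by blast
    next
      assume "\<exists>l. s = s_star D l \<and> N s = c l * residue_value (A n0) l \<and> (c l = 0 \<longrightarrow> (\<exists>H. H holomorphic_on V \<and> eventually (\<lambda>z. G z = H z) (at s))) \<and> eventually (\<lambda>z. G z = N z / (z - s)) (at s)"
      then obtain l where l: "s = s_star D l" "N s = c l * residue_value (A n0) l"
        "c l = 0 \<longrightarrow> (\<exists>H. H holomorphic_on V \<and> eventually (\<lambda>z. G z = H z) (at s))" "eventually (\<lambda>z. G z = N z / (z - s)) (at s)"
        by blast
      show ?thesis
      proof (cases "c l = 0")
        case True
        then have "\<not> is_pole G s" using l(3) hol V by blast
        moreover have "\<not> (\<exists>k. s = s_star D k \<and> c k \<noteq> 0)" using True l(1) s_star_inj by metis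
        ultimately show ?thesis by blast
      next
        case False
        have "is_pole (\<lambda>z. N z / (z - s)) s"
        proof (rule is_pole_divide)
          show "isCont N s" using V holomorphic_on_imp_continuous_on continuous_on_eq_continuous_at by blast
          show "filterlim (\<lambda>z. z - s) (at 0) (at s)"
            by (auto simp: filterlim_at eventually_at_filter intro!: tendsto_eq_intros)
          show "N s \<noteq> 0" using l(2) False residue_value_nonzero[OF A0] by simp
        qed
        then have "is_pole G s" using is_pole_cong[OF l(4) refl] by blast
        then show ?thesis using l(1) False by blast
      qed
    qed
  next
    case False
    \<comment> \<open>The boxes end at real part 4; further right the Dirichlet series itself is
      holomorphic.\<close>
    have "\<not> is_pole (standard_twist_series a D \<alpha>) s"
      using False by (intro not_is_pole_holomorphic[OF open_halfspace_Re_gt _ series_holomorphic]) simp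
    moreover have "eventually (\<lambda>z. G z = standard_twist_series a D \<alpha> z) (at s)"
    proof -
      have "eventually (\<lambda>z. z \<in> {z. Re z > 2}) (at s)"
        using False by (intro eventually_at_in_open' open_halfspace_Re_gt) simp
      then show ?thesis by eventually_elim (simp add: series)
    qed
    ultimately have "\<not> is_pole G s" using is_pole_cong[OF _ refl] by blast
    moreover have "s \<noteq> s_star D l" for l using Re_s_star_le[of l] False by auto
    ultimately show ?thesis by blast
  qed
qed

end

theorem theorem3:
  fixes a :: "nat \<Rightarrow> complex" and D :: fe_data and F :: "complex \<Rightarrow> complex"
    and c :: "nat \<Rightarrow> complex"
  assumes "extended_selberg a D F"
    and "sel_degree D \<ge> 1"
    and "structural_coeffs D c"
  shows "\<forall>\<alpha>\<in>Spec a D. \<forall>G. is_standard_twist a D \<alpha> G \<longrightarrow>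
      (\<forall>l. residue G (s_star D l) =
        c l / of_real (sel_degree D) * (root_number D / of_real (sqrt (2 * pi))) *
        exp (- \<i> * of_real (pi / 2) * (sel_xi D + of_real (sel_degree D) * s_star D l)) *
        conductor_base D powr (of_real (sel_degree D / 2) - of_real (sel_degree D) * s_star D l) *
        (cnj (coeff_at a (n_alpha D \<alpha>)) / of_real (n_alpha D \<alpha>) powr (1 - s_star D l))) \<and>
      {s. is_pole G s} = {s_star D l |l. c l \<noteq> 0}"
proof (intro ballI allI impI, goal_cases)
  case (1 \<alpha> G)
  have pos: "\<alpha> > 0" and ne: "coeff_at a (n_alpha D \<alpha>) \<noteq> 0"
    using 1 by (auto simp: Spec_def)
  interpret standard_twist a D F \<alpha> c
    by unfold_locales (use assms pos in auto)
  have n: "n_alpha D \<alpha> > 0"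
    using conductor_pos d_pos pos by (simp add: n_alpha_def)
  have "n_alpha D \<alpha> \<in> \<nat>"
    using ne by (auto simp: coeff_at_def split: if_splits)
  then obtain k where k: "n_alpha D \<alpha> = real k"
    by (auto elim: Nats_cases)
  \<comment> \<open>Positivity excludes \<open>k = 0\<close>, so the resonant integer is a genuine
    index of the Dirichlet series.\<close>
  with n obtain n0 where n0: "n_alpha D \<alpha> = real (Suc n0)"
    by (cases k) auto
  have coeff: "coeff_at a (n_alpha D \<alpha>) = a (Suc n0)"
    unfolding n0 by (simp add: coeff_at_def del: of_nat_Suc)
  have "a (Suc n0) \<noteq> 0"
    using ne coeff by simp
  note main = residue_and_poles[OF n0 this 1(2)]
  have "{s. is_pole G s} = {s_star D l |l. c l \<noteq> 0}"
    using main(2) by auto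
  then show ?case
    unfolding main(1) coeff residue_value_def by (simp add: mult_ac)
qed

end
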